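(* Let $d$ be a positive integer. For any $\theta>0$ there exists $\epsilon=\epsilon(d,\theta)>0$ with the following property. Let $\delta>0$. Then there exists a positive integer $k=k(d,\delta)$ (depending only on $d$ and $\delta$) with the following property. For all positive integers $n_1,\dots,n_d$, for any $\mathcal B'\subset\mathcal B$ with $|\mathcal B'|\ge\delta|\mathcal B|$ and any $\mathcal A\subset\mathcal G$ which is $(\mathcal B',1-\epsilon)$-closed, there exists a $k$-simple set $\mathcal D\subset\mathcal G$ such that $|\mathcal D\cap\mathcal A|\ge(1-\theta)|\mathcal D|$.
   Context: $\mathcal G=\mathbb F_2^{n_1}\otimes\dots\otimes\mathbb F_2^{n_d}$. $\mathcal B$ is the multiset $\{u_1\otimes\dots\otimes u_d: u_i\in\mathbb F_2^{n_i}\text{ for all }i\}$, with one element for each tuple $(u_1,\dots,u_d)$ (zero vectors allowed, so $|\mathcal B|=2^{n_1+\dots+n_d}$). $\mathcal B'\subset\mathcal B$ denotes a sub-multiset; sizes of multisets are counted with multiplicity. For a finite non-empty subset $A$ of an Abelian group and a finite non-empty (multi)set $B$ of elements of the group, $A$ is $(B,\eta)$-closed if $|\{(a,b)\in A\times B: a+b\in A\}|\ge\eta|A||B|$ (elements of $B$ counted with multiplicity). For a non-empty $I\subset[d]=\{1,\dots,d\}$ write $\mathbb F_2^I=\bigotimes_{i\in I}\mathbb F_2^{n_i}$ and $I^c=[d]\setminus I$, so that $\mathcal G=\mathbb F_2^I\otimes\mathbb F_2^{I^c}$ naturally. A set $\mathcal C\subset\mathcal G$ is $k$-simple if there exist subspaces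 $H_I\subset\mathbb F_2^I$ of codimension at most $k$, one for each non-empty $I\subset[d]$, such that $\mathcal C$ is a translate of $\bigcap_{I\subset[d],I\ne\emptyset}(H_I\otimes\mathbb F_2^{I^c})$, where $H_{[d]}\otimes\mathbb F_2^{\emptyset}$ means $H_{[d]}$. *)

theory Defs
  imports Complex_Main "HOL-Library.FuncSet" "HOL-Library.Multiset"
    "HOL-Library.Function_Algebras" "HOL-Library.Z2"
begin

text \<open>
  The field with two elements is the library type \<^typ>\<open>bit\<close>.  The group structure on functions
  is the pointwise one of \<^theory>\<open>HOL-Library.Function_Algebras\<close>; here is the matching
  scalar multiplication.
\<close>

definition fun_scale :: "bit \<Rightarrow> ('a \<Rightarrow> bit) \<Rightarrow> 'a \<Rightarrow> bit"
  where "fun_scale c x = (\<lambda>m. c * x m)"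

global_interpretation fun_vs: vector_space "fun_scale :: bit \<Rightarrow> ('a \<Rightarrow> bit) \<Rightarrow> 'a \<Rightarrow> bit"
  by unfold_locales (auto simp: fun_scale_def fun_eq_iff algebra_simps)

text \<open>
  Tensor products of the coordinate spaces \<open>F\<^sub>2^(n i)\<close> are modelled as spaces of arrays:
  an element of the tensor product over \<open>i \<in> I\<close> is an array indexed by the multi-indices \<open>m\<close>
  with \<open>m i < n i\<close> for \<open>i \<in> I\<close>.  Multi-indices are extensional functions on \<open>I\<close>, and arrays
  vanish outside the multi-indices, so that distinct functions are distinct tensors.
  For empty \<open>I\<close> there is exactly one multi-index, and the space is the field itself.
\<close>

definition multi_idx :: "(nat \<Rightarrow> nat) \<Rightarrow> nat set \<Rightarrow> (nat \<Rightarrow> nat) set"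
  where "multi_idx n I = (\<Pi>\<^sub>E i\<in>I. {..<n i})"

definition tensor_space :: "(nat \<Rightarrow> nat) \<Rightarrow> nat set \<Rightarrow> ((nat \<Rightarrow> nat) \<Rightarrow> bit) set"
  where "tensor_space n I = {x. \<forall>m. m \<notin> multi_idx n I \<longrightarrow> x m = 0}"

definition coord_space :: "nat \<Rightarrow> (nat \<Rightarrow> bit) set"
  where "coord_space N = {v. \<forall>j. \<not> j < N \<longrightarrow> v j = 0}"

definition pure_tensor :: "(nat \<Rightarrow> nat) \<Rightarrow> nat set \<Rightarrow> (nat \<Rightarrow> nat \<Rightarrow> bit) \<Rightarrow> (nat \<Rightarrow> nat) \<Rightarrow> bit"
  where "pure_tensor n I u = (\<lambda>m. if m \<in> multi_idx n I then \<Prod>i\<in>I. u i (m i) else 0)"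

definition pure_tensors :: "nat \<Rightarrow> (nat \<Rightarrow> nat) \<Rightarrow> ((nat \<Rightarrow> nat) \<Rightarrow> bit) multiset"
  where "pure_tensors d n =
    image_mset (pure_tensor n {1..d}) (mset_set (\<Pi>\<^sub>E i\<in>{1..d}. coord_space (n i)))"

text \<open>\<open>mset_set\<close> is empty on infinite sets, so the multiset above deserves a size check.\<close>

lemma coord_space_eq_image: "coord_space N = (\<lambda>S j. of_bool (j \<in> S)) ` Pow {..<N}"
proof
  show "coord_space N \<subseteq> (\<lambda>S j. of_bool (j \<in> S)) ` Pow {..<N}"
  proof
    fix v assume v: "v \<in> coord_space N"
    have "v = (\<lambda>j. of_bool (j \<in> {j. v j = 1}))" by (auto simp: fun_eq_iff)
    moreover have "{j. v j = 1} \<in> Pow {..<N}" using v by (fastforce simp: coord_space_def)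
    ultimately show "v \<in> (\<lambda>S j. of_bool (j \<in> S)) ` Pow {..<N}" by blast
  qed
qed (auto simp: coord_space_def)

lemma card_coord_space: "card (coord_space N) = 2 ^ N"
proof -
  have "inj_on (\<lambda>S j. of_bool (j \<in> S) :: bit) (Pow {..<N})"
    by (auto simp: inj_on_def fun_eq_iff)
  then show ?thesis
    by (simp add: coord_space_eq_image card_image card_Pow)
qed

lemma size_pure_tensors: "size (pure_tensors d n) = 2 ^ (\<Sum>i=1..d. n i)"
  by (simp add: pure_tensors_def card_PiE card_coord_space power_sum)

text \<open>
  For disjoint \<open>I\<close> and \<open>J\<close>, the natural bilinear map from the spaces over \<open>I\<close> and \<open>J\<close> to the
  space over \<open>I \<union> J\<close>, and the tensor product of two subspaces as a subspace of the latter.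
\<close>

definition tensor_mult ::
    "(nat \<Rightarrow> nat) \<Rightarrow> nat set \<Rightarrow> nat set \<Rightarrow> ((nat \<Rightarrow> nat) \<Rightarrow> bit) \<Rightarrow> ((nat \<Rightarrow> nat) \<Rightarrow> bit) \<Rightarrow>
      (nat \<Rightarrow> nat) \<Rightarrow> bit"
  where "tensor_mult n I J x y =
    (\<lambda>m. if m \<in> multi_idx n (I \<union> J) then x (restrict m I) * y (restrict m J) else 0)"

definition tensor_subspaces ::
    "(nat \<Rightarrow> nat) \<Rightarrow> nat set \<Rightarrow> nat set \<Rightarrow> ((nat \<Rightarrow> nat) \<Rightarrow> bit) set \<Rightarrow> ((nat \<Rightarrow> nat) \<Rightarrow> bit) set \<Rightarrow>
      ((nat \<Rightarrow> nat) \<Rightarrow> bit) set"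
  where "tensor_subspaces n I J U V = fun_vs.span {tensor_mult n I J x y |x y. x \<in> U \<and> y \<in> V}"

lemma tensor_mult_pure_tensor:
  assumes "finite I" "finite J" "I \<inter> J = {}"
  shows "tensor_mult n I J (pure_tensor n I u) (pure_tensor n J u) = pure_tensor n (I \<union> J) u"
proof
  fix m
  show "tensor_mult n I J (pure_tensor n I u) (pure_tensor n J u) m = pure_tensor n (I \<union> J) u m"
  proof (cases "m \<in> multi_idx n (I \<union> J)")
    case True
    then have "restrict m I \<in> multi_idx n I" "restrict m J \<in> multi_idx n J"
      by (auto simp: multi_idx_def)
    with True assms show ?thesis
      by (simp add: tensor_mult_def pure_tensor_def prod.union_disjoint)
  qed (simp add: tensor_mult_def pure_tensor_def)
qed

text \<open>
  The convention that tensoring with the empty tensor product changes nothing needs no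
  special case.
\<close>

lemma tensor_subspaces_empty:
  assumes "fun_vs.subspace H" "H \<subseteq> tensor_space n I"
  shows "tensor_subspaces n I {} H (tensor_space n {}) = H"
proof -
  have *: "tensor_mult n I {} x y = fun_scale (y (\<lambda>_. undefined)) x" if "x \<in> H" for x y
  proof
    fix m
    show "tensor_mult n I {} x y m = fun_scale (y (\<lambda>_. undefined)) x m"
    proof (cases "m \<in> multi_idx n I")
      case True
      then have "restrict m I = m"
        by (auto simp: multi_idx_def PiE_def extensional_restrict)
      with True show ?thesis
        by (simp add: tensor_mult_def fun_scale_def restrict_def)
    next
      case False
      then have "x m = 0" using that assms(2) by (auto simp: tensor_space_def)
      with False show ?thesis by (simp add: tensor_mult_def fun_scale_def)
    qed
  qed
  define e where "e = (\<lambda>m::nat \<Rightarrow> nat. if m = (\<lambda>_. undefined) then 1 else 0 :: bit)"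
  have e: "e \<in> tensor_space n {}"
    by (auto simp: e_def tensor_space_def multi_idx_def)
  have "{tensor_mult n I {} x y |x y. x \<in> H \<and> y \<in> tensor_space n {}} = H" (is "?S = H")
  proof
    show "?S \<subseteq> H" using * assms(1) by (auto intro: fun_vs.subspace_scale)
    show "H \<subseteq> ?S"
    proof
      fix x assume x: "x \<in> H"
      then have "x = tensor_mult n I {} x e" by (simp add: * e_def)
      with x e show "x \<in> ?S" by blast
    qed
  qed
  then show ?thesis
    using assms(1) by (simp add: tensor_subspaces_def fun_vs.span_eq_iff)
qed

definition closed_wrt :: "'g::ab_group_add multiset \<Rightarrow> real \<Rightarrow> 'g set \<Rightarrow> bool"
  where "closed_wrt B \<eta> A \<longleftrightarrow> finite A \<and> A \<noteq> {} \<and> B \<noteq> {#} \<and>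
    real (\<Sum>b\<in>#B. card {a \<in> A. a + b \<in> A}) \<ge> \<eta> * real (card A) * real (size B)"

definition simple_set :: "nat \<Rightarrow> (nat \<Rightarrow> nat) \<Rightarrow> nat \<Rightarrow> ((nat \<Rightarrow> nat) \<Rightarrow> bit) set \<Rightarrow> bool"
  where "simple_set d n k C \<longleftrightarrow>
    (\<exists>H g. (\<forall>I. I \<subseteq> {1..d} \<and> I \<noteq> {} \<longrightarrow>
              H I \<subseteq> tensor_space n I \<and> fun_vs.subspace (H I) \<and>
              int (fun_vs.dim (tensor_space n I)) - int (fun_vs.dim (H I)) \<le> int k) \<and>
           g \<in> tensor_space n {1..d} \<and>
           C = (\<lambda>x. g + x) `
             (\<Inter>I\<in>{I. I \<subseteq> {1..d} \<and> I \<noteq> {}}.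
                tensor_subspaces n I ({1..d} - I) (H I) (tensor_space n ({1..d} - I))))"

end

theory Submission
  imports Defs
begin

text \<open>
  Let \<open>w(r)\<close> be the normalised square of the Fourier coefficient of \<open>A\<close> at \<open>r\<close>.  The proportion of
  \<open>a \<in> A\<close> with \<open>a + t \<notin> A\<close> is twice the \<open>w\<close>-mass of the \<open>r\<close> with \<open>r\<cdot>t = 1\<close>.  So if \<open>A\<close> is almost closed
  under \<open>B'\<close>, then almost all of the mass lies on tensors \<open>r\<close> orthogonal to most of \<open>B'\<close>.  If all those
  tensors lie in one sum, over \<open>I\<close>, of \<open>V\<^sub>I\<close> tensored with the full space over the complement of \<open>I\<close>,
  where each \<open>V\<^sub>I\<close> has bounded dimension, then they are orthogonal to the \<open>k\<close>-simple subspace given by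
  the annihilators of the \<open>V\<^sub>I\<close>.  Hence \<open>A\<close> is almost closed under that subspace as well, and averaging
  over \<open>A\<close> finds a dense coset.

  Tensors are treated as multilinear forms on tuples of vectors.  Two facts give the structure.
  First, there is a tree of boundedly many linear conditions on each coordinate (depending on the
  earlier coordinates) such that every form vanishing on most of \<open>B'\<close> vanishes on the whole tree; this
  goes by induction on the number of coordinates, with a version of Bogolyubov's lemma in which every
  subset carrying most of the weight still represents the whole subspace.  Second, the forms
  vanishing on a tree are structured: write such a form as a polynomial in boundedly many forms, and
  as long as some linear combination of these has a partial gradient that is often captured by the
  tree, trade one of them for members of a fixed bounded set of forms and for forms on fewer
  coordinates.  Once no such combination is left, the forms take all possible values on the tree,
  hence the polynomial is zero.
\<close>

text \<open>The order of quantifiers shapes the proof. Since \<epsilon> may not depend on \<delta>,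
  the level \<beta> below which a form counts as vanishing on most of \<open>B'\<close> must depend
  on \<open>d\<close> alone, while widths of trees and sizes of families may depend on \<delta>.
  Moreover the tree and the family have to be fixed before the form, because the same subspaces must
  handle all surviving frequencies. So Bogolyubov's lemma has to hold for every heavy subset at
  once: the slices on which a form behaves well depend on the form.

  The exchange of forms meets the same obstacle. The forms of the fixed set come from a maximal
  independent set of candidates, determined before any particular form is given. The number of
  auxiliary forms may grow with each trade, so what decreases is the multiset of their degrees. That
  a dependent combination can be traded at all rests on the result for fewer coordinates: the
  gradient of a form on at most \<open>d\<close> coordinates lives on at most \<open>d - 1\<close>,
  and a gradient that often vanishes makes the form a combination of products of forms on fewer
  coordinates.\<close>

subsection \<open>Bit vectors and the Fourier transform\<close>

text \<open>Sums and products of bits stay in ring form instead of becoming bit operations.\<close>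

declare add_bit_eq_xor [simp del] mult_bit_eq_and [simp del]

lemma bit_add_self [simp]: "(b::bit) + b = 0" "b + (b + c) = c"
  by (cases b; cases c; simp)+

lemma bit_fun_add_self [simp]: "(x :: 'a \<Rightarrow> bit) + x = 0" "x + (x + y) = y"
  by (simp_all add: fun_eq_iff)

lemma bit_add_eq_0_iff: "(a::bit) + b = 0 \<longleftrightarrow> a = b"
  by (cases a; cases b) simp_all

lemma bit_fun_add_eq_0_iff: "(x :: 'a \<Rightarrow> bit) + y = 0 \<longleftrightarrow> x = y"
  by (simp add: fun_eq_iff bit_add_eq_0_iff del: bit_not_zero_iff)

lemma sum_fun_apply: "(\<Sum>i\<in>A. f i) x = (\<Sum>i\<in>A. f i x)"
  by (induction A rule: infinite_finite_induct) auto

text \<open>One notion serves for the vectors of a coordinate, with \<open>M = {..<n i}\<close>, and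
  for tensors, with \<open>M = multi_idx n J\<close>.\<close>

definition vecs :: "'m set \<Rightarrow> ('m \<Rightarrow> bit) set"
  where "vecs M = {x. \<forall>m. m \<notin> M \<longrightarrow> x m = 0}"

definition dot :: "'m set \<Rightarrow> ('m \<Rightarrow> bit) \<Rightarrow> ('m \<Rightarrow> bit) \<Rightarrow> bit"
  where "dot M x y = (\<Sum>m\<in>M. x m * y m)"

definition unit_vec :: "'m \<Rightarrow> 'm \<Rightarrow> bit"
  where "unit_vec m = (\<lambda>j. of_bool (j = m))"

lemma vecs_0 [simp]: "0 \<in> vecs M" and sp_add: "x \<in> vecs M \<Longrightarrow> y \<in> vecs M \<Longrightarrow> x + y \<in> vecs M"
  and vecs_sum: "(\<And>i. i \<in> A \<Longrightarrow> f i \<in> vecs M) \<Longrightarrow> sum f A \<in> vecs M"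
  and unit_vec_vecs: "m \<in> M \<Longrightarrow> unit_vec m \<in> vecs M"
  by (auto simp: vecs_def unit_vec_def sum_fun_apply)

lemma vecs_subspace: "fun_vs.subspace (vecs M)"
  by (auto simp: fun_vs.subspace_def vecs_def fun_scale_def)

lemma card_vecs: assumes "finite M" shows "finite (vecs M)" "card (vecs M) = 2 ^ card M"
proof -
  have "bij_betw (\<lambda>S j. of_bool (j \<in> S) :: bit) (Pow M) (vecs M)"
  proof (rule bij_betwI[where g = "\<lambda>x. {j. x j = 1}"])
    show "(\<lambda>x. {j. x j = (1::bit)}) \<in> vecs M \<rightarrow> Pow M"
      unfolding vecs_def by (force simp flip: bit_not_zero_iff)
  qed (auto simp: vecs_def fun_eq_iff of_bool_def)
  with assms show "finite (vecs M)" "card (vecs M) = 2 ^ card M"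
    using bij_betw_finite bij_betw_same_card by (blast, metis card_Pow)
qed

lemma card_vecs_pos [simp]: "finite M \<Longrightarrow> card (vecs M) > 0"
  by (simp add: card_vecs)

lemma dot_add_left: "dot M (x + y) z = dot M x z + dot M y z"
  and dot_add_right: "dot M x (y + z) = dot M x y + dot M x z"
  and dot_0 [simp]: "dot M 0 z = 0" "dot M x 0 = 0"
  and dot_commute: "dot M x y = dot M y x"
  by (simp_all add: dot_def algebra_simps sum.distrib)

lemma dot_sum_left: "dot M (sum f A) z = (\<Sum>a\<in>A. dot M (f a) z)"
  by (induction A rule: infinite_finite_induct) (simp_all only: sum.infinite sum.empty sum.insert dot_0 dot_add_left not_False_eq_True)

lemma dot_sum_right: "dot M z (sum f A) = (\<Sum>a\<in>A. dot M z (f a))"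
  by (induction A rule: infinite_finite_induct)
    (simp_all only: sum.infinite sum.empty sum.insert dot_0 dot_add_right not_False_eq_True)

lemma dot_unit_vec: "finite M \<Longrightarrow> m \<in> M \<Longrightarrow> dot M (unit_vec m) y = y m"
  by (simp add: dot_def unit_vec_def of_bool_def if_distrib[of "\<lambda>a. a * _"] sum.delta cong: if_cong)

section \<open>Characters and Fourier coefficients\<close>

definition sgn_char :: "bit \<Rightarrow> real" where "sgn_char b = (if b = 0 then 1 else -1)"

lemma sgn_char_0 [simp]: "sgn_char 0 = 1" and chi_1 [simp]: "sgn_char 1 = -1"
  and sgn_char_add: "sgn_char (a + b) = sgn_char a * sgn_char b"
  and abs_sgn_char [simp]: "\<bar>sgn_char a\<bar> = 1" and chi_square [simp]: "sgn_char a * sgn_char a = 1" 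
  by (cases a; cases b; simp add: sgn_char_def)+

lemma sgn_char_sum: "sgn_char (\<Sum>a\<in>A. f a) = (\<Prod>a\<in>A. sgn_char (f a))"
  by (induction A rule: infinite_finite_induct) (simp_all add: sgn_char_add)

lemma sum_sgn_char:
  assumes M: "finite M" and y: "y \<in> vecs M"
  shows "(\<Sum>x\<in>vecs M. sgn_char (dot M x y)) = (if y = 0 then card (vecs M) else 0)"
proof (cases "y = 0")
  case False
  then obtain m where "y m \<noteq> 0" by (auto simp: fun_eq_iff)
  then have m: "m \<in> M" "y m = 1" using y by (auto simp: vecs_def)
  \<comment> \<open>Translation by a unit vector at a position where \<open>y\<close> is 1 flips
    every sign, so the sum is its own negative.\<close>
  have "(\<Sum>x\<in>vecs M. sgn_char (dot M x y)) = (\<Sum>x\<in>vecs M. sgn_char (dot M (x + unit_vec m) y))"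
    by (rule sum.reindex_bij_witness[where i = "\<lambda>x. x + unit_vec m" and j = "\<lambda>x. x + unit_vec m"])
      (auto simp: sp_add unit_vec_vecs m add.assoc)
  also have "\<dots> = - (\<Sum>x\<in>vecs M. sgn_char (dot M x y))"
    using m M by (simp add: dot_add_left dot_unit_vec sgn_char_add sum_negf)
  finally show ?thesis using False by simp
qed simp

lemma sum_sgn_char': "finite M \<Longrightarrow> y \<in> vecs M \<Longrightarrow> 
  (\<Sum>x\<in>vecs M. sgn_char (dot M y x)) = (if y = 0 then card (vecs M) else 0)"
  using sum_sgn_char[of M y] by (simp add: dot_commute)

definition fourier :: "'m set \<Rightarrow> (('m \<Rightarrow> bit) \<Rightarrow> real) \<Rightarrow> ('m \<Rightarrow> bit) \<Rightarrow> real"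
  where "fourier M f y = (\<Sum>x\<in>vecs M. f x * sgn_char (dot M x y))"

lemma fourier_0: "fourier M f 0 = sum f (vecs M)"
  by (simp add: fourier_def)

text \<open>Plancherel for a shifted correlation. Taking \<open>t = 0\<close> gives Parseval; for
  the indicator of a set the right side counts the elements that stay in the set after adding
  \<open>t\<close>.\<close>

lemma sum_fourier_mult:
  fixes f g :: "_ \<Rightarrow> real"
  assumes M: "finite M" and "t \<in> vecs M"
  shows "(\<Sum>y\<in>vecs M. fourier M f y * fourier M g y * sgn_char (dot M t y))
     = card (vecs M) * (\<Sum>x\<in>vecs M. f x * g (x + t))"
proof -
  have "(\<Sum>y\<in>vecs M. fourier M f y * fourier M g y * sgn_char (dot M t y))
      = (\<Sum>y\<in>vecs M. \<Sum>x\<in>vecs M. \<Sum>x'\<in>vecs M. f x * g x' * sgn_char (dot M (x + x' + t) y))"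
  proof (rule sum.cong[OF refl])
    fix y
    have "fourier M f y * fourier M g y = (\<Sum>x\<in>vecs M. \<Sum>x'\<in>vecs M. f x * g x' * sgn_char (dot M x y) * sgn_char (dot M x' y))"
      by (simp add: fourier_def sum_product mult_ac)
    then have "fourier M f y * fourier M g y * sgn_char (dot M t y) =
        (\<Sum>x\<in>vecs M. \<Sum>x'\<in>vecs M. f x * g x' * sgn_char (dot M x y) * sgn_char (dot M x' y) * sgn_char (dot M t y))"
      by (simp only: sum_distrib_right)
    then show "fourier M f y * fourier M g y * sgn_char (dot M t y) =
        (\<Sum>x\<in>vecs M. \<Sum>x'\<in>vecs M. f x * g x' * sgn_char (dot M (x + x' + t) y))"
      by (simp only: dot_add_left sgn_char_add mult.assoc)
  qed
  also have "\<dots> = (\<Sum>x\<in>vecs M. \<Sum>x'\<in>vecs M. \<Sum>y\<in>vecs M. f x * g x' * sgn_char (dot M (x + x' + t) y))"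
    by (subst sum.swap, rule sum.cong[OF refl], rule sum.swap)
  also have "\<dots> = (\<Sum>x\<in>vecs M. \<Sum>x'\<in>vecs M. if x' = x + t then f x * g x' * card (vecs M) else 0)"
  proof (intro sum.cong refl)
    fix x x' assume "x \<in> vecs M" "x' \<in> vecs M"
    then have "x + x' + t \<in> vecs M" using assms by (simp add: sp_add)
    moreover have "x + x' + t = 0 \<longleftrightarrow> x' = x + t"
      by (metis add.commute add.left_commute bit_fun_add_eq_0_iff)
    ultimately show "(\<Sum>y\<in>vecs M. f x * g x' * sgn_char (dot M (x + x' + t) y)) =
      (if x' = x + t then f x * g x' * card (vecs M) else 0)"
      using M by (simp add: sum_sgn_char' flip: sum_distrib_left)
  qed
  also have "\<dots> = (\<Sum>x\<in>vecs M. f x * g (x + t) * card (vecs M))"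
    using assms by (simp add: sum.delta card_vecs sp_add)
  finally show ?thesis by (simp add: sum_distrib_left mult_ac)
qed

lemma parseval:
  fixes f :: "_ \<Rightarrow> real"
  assumes "finite M"
  shows "(\<Sum>y\<in>vecs M. (fourier M f y)\<^sup>2) = card (vecs M) * (\<Sum>x\<in>vecs M. (f x)\<^sup>2)"
  using sum_fourier_mult[OF assms, of 0 f f] by (simp add: power2_eq_square)

text \<open>The indicator of the solution set expands as a product of factors "1 plus a character".
  By \<open>ind\<close>, no character involving some \<open>v b\<close> is trivial, so only subsets
  of \<open>E\<close> contribute to the average, each nonnegatively, and the empty subset alone
  gives the bound. This is why \<open>E\<close> may be linearly dependent.\<close>

lemma card_solutions:
  fixes v :: "'t \<Rightarrow> 'm \<Rightarrow> bit"
  assumes M: "finite M" and E: "finite E" "E \<subseteq> vecs M" and T: "finite T" "v ` T \<subseteq> vecs M"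
    and ind: "\<And>B C. B \<subseteq> T \<Longrightarrow> B \<noteq> {} \<Longrightarrow> C \<subseteq> E \<Longrightarrow> (\<Sum>b\<in>B. v b) \<noteq> \<Sum>C"
  shows "card (vecs M) \<le> card {x\<in>vecs M. (\<forall>y\<in>E. dot M x y = 0) \<and> (\<forall>b\<in>T. dot M x (v b) = t b)}
    * 2 ^ (card E + card T)"
proof -
  let ?S = "{x\<in>vecs M. (\<forall>y\<in>E. dot M x y = 0) \<and> (\<forall>b\<in>T. dot M x (v b) = t b)}"
  define P where "P x = (\<Prod>y\<in>E. sgn_char (dot M x y) + 1) * (\<Prod>b\<in>T. sgn_char (dot M x (v b) + t b) + 1)" for x
  have P: "P x = of_bool (x \<in> ?S) * 2 ^ (card E + card T)" if "x \<in> vecs M" for x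
  proof (cases "x \<in> ?S")
    case True
    then show ?thesis by (simp add: P_def power_add)
  next
    case False
    then have "(\<exists>y\<in>E. sgn_char (dot M x y) + 1 = 0) \<or> (\<exists>b\<in>T. sgn_char (dot M x (v b) + t b) + 1 = 0)"
      using that bit_add_eq_0_iff by (fastforce simp: sgn_char_def)
    then have "P x = 0" unfolding P_def using E T by (auto simp: prod_zero_iff)
    then show ?thesis using False by simp
  qed
  have expand: "P x = (\<Sum>C\<in>Pow E. \<Sum>B\<in>Pow T. sgn_char (\<Sum>b\<in>B. t b) * sgn_char (dot M x (\<Sum>C + (\<Sum>b\<in>B. v b))))" for x
    unfolding P_def prod_add[OF E(1)] prod_add[OF T(1)] sum_product
    by (intro sum.cong refl)
      (simp add: dot_add_right dot_sum_right sgn_char_add sgn_char_sum prod.distrib mult_ac)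
  have nn: "real (card (vecs M)) \<le> (\<Sum>x\<in>vecs M. P x)"
  proof -
    have "(\<Sum>x\<in>vecs M. P x) = (\<Sum>C\<in>Pow E. \<Sum>B\<in>Pow T. \<Sum>x\<in>vecs M. sgn_char (\<Sum>b\<in>B. t b) * sgn_char (dot M x (\<Sum>C + (\<Sum>b\<in>B. v b))))"
      unfolding expand by (subst sum.swap, rule sum.cong[OF refl], rule sum.swap)
    also have "\<dots> = (\<Sum>C\<in>Pow E. \<Sum>B\<in>Pow T. if B = {} \<and> \<Sum>C = 0 then real (card (vecs M)) else 0)"
    proof (intro sum.cong refl)
      fix C B assume CB: "C \<in> Pow E" "B \<in> Pow T"
      then have "\<Sum>C + (\<Sum>b\<in>B. v b) \<in> vecs M" using E T by (intro sp_add vecs_sum) (auto simp: image_subset_iff)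
      moreover have "\<Sum>C + (\<Sum>b\<in>B. v b) = 0 \<longleftrightarrow> (\<Sum>b\<in>B. v b) = \<Sum>C"
        using bit_fun_add_eq_0_iff by metis
      moreover have "B = {}" if "(\<Sum>b\<in>B. v b) = \<Sum>C" using ind[of B C] CB that by auto
      ultimately show "(\<Sum>x\<in>vecs M. sgn_char (\<Sum>b\<in>B. t b) * sgn_char (dot M x (\<Sum>C + (\<Sum>b\<in>B. v b)))) =
         (if B = {} \<and> \<Sum>C = 0 then real (card (vecs M)) else 0)"
        using M by (auto simp: sum_sgn_char simp flip: sum_distrib_left)
    qed
    finally have 1: "(\<Sum>x\<in>vecs M. P x) = (\<Sum>C\<in>Pow E. \<Sum>B\<in>Pow T. if B = {} \<and> \<Sum>C = 0 then real (card (vecs M)) else 0)" .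
    have "real (card (vecs M)) = (\<Sum>C\<in>{{} :: ('m \<Rightarrow> bit) set}. \<Sum>B\<in>Pow T. if B = {} \<and> \<Sum>C = 0 then real (card (vecs M)) else 0)"
      using T by (simp add: sum.delta)
    also have "\<dots> \<le> (\<Sum>C\<in>Pow E. \<Sum>B\<in>Pow T. if B = {} \<and> \<Sum>C = 0 then real (card (vecs M)) else 0)"
      using E by (intro sum_mono2 sum_nonneg) auto
    finally show ?thesis by (simp only: 1)
  qed
  have "(\<Sum>x\<in>vecs M. P x) = (\<Sum>x\<in>vecs M. of_bool (x \<in> ?S) * 2 ^ (card E + card T))"
    by (intro sum.cong P refl)
  also have "\<dots> = card ?S * 2 ^ (card E + card T)"
    using card_vecs(1)[OF M] by (simp add: sum.If_cases of_bool_def if_distrib[of "\<lambda>a. a * _"] Int_def cong: if_cong)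
  finally have "real (card (vecs M)) \<le> real (card ?S * 2 ^ (card E + card T))" using nn by simp
  then show ?thesis by (simp only: of_nat_le_iff)
qed

text \<open>\<open>U\<close> is quantified after \<Lambda>, since the form that decides which
  vectors are usable is given only after \<Lambda>. A positive proportion of the representations of
  \<open>h\<close>, and not just one of them, has to stay in \<open>U\<close>: each representation
  carries its own tree, and \<open>common_ctree\<close> merges trees only for forms vanishing on a
  positive proportion of them.\<close>

definition bogolyubov_set :: "'m set \<Rightarrow> (('m \<Rightarrow> bit) \<Rightarrow> real) \<Rightarrow> nat \<Rightarrow> nat \<Rightarrow> real \<Rightarrow> ('m \<Rightarrow> bit) set \<Rightarrow> bool"
  where "bogolyubov_set M f m k c \<Lambda> \<longleftrightarrow> finite \<Lambda> \<and> \<Lambda> \<subseteq> vecs M \<and> card \<Lambda> \<le> k \<and>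
    (\<forall>U\<subseteq>vecs M. sum f (vecs M - U) \<le> sum f (vecs M) / 4 \<longrightarrow>
      (\<forall>h\<in>vecs M. (\<forall>y\<in>\<Lambda>. dot M h y = 0) \<longrightarrow>
        {xs \<in> {..<m} \<rightarrow>\<^sub>E vecs M. sum xs {..<m} = h} \<noteq> {} \<and>
        c * real (card {xs \<in> {..<m} \<rightarrow>\<^sub>E vecs M. sum xs {..<m} = h})
          \<le> real (card {xs \<in> {..<m} \<rightarrow>\<^sub>E U. sum xs {..<m} = h})))"

text \<open>The number of summands \<open>m\<close> depends on the density \<open>\<delta>\<close>, which makes \<open>(2/3)^m\<close> beat \<open>\<delta>\<close>.\<close>

lemma robust_bogolyubov:
  assumes \<delta>: "(\<delta> :: real) > 0"
  shows "\<exists>m k c. c > 0 \<and> (\<forall>(M :: 'm set) f. finite M \<and> (\<forall>x\<in>vecs M. 0 \<le> f x \<and> f x \<le> 1) \<and>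
     sum f (vecs M) \<ge> \<delta> * card (vecs M) \<longrightarrow> (\<exists>\<Lambda>. bogolyubov_set M f m k c \<Lambda>))"
proof -
  have "(\<lambda>m. 4 / \<delta> * (2/3)^m) \<longlonglongrightarrow> 4 / \<delta> * 0"
    by (intro tendsto_intros LIMSEQ_realpow_zero) auto
  then have "\<forall>\<^sub>F m in sequentially. 4 / \<delta> * (2/3)^m < 1/2"
    by (intro order_tendstoD) auto
  then obtain m0 where m0: "\<And>m. m \<ge> m0 \<Longrightarrow> 4 / \<delta> * (2/3)^m < 1/2"
    by (auto simp: eventually_sequentially)
  \<comment> \<open>An even exponent makes the contribution of the large spectrum nonnegative, and
    \<open>m \<ge> 2\<close> leaves a square for Parseval.\<close>
  define m where "m = 2 * (m0 + 1)"
  have m: "4 / \<delta> * (2/3)^m < 1/2" "m \<ge> 2" "even m" using m0[of m] by (auto simp: m_def)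
  \<comment> \<open>The coefficient at 0 of the part of \<open>f\<close> on \<open>U\<close> is at
    least \<open>3 / 4 * F \<ge> 3 / 4 * \<delta> * card G\<close>; half of its \<open>m\<close>-th
    power survives the error terms.\<close>
  define c where "c = (3 * \<delta> / 4)^m / 2"
  define k where "k = nat \<lceil>16 / \<delta>\<rceil>"
  have c: "c > 0" using \<delta> by (simp add: c_def)
  show ?thesis
  proof (rule exI[of _ m], rule exI[of _ k], rule exI[of _ c], intro conjI allI impI, goal_cases)
    case (2 M f)
    then have M: "finite M" and f: "\<And>x. x \<in> vecs M \<Longrightarrow> 0 \<le> f x" "\<And>x. x \<in> vecs M \<Longrightarrow> f x \<le> 1"
      and fd: "sum f (vecs M) \<ge> \<delta> * card (vecs M)" by auto
    define G where "G = vecs M"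
    define F where "F = sum f G"
    have G: "finite G" "card G > 0" using M by (simp_all add: G_def card_vecs(1))
    have F: "F \<ge> \<delta> * card G" using fd by (simp add: F_def G_def)
    have "0 < \<delta> * card G" using \<delta> G by simp
    with F have F: "F \<ge> \<delta> * card G" "F > 0" by linarith+
    \<comment> \<open>The large spectrum. Off it the coefficients of \<open>f\<close> are below
      \<open>F / 4\<close>, and cutting \<open>f\<close> down to \<open>U\<close> changes a
      coefficient by at most another \<open>F / 4\<close>. The resulting bound \<open>F / 2\<close>
      compares with at least \<open>3 / 4 * F\<close> at 0, whence the ratio 2/3.\<close>
    define \<Lambda> where "\<Lambda> = {y\<in>G. \<bar>fourier M f y\<bar> \<ge> F / 4}"
    have \<Lambda>: "finite \<Lambda>" "\<Lambda> \<subseteq> G" using G by (auto simp: \<Lambda>_def)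
    have "card \<Lambda> * (F / 4)\<^sup>2 \<le> (\<Sum>y\<in>\<Lambda>. (fourier M f y)\<^sup>2)"
      using F by (intro sum_bounded_below[THEN order_trans[rotated]])
        (auto simp: \<Lambda>_def abs_le_square_iff[symmetric])
    also have "\<dots> \<le> (\<Sum>y\<in>G. (fourier M f y)\<^sup>2)"
      using \<Lambda> G by (intro sum_mono2) auto
    also have "\<dots> = card G * (\<Sum>x\<in>G. (f x)\<^sup>2)" unfolding G_def by (rule parseval[OF M])
    also have "\<dots> \<le> card G * F"
      unfolding F_def using f by (intro mult_left_mono sum_mono)
        (auto simp: G_def power2_eq_square mult_left_le)
    also have "\<dots> \<le> F / \<delta> * F"
      using F \<delta> by (intro mult_right_mono) (auto simp: field_simps)
    finally have "card \<Lambda> \<le> 16 / \<delta>" using F \<delta> by (simp add: field_simps power2_eq_square)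
    then have k: "card \<Lambda> \<le> k" by (simp add: k_def) linarith
    show ?case unfolding bogolyubov_set_def G_def[symmetric]
    proof (intro exI[of _ \<Lambda>] conjI allI impI \<Lambda> k ballI)
      fix U h assume U: "U \<subseteq> G" and UF: "sum f (G - U) \<le> sum f G / 4"
        and h: "h \<in> G" "\<forall>y\<in>\<Lambda>. dot M h y = 0"
      define g where "g x = (if x \<in> U then f x else 0)" for x
      have finU: "finite U" using U G finite_subset by blast
      \<comment> \<open>The weighted number of representations of \<open>h\<close> is an
        \<open>m\<close>-fold convolution, so it is read off from \<open>m\<close>-th powers of
        Fourier coefficients.\<close>
      have conv: "(\<Sum>xs\<in>{xs \<in> {..<m} \<rightarrow>\<^sub>E G. sum xs {..<m} = h}. \<Prod>l<m. \<phi> (xs l)) * card G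
          = (\<Sum>y\<in>G. sgn_char (dot M h y) * fourier M \<phi> y ^ m)" for \<phi> :: "_ \<Rightarrow> real"
      proof -
        have "(\<Sum>y\<in>G. sgn_char (dot M h y) * fourier M \<phi> y ^ m)
          = (\<Sum>y\<in>G. \<Sum>xs\<in>{..<m} \<rightarrow>\<^sub>E G. (\<Prod>l<m. \<phi> (xs l)) * sgn_char (dot M (h + sum xs {..<m}) y))"
        proof (rule sum.cong[OF refl])
          fix y
          have "fourier M \<phi> y ^ m = (\<Prod>l<m. \<Sum>x\<in>G. \<phi> x * sgn_char (dot M x y))"
            by (simp add: fourier_def G_def)
          also have "\<dots> = (\<Sum>xs\<in>{..<m} \<rightarrow>\<^sub>E G. \<Prod>l<m. \<phi> (xs l) * sgn_char (dot M (xs l) y))"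
            using G by (intro prod_sum_PiE) auto
          finally show "sgn_char (dot M h y) * fourier M \<phi> y ^ m
            = (\<Sum>xs\<in>{..<m} \<rightarrow>\<^sub>E G. (\<Prod>l<m. \<phi> (xs l)) * sgn_char (dot M (h + sum xs {..<m}) y))"
            by (simp add: sum_distrib_left prod.distrib dot_add_left dot_sum_left sgn_char_add sgn_char_sum mult_ac)
        qed
        also have "\<dots> = (\<Sum>xs\<in>{..<m} \<rightarrow>\<^sub>E G. \<Sum>y\<in>G. (\<Prod>l<m. \<phi> (xs l)) * sgn_char (dot M (h + sum xs {..<m}) y))"
          by (rule sum.swap)
        also have "\<dots> = (\<Sum>xs\<in>{..<m} \<rightarrow>\<^sub>E G. if sum xs {..<m} = h then (\<Prod>l<m. \<phi> (xs l)) * card G else 0)"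
        proof (rule sum.cong[OF refl])
          fix xs assume "xs \<in> {..<m} \<rightarrow>\<^sub>E G"
          then have "h + sum xs {..<m} \<in> vecs M"
            using h by (intro sp_add vecs_sum) (auto simp: G_def)
          moreover have "h + sum xs {..<m} = 0 \<longleftrightarrow> sum xs {..<m} = h"
            using bit_fun_add_eq_0_iff by metis
          ultimately show "(\<Sum>y\<in>G. (\<Prod>l<m. \<phi> (xs l)) * sgn_char (dot M (h + sum xs {..<m}) y)) =
            (if sum xs {..<m} = h then (\<Prod>l<m. \<phi> (xs l)) * card G else 0)"
            using M by (simp add: sum_sgn_char' G_def flip: sum_distrib_left)
        qed
        also have "\<dots> = (\<Sum>xs\<in>{xs \<in> {..<m} \<rightarrow>\<^sub>E G. sum xs {..<m} = h}. (\<Prod>l<m. \<phi> (xs l)) * card G)"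
          using G by (intro sum.inter_filter[symmetric]) (auto intro: finite_PiE)
        finally show ?thesis by (simp add: sum_distrib_right)
      qed
      have g: "0 \<le> g x" "g x \<le> 1" if "x \<in> G" for x using f that by (auto simp: g_def G_def)
      have fg: "sum f (G - U) = F - sum g G"
      proof -
        have "F = sum f U + sum f (G - U)"
          unfolding F_def using G U by (metis add.commute sum.subset_diff)
        moreover have "sum g G = sum f U"
          unfolding g_def using U G by (simp add: sum.inter_restrict[symmetric] Int_absorb1)
        ultimately show ?thesis by simp
      qed
      then have g0: "sum g G \<ge> 3/4 * F" using UF by (simp add: F_def)
      have gF: "sum g G \<le> F" unfolding F_def using f by (intro sum_mono) (auto simp: g_def G_def)
      have small: "\<bar>fourier M g y\<bar> \<le> F / 2" if y: "y \<in> G" "y \<notin> \<Lambda>" for y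
      proof -
        have "\<bar>fourier M f y - fourier M g y\<bar> = \<bar>\<Sum>x\<in>G. (f x - g x) * sgn_char (dot M x y)\<bar>"
          by (simp add: fourier_def G_def sum_subtractf left_diff_distrib)
        also have "\<dots> \<le> (\<Sum>x\<in>G. \<bar>(f x - g x) * sgn_char (dot M x y)\<bar>)" by (rule sum_abs)
        also have "\<dots> = (\<Sum>x\<in>G. f x - g x)"
          using f by (intro sum.cong) (auto simp: g_def abs_mult G_def)
        also have "\<dots> \<le> F / 4" using g0 by (simp add: sum_subtractf F_def)
        finally have "\<bar>fourier M f y - fourier M g y\<bar> \<le> F / 4" .
        moreover have "\<bar>fourier M f y\<bar> < F / 4" using y by (auto simp: \<Lambda>_def)
        ultimately show ?thesis by linarith
      qed
      \<comment> \<open>Two of the \<open>m\<close> factors are spent on Parseval, the others on the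
        uniform bound \<open>F / 2\<close>.\<close>
      have rest: "(\<Sum>y\<in>G - \<Lambda>. \<bar>fourier M g y\<bar> ^ m) \<le> (3/4 * F)^m / 2"
      proof -
        have "(\<Sum>y\<in>G - \<Lambda>. \<bar>fourier M g y\<bar> ^ m) \<le> (\<Sum>y\<in>G - \<Lambda>. (F/2)^(m-2) * (fourier M g y)\<^sup>2)"
        proof (rule sum_mono)
          fix y assume "y \<in> G - \<Lambda>"
          then have "\<bar>fourier M g y\<bar> ^ (m-2) \<le> (F/2)^(m-2)" using small by (intro power_mono) auto
          then have "\<bar>fourier M g y\<bar> ^ (m-2) * \<bar>fourier M g y\<bar>\<^sup>2 \<le> (F/2)^(m-2) * (fourier M g y)\<^sup>2"
            by (simp add: mult_right_mono)
          then show "\<bar>fourier M g y\<bar> ^ m \<le> (F/2)^(m-2) * (fourier M g y)\<^sup>2"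
            using m(2) by (simp add: m_def power_add power2_eq_square mult_ac)
        qed
        also have "\<dots> \<le> (\<Sum>y\<in>G. (F/2)^(m-2) * (fourier M g y)\<^sup>2)"
          using G F by (intro sum_mono2) auto
        also have "\<dots> = (F/2)^(m-2) * (card G * (\<Sum>x\<in>G. (g x)\<^sup>2))"
          unfolding G_def by (simp add: parseval[OF M] flip: sum_distrib_left)
        also have "\<dots> \<le> (F/2)^(m-2) * (F / \<delta> * F)"
        proof (intro mult_left_mono mult_mono)
          show "(\<Sum>x\<in>G. (g x)\<^sup>2) \<le> F"
            using g by (intro order_trans[OF sum_mono gF]) (auto simp: power2_eq_square mult_left_le)
        qed (use F \<delta> in \<open>auto simp: field_simps sum_nonneg\<close>)
        also have "\<dots> = (F/2)^m * (4 / \<delta>)"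
          using m(2) by (simp add: m_def power_add power2_eq_square field_simps)
        also have "\<dots> = (3/4*F)^m * (4 / \<delta> * (2/3)^m)"
        proof -
          have "F/2 = 3/4*F * (2/3)" by simp
          then have "(F/2)^m = (3/4*F)^m * (2/3)^m" by (simp only: power_mult_distrib)
          then show ?thesis by simp
        qed
        also have "\<dots> \<le> (3/4*F)^m * (1/2)"
          using m F by (intro mult_left_mono) auto
        finally show ?thesis by simp
      qed
      show "{xs \<in> {..<m} \<rightarrow>\<^sub>E G. sum xs {..<m} = h} \<noteq> {}"
      proof -
        have "restrict (\<lambda>l. if l = 0 then h else 0) {..<m} \<in> {..<m} \<rightarrow>\<^sub>E G"
          using h by (auto simp: G_def)
        moreover have "sum (restrict (\<lambda>l. if l = 0 then h else 0) {..<m}) {..<m} = h"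
        proof -
          have "sum (restrict (\<lambda>l. if l = 0 then h else 0) {..<m}) {..<m} = (\<Sum>l<m. if l = 0 then h else 0)"
            by (rule sum.cong) auto
          also have "\<dots> = h" using m(2) by (subst sum.delta) auto
          finally show ?thesis .
        qed
        ultimately show ?thesis by blast
      qed
      \<comment> \<open>With weight 1 the same identity shows that every \<open>h\<close> has
        equally many representations.\<close>
      have "real (card G) * card {xs \<in> {..<m} \<rightarrow>\<^sub>E G. sum xs {..<m} = h} = (\<Sum>y\<in>G. sgn_char (dot M h y) * fourier M (\<lambda>_. 1) y ^ m)"
        using conv[of "\<lambda>_. 1"] by (simp add: mult.commute)
      also have "\<dots> = (\<Sum>y\<in>G. if y = 0 then real (card G) ^ m else 0)"
        using M m(2) by (intro sum.cong refl) (simp add: fourier_def sum_sgn_char G_def)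
      also have "\<dots> = real (card G) ^ m"
        using G by (simp add: sum.delta' G_def)
      finally have Gm: "real (card G) * card {xs \<in> {..<m} \<rightarrow>\<^sub>E G. sum xs {..<m} = h} = real (card G) ^ m" .
      have "(3/4*F)^m / 2 \<le> (\<Sum>y\<in>G. sgn_char (dot M h y) * fourier M g y ^ m)"
      proof -
        have z: "0 \<in> \<Lambda>" using F by (simp add: \<Lambda>_def fourier_0 G_def F_def)
        have "fourier M g 0 ^ m \<le> (\<Sum>y\<in>\<Lambda>. fourier M g y ^ m)"
          by (rule member_le_sum[OF z]) (use \<Lambda> m(3) in \<open>auto simp: zero_le_even_power\<close>)
        moreover have "(3/4*F)^m \<le> fourier M g 0 ^ m"
          using g0 F by (intro power_mono) (auto simp: fourier_0 G_def)
        moreover have "(\<Sum>y\<in>\<Lambda>. sgn_char (dot M h y) * fourier M g y ^ m) = (\<Sum>y\<in>\<Lambda>. fourier M g y ^ m)"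
          using h by (intro sum.cong) auto
        moreover have "(\<Sum>y\<in>G - \<Lambda>. - (\<bar>fourier M g y\<bar> ^ m)) \<le> (\<Sum>y\<in>G - \<Lambda>. sgn_char (dot M h y) * fourier M g y ^ m)"
          using m(3) by (intro sum_mono) (auto simp: sgn_char_def power_even_abs intro: order_trans[of _ 0] zero_le_even_power)
        moreover have "(\<Sum>y\<in>G. sgn_char (dot M h y) * fourier M g y ^ m) =
          (\<Sum>y\<in>G - \<Lambda>. sgn_char (dot M h y) * fourier M g y ^ m) + (\<Sum>y\<in>\<Lambda>. sgn_char (dot M h y) * fourier M g y ^ m)"
          using \<Lambda> G by (intro sum.subset_diff) auto
        ultimately show ?thesis using rest by (simp add: sum_negf)
      qed
      also have "\<dots> = (\<Sum>xs\<in>{xs \<in> {..<m} \<rightarrow>\<^sub>E G. sum xs {..<m} = h}. \<Prod>l<m. g (xs l)) * card G"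
        by (rule conv[symmetric])
      also have "(\<Sum>xs\<in>{xs \<in> {..<m} \<rightarrow>\<^sub>E G. sum xs {..<m} = h}. \<Prod>l<m. g (xs l))
        \<le> (\<Sum>xs\<in>{xs \<in> {..<m} \<rightarrow>\<^sub>E G. sum xs {..<m} = h}. of_bool (xs \<in> {..<m} \<rightarrow>\<^sub>E U))"
      proof (rule sum_mono)
        fix xs assume xs: "xs \<in> {xs \<in> {..<m} \<rightarrow>\<^sub>E G. sum xs {..<m} = h}"
        show "(\<Prod>l<m. g (xs l)) \<le> of_bool (xs \<in> {..<m} \<rightarrow>\<^sub>E U)"
        proof (cases "xs \<in> {..<m} \<rightarrow>\<^sub>E U")
          case True
          then show ?thesis using g xs by (auto intro!: prod_le_1 simp: PiE_iff)
        next
          case False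
          then obtain l where "l < m" "xs l \<notin> U" using xs by (auto simp: PiE_iff)
          then have "(\<Prod>l<m. g (xs l)) = 0" by (intro prod_zero) (auto simp: g_def)
          then show ?thesis by (simp only:) simp
        qed
      qed
      also have "\<dots> = card {xs \<in> {..<m} \<rightarrow>\<^sub>E U. sum xs {..<m} = h}"
      proof -
        have "{xs \<in> {..<m} \<rightarrow>\<^sub>E U. sum xs {..<m} = h} =
          {xs \<in> {xs \<in> {..<m} \<rightarrow>\<^sub>E G. sum xs {..<m} = h}. xs \<in> {..<m} \<rightarrow>\<^sub>E U}"
          using U by (auto simp: PiE_iff)
        moreover have "finite {xs \<in> {..<m} \<rightarrow>\<^sub>E G. sum xs {..<m} = h}"
          using G by (intro finite_Collect_conjI disjI1) (simp add: finite_PiE)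
        ultimately show ?thesis
          by (simp add: of_bool_def sum.If_cases Int_def)
      qed
      finally have A: "(3/4*F)^m / 2 \<le> real (card {xs \<in> {..<m} \<rightarrow>\<^sub>E U. sum xs {..<m} = h}) * card G"
        by (simp add: mult_right_mono)
      have "c * real (card G) ^ m = (3/4 * (\<delta> * card G))^m / 2"
        by (simp add: c_def power_mult_distrib power_divide)
      also have "\<dots> \<le> (3/4 * F)^m / 2"
        using F \<delta> by (intro divide_right_mono power_mono mult_left_mono) auto
      finally have "c * card {xs \<in> {..<m} \<rightarrow>\<^sub>E G. sum xs {..<m} = h} * card G \<le> real (card {xs \<in> {..<m} \<rightarrow>\<^sub>E U. sum xs {..<m} = h}) * card G"
        using A Gm by (simp add: mult_ac)
      then show "real (card {xs \<in> {..<m} \<rightarrow>\<^sub>E U. sum xs {..<m} = h}) \<ge>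
          c * real (card {xs \<in> {..<m} \<rightarrow>\<^sub>E G. sum xs {..<m} = h})"
        using G by simp
    qed
  qed (use c in auto)
qed

subsection \<open>Multilinear forms, trees of constraints\<close>

type_synonym tup = "nat \<Rightarrow> nat \<Rightarrow> bit"

definition agree :: "(nat \<Rightarrow> nat) \<Rightarrow> nat set \<Rightarrow> tup \<Rightarrow> tup \<Rightarrow> bool"
  where "agree n I u v \<longleftrightarrow> (\<forall>i\<in>I. \<forall>j<n i. u i j = v i j)"

text \<open>
  A form reads only the first \<open>n i\<close> entries of the vector \<open>u i\<close>, so equality of forms as functions is the
  same as equality on tuples of vectors of the coordinate spaces.
\<close>

definition mlform :: "(nat \<Rightarrow> nat) \<Rightarrow> nat set \<Rightarrow> (tup \<Rightarrow> bit) \<Rightarrow> bool"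
  where "mlform n I f \<longleftrightarrow> (\<forall>u v. agree n I u v \<longrightarrow> f u = f v) \<and>
    (\<forall>i\<in>I. \<forall>u x y. f (u(i := x + y)) = f (u(i := x)) + f (u(i := y)))"

text \<open>The gradient of a form in coordinate \<open>i\<close>: by \<open>mlform_partial\<close>,
  the form is the inner product of the vector at \<open>i\<close> with it. It does not depend on
  \<open>u i\<close>.\<close>

definition partial :: "(nat \<Rightarrow> nat) \<Rightarrow> nat \<Rightarrow> (tup \<Rightarrow> bit) \<Rightarrow> tup \<Rightarrow> nat \<Rightarrow> bit"
  where "partial n i f u = (\<lambda>j. if j < n i then f (u(i := unit_vec j)) else 0)"

lemma agree_refl [simp]: "agree n I u u" by (simp add: agree_def)

lemma agree_mono: "agree n I u v \<Longrightarrow> J \<subseteq> I \<Longrightarrow> agree n J u v" by (auto simp: agree_def)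

lemma agree_upd: "agree n (I - {i}) u v \<Longrightarrow> agree n I (u(i := x)) (v(i := x))" by (auto simp: agree_def)

lemma agree_upd_notin: "i \<notin> I \<Longrightarrow> agree n I (u(i := x)) u" by (auto simp: agree_def)

lemma mlform_agree: "mlform n I f \<Longrightarrow> agree n I u v \<Longrightarrow> f u = f v"
  by (simp add: mlform_def)

lemma mlform_upd_add: "mlform n I f \<Longrightarrow> i \<in> I \<Longrightarrow> f (u(i := x + y)) = f (u(i := x)) + f (u(i := y))"
  by (simp add: mlform_def)

lemma mlform_0: "mlform n I (\<lambda>u. 0)"
  by (simp add: mlform_def)

lemma mlform_add: "mlform n I f \<Longrightarrow> mlform n I g \<Longrightarrow> mlform n I (\<lambda>u. f u + g u)"
  unfolding mlform_def by (auto simp: algebra_simps intro: arg_cong2[of _ _ _ _ "(+)"])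

lemma mlform_sum: "(\<And>a. a \<in> A \<Longrightarrow> mlform n I (f a)) \<Longrightarrow> mlform n I (\<lambda>u. \<Sum>a\<in>A. f a u)"
  by (induction A rule: infinite_finite_induct) (auto intro: mlform_0 mlform_add)

lemma mlform_one: "mlform n {} (\<lambda>u. c)"
  by (simp add: mlform_def)

lemma mlform_mult:
  assumes "mlform n I f" "mlform n J g" "I \<inter> J = {}"
  shows "mlform n (I \<union> J) (\<lambda>u. f u * g u)"
proof -
  have "f (u(i := x + y)) * g (u(i := x + y)) = f (u(i := x)) * g (u(i := x)) + f (u(i := y)) * g (u(i := y))"
    if "i \<in> I \<union> J" for i u x y
  proof (cases "i \<in> I")
    case True
    then have "i \<notin> J" using assms(3) by auto
    then have "g (u(i := z)) = g u" for z using mlform_agree[OF assms(2)] agree_upd_notin by blast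
    then show ?thesis using mlform_upd_add[OF assms(1) True] by (simp add: algebra_simps)
  next
    case False
    then have "f (u(i := z)) = f u" for z using mlform_agree[OF assms(1)] agree_upd_notin by blast
    moreover have "i \<in> J" using that False by auto
    ultimately show ?thesis using mlform_upd_add[OF assms(2)] by (simp add: algebra_simps)
  qed
  moreover have "f u * g u = f v * g v" if "agree n (I \<union> J) u v" for u v
    using that mlform_agree[OF assms(1), of u v] mlform_agree[OF assms(2), of u v] by (auto simp: agree_def)
  ultimately show ?thesis by (auto simp: mlform_def)
qed

lemma mlform_prod:
  assumes "finite B" "\<And>p. p \<in> B \<Longrightarrow> mlform n (S p) (f p)" "\<And>p q. p \<in> B \<Longrightarrow> q \<in> B \<Longrightarrow> p \<noteq> q \<Longrightarrow> S p \<inter> S q = {}"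
  shows "mlform n (\<Union>p\<in>B. S p) (\<lambda>u. \<Prod>p\<in>B. f p u)"
  using assms
proof (induction B rule: finite_induct)
  case empty
  then show ?case by (simp add: mlform_one)
next
  case (insert p B)
  have "S p \<inter> (\<Union>q\<in>B. S q) = {}" using insert.prems(2)[of p] insert.hyps by fastforce
  then have "mlform n (S p \<union> (\<Union>q\<in>B. S q)) (\<lambda>u. f p u * (\<Prod>q\<in>B. f q u))"
    using insert.prems insert.IH by (intro mlform_mult) auto
  then show ?case using insert.hyps by simp
qed

lemma mlform_fix:
  assumes "mlform n J r"
  shows "mlform n (J - {i}) (\<lambda>u. r (u(i := x)))"
  unfolding mlform_def
proof (intro conjI allI ballI impI)
  fix u v assume "agree n (J - {i}) u v"
  then show "r (u(i := x)) = r (v(i := x))" by (intro mlform_agree[OF assms] agree_upd)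
next
  fix i' u y z assume i': "i' \<in> J - {i}"
  then have "u(i' := w, i := x) = u(i := x, i' := w)" for w by (auto simp: fun_eq_iff)
  then show "r (u(i' := y + z, i := x)) = r (u(i' := y, i := x)) + r (u(i' := z, i := x))"
    using mlform_upd_add[OF assms] i' by simp
qed

lemma mlform_upd_sum:
  assumes "mlform n I f" "i \<in> I"
  shows "f (u(i := 0)) = 0" "f (u(i := (\<Sum>a\<in>A. x a))) = (\<Sum>a\<in>A. f (u(i := x a)))"
proof -
  have "f (u(i := 0 + 0)) = f (u(i := 0)) + f (u(i := 0))" by (rule mlform_upd_add[OF assms])
  then show z: "f (u(i := 0)) = 0" by simp
  show "f (u(i := (\<Sum>a\<in>A. x a))) = (\<Sum>a\<in>A. f (u(i := x a)))"
    by (induction A rule: infinite_finite_induct)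
      (simp_all only: sum.infinite sum.empty sum.insert z mlform_upd_add[OF assms] not_False_eq_True)
qed

lemma partial_vecs: "partial n i f u \<in> vecs {..<n i}"
  by (simp add: partial_def vecs_def)

lemma mlform_partial:
  assumes "mlform n I f" "i \<in> I"
  shows "f (u(i := x)) = dot {..<n i} x (partial n i f u)"
proof -
  define y where "y = (\<Sum>j | j < n i \<and> x j = 1. unit_vec j)"
  have "y j = x j" if "j < n i" for j
    using that unfolding y_def sum_fun_apply
    by (cases "x j") (auto simp: unit_vec_def of_bool_def sum.delta cong: if_cong)
  then have "f (u(i := x)) = f (u(i := y))"
    by (intro mlform_agree[OF assms(1)]) (auto simp: agree_def)
  also have "\<dots> = (\<Sum>j | j < n i \<and> x j = 1. f (u(i := unit_vec j)))"
    unfolding y_def by (rule mlform_upd_sum[OF assms])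
  also have "\<dots> = (\<Sum>j<n i. if x j = 1 then f (u(i := unit_vec j)) else 0)"
    by (subst sum.inter_filter[symmetric]) (auto intro: sum.cong)
  also have "\<dots> = dot {..<n i} x (partial n i f u)"
    unfolding dot_def by (intro sum.cong) (auto simp: partial_def)
  finally show ?thesis .
qed

lemma mlform_dot_partial: "mlform n I f \<Longrightarrow> i \<in> I \<Longrightarrow> f u = dot {..<n i} (u i) (partial n i f u)"
  using mlform_partial[of n I f i u "u i"] by simp

lemma partial_agree: "mlform n I f \<Longrightarrow> agree n (I - {i}) u v \<Longrightarrow> partial n i f u = partial n i f v"
  unfolding partial_def fun_eq_iff using mlform_agree[OF _ agree_upd] by fastforce

lemma partial_sum: "partial n i (\<lambda>u. \<Sum>a\<in>A. f a u) u = (\<Sum>a\<in>A. partial n i (f a) u)"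
  by (auto simp: partial_def fun_eq_iff sum_fun_apply)

lemma partial_upd_add:
  assumes "mlform n I f" "i' \<in> I" "i' \<noteq> i"
  shows "partial n i f (u(i' := x + y)) = partial n i f (u(i' := x)) + partial n i f (u(i' := y))"
proof -
  have "u(i' := w, i := z) = u(i := z, i' := w)" for w z using assms(3) by (rule fun_upd_twist)
  then show ?thesis using mlform_upd_add[OF assms(1,2)] unfolding partial_def by (intro ext) (simp del: fun_upd_apply)
qed

section \<open>Averages over tuples, and trees of linear conditions\<close>

definition tuples :: "(nat \<Rightarrow> nat) \<Rightarrow> nat set \<Rightarrow> tup set"
  where "tuples n K = (\<Pi>\<^sub>E i\<in>K. vecs {..<n i})"

definition mean :: "(nat \<Rightarrow> nat) \<Rightarrow> nat set \<Rightarrow> (tup \<Rightarrow> real) \<Rightarrow> real"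
  where "mean n K F = (\<Sum>u\<in>tuples n K. F u) / card (tuples n K)"

abbreviation prob :: "(nat \<Rightarrow> nat) \<Rightarrow> nat set \<Rightarrow> (tup \<Rightarrow> bool) \<Rightarrow> real"
  where "prob n K P \<equiv> mean n K (\<lambda>u. of_bool (P u))"

lemma tuples_finite: "finite K \<Longrightarrow> finite (tuples n K)"
  by (simp add: tuples_def finite_PiE card_vecs(1))

lemma tuples_card: "finite K \<Longrightarrow> card (tuples n K) > 0"
  by (simp add: tuples_def card_PiE prod_pos)

lemma tuples_empty: "tuples n {} = {\<lambda>_. undefined}"
  by (simp add: tuples_def)

lemma tuples_upd: "u \<in> tuples n K \<Longrightarrow> x \<in> vecs {..<n i} \<Longrightarrow> u(i := x) \<in> tuples n (insert i K)"
  unfolding tuples_def by (auto simp: PiE_iff extensional_def)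

lemma tuples_insert:
  assumes "finite K" "i \<notin> K"
  shows "(\<Sum>u\<in>tuples n (insert i K). F u) = (\<Sum>x\<in>vecs {..<n i}. \<Sum>u\<in>tuples n K. (F (u(i := x)) :: 'a :: comm_monoid_add))"
proof -
  have "(\<Sum>u\<in>tuples n (insert i K). F u) = (\<Sum>(x, u)\<in>vecs {..<n i} \<times> tuples n K. F (u(i := x)))"
    unfolding tuples_def PiE_insert_eq
    by (subst sum.reindex[OF inj_combinator[OF assms(2)]]) (auto intro: sum.cong)
  then show ?thesis by (simp add: sum.cartesian_product)
qed

lemma card_tuples_insert:
  assumes "finite K" "i \<notin> K"
  shows "card (tuples n (insert i K)) = card (vecs {..<n i}) * card (tuples n K)"
  using assms by (simp add: tuples_def card_PiE)

lemma mean_insert: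
  assumes "finite K" "i \<notin> K"
  shows "mean n (insert i K) F = (\<Sum>x\<in>vecs {..<n i}. mean n K (\<lambda>u. F (u(i := x)))) / card (vecs {..<n i})"
  unfolding mean_def using assms by (simp add: tuples_insert card_tuples_insert sum_divide_distrib mult.commute)

lemma mean_insert':
  assumes "finite K" "i \<notin> K"
  shows "mean n (insert i K) F = mean n K (\<lambda>u. (\<Sum>x\<in>vecs {..<n i}. F (u(i := x))) / card (vecs {..<n i}))"
proof -
  have "(\<Sum>x\<in>vecs {..<n i}. \<Sum>u\<in>tuples n K. F (u(i := x))) = (\<Sum>u\<in>tuples n K. \<Sum>x\<in>vecs {..<n i}. F (u(i := x)))"
    by (rule sum.swap)
  then show ?thesis
    unfolding mean_def using assms by (simp add: tuples_insert card_tuples_insert sum_divide_distrib[symmetric])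
qed

lemma mean_mono: "(\<And>u. u \<in> tuples n K \<Longrightarrow> F u \<le> G u) \<Longrightarrow> mean n K F \<le> mean n K G"
  unfolding mean_def by (intro divide_right_mono sum_mono) auto

lemma mean_cong: "(\<And>u. u \<in> tuples n K \<Longrightarrow> F u = G u) \<Longrightarrow> mean n K F = mean n K G"
  unfolding mean_def by (auto cong: sum.cong)

lemma mean_nonneg: "(\<And>u. u \<in> tuples n K \<Longrightarrow> 0 \<le> F u) \<Longrightarrow> 0 \<le> mean n K F"
  unfolding mean_def by (intro divide_nonneg_nonneg sum_nonneg) auto

lemma mean_add: "mean n K (\<lambda>u. F u + G u) = mean n K F + mean n K G"
  and mean_diff: "mean n K (\<lambda>u. F u - G u) = mean n K F - mean n K G"
  and mean_mult: "mean n K (\<lambda>u. c * F u) = c * mean n K F"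
  and mean_mult_right: "mean n K (\<lambda>u. F u * c) = mean n K F * c"
  by (simp_all add: mean_def sum.distrib add_divide_distrib sum_subtractf diff_divide_distrib
     flip: sum_distrib_left sum_distrib_right)

lemma mean_sum: "mean n K (\<lambda>u. \<Sum>a\<in>A. H a u) = (\<Sum>a\<in>A. mean n K (H a))"
  unfolding mean_def by (subst sum.swap) (simp only: sum_divide_distrib)

lemma mean_const: "finite K \<Longrightarrow> mean n K (\<lambda>_. c) = c"
  using tuples_card[of K n] by (simp add: mean_def)

lemma mean_pos_ex: "mean n K F > 0 \<Longrightarrow> \<exists>u\<in>tuples n K. F u > 0"
proof (rule ccontr)
  assume "mean n K F > 0" "\<not> (\<exists>u\<in>tuples n K. F u > 0)"
  then have "\<And>u. u \<in> tuples n K \<Longrightarrow> F u \<le> 0" by (simp add: not_less)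
  then have "mean n K F \<le> 0"
    unfolding mean_def by (intro divide_nonpos_nonneg sum_nonpos) auto
  with \<open>mean n K F > 0\<close> show False by simp
qed

lemma mean_subset:
  assumes "finite K" "K' \<subseteq> K" "\<And>u v. (\<forall>i\<in>K'. u i = v i) \<Longrightarrow> F u = F v"
  shows "mean n K F = mean n K' F"
proof -
  have "mean n (K' \<union> L) F = mean n K' F" if "finite L" "L \<inter> K' = {}" for L
    using that
  proof (induction L rule: finite_induct)
    case (insert i L)
    have "F (u(i := x)) = F u" for u x using assms(3)[of "u(i := x)" u] insert.prems by auto
    then have "mean n (insert i (K' \<union> L)) F = mean n (K' \<union> L) F"
      using insert finite_subset[OF assms(2,1)] by (subst mean_insert) auto
    then show ?case using insert by simp
  qed simp
  from this[of "K - K'"] show ?thesis using assms(1,2) by (simp add: Un_absorb1 Int_commute)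
qed

text \<open>The conditions at \<open>i\<close> may look only at coordinates before \<open>i\<close>.
  Once those are fixed, the tree demands at most \<open>k\<close> linear equations of
  \<open>u i\<close>.\<close>

definition ctree :: "(nat \<Rightarrow> nat) \<Rightarrow> nat set \<Rightarrow> nat \<Rightarrow> (nat \<Rightarrow> tup \<Rightarrow> (nat \<Rightarrow> bit) set) \<Rightarrow> bool"
  where "ctree n J k \<Lambda> \<longleftrightarrow> (\<forall>i\<in>J. \<forall>u. finite (\<Lambda> i u) \<and> \<Lambda> i u \<subseteq> vecs {..<n i} \<and> card (\<Lambda> i u) \<le> k \<and>
    (\<forall>v. agree n {j\<in>J. j < i} u v \<longrightarrow> \<Lambda> i u = \<Lambda> i v))"

definition tree_zeros :: "(nat \<Rightarrow> nat) \<Rightarrow> nat set \<Rightarrow> (nat \<Rightarrow> tup \<Rightarrow> (nat \<Rightarrow> bit) set) \<Rightarrow> tup set"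
  where "tree_zeros n J \<Lambda> = {u. \<forall>i\<in>J. \<forall>y\<in>\<Lambda> i u. dot {..<n i} (u i) y = 0}"

lemma ctreeD:
  assumes "ctree n J k \<Lambda>" "i \<in> J"
  shows "finite (\<Lambda> i u)" "\<Lambda> i u \<subseteq> vecs {..<n i}" "card (\<Lambda> i u) \<le> k"
    "agree n {j\<in>J. j < i} u v \<Longrightarrow> \<Lambda> i u = \<Lambda> i v"
  using assms by (auto simp: ctree_def)

lemma ctree_Un: "ctree n J k \<Lambda> \<Longrightarrow> ctree n J k' \<Lambda>' \<Longrightarrow> ctree n J (k + k') (\<lambda>i u. \<Lambda> i u \<union> \<Lambda>' i u)"
  unfolding ctree_def by (fastforce intro: order_trans[OF card_Un_le] add_mono)

lemma ctree_mono: "ctree n J k \<Lambda> \<Longrightarrow> k \<le> k' \<Longrightarrow> ctree n J k' \<Lambda>"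
  unfolding ctree_def by (meson order_trans)

lemma ctree_empty: "ctree n J 0 (\<lambda>i u. {})"
  by (simp add: ctree_def)

text \<open>With the earlier coordinates fixed, a form whose last coordinate is \<open>i\<close> is
  linear in \<open>u i\<close>. Its value can be prescribed together with those of the others unless
  a combination of the gradients is already decided by the tree; this is the case excluded in
  \<open>card_solutions\<close>.\<close>

definition dependent_at :: "(nat \<Rightarrow> tup \<Rightarrow> (nat \<Rightarrow> bit) set) \<Rightarrow> (nat set \<times> (tup \<Rightarrow> bit)) set \<Rightarrow> (nat \<Rightarrow> nat) \<Rightarrow> nat \<Rightarrow> tup \<Rightarrow> bool"
  where "dependent_at \<Lambda> A n i u \<longleftrightarrow> (\<exists>B\<subseteq>{p\<in>A. Max (fst p) = i}. B \<noteq> {} \<and>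
     (\<exists>C\<subseteq>\<Lambda> i u. (\<Sum>p\<in>B. partial n i (snd p) u) = \<Sum>C))"

text \<open>The coordinates are exposed in increasing order. At each of them, the tree and the forms
  ending there impose at most \<open>k + N\<close> linear equations, solved by a proportion
  \<open>(1/2)^(k + N)\<close> of the vectors unless \<open>dependent_at\<close> holds; this
  exception costs at most \<open>c\<close> per coordinate.\<close>

lemma expose:
  fixes c :: real
  assumes "finite J" "ctree n J k \<Lambda>" "finite A" "card A \<le> N"
    and "\<And>S f. (S, f) \<in> A \<Longrightarrow> S \<subseteq> J \<and> S \<noteq> {} \<and> mlform n S f" and c: "c \<ge> (0::real)"
    and "\<And>i. i \<in> J \<Longrightarrow> prob n {j\<in>J. j < i} (dependent_at \<Lambda> A n i) \<le> c"
  shows "((1/2)^(k + N))^card J - card J * c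
    \<le> prob n J (\<lambda>u. u \<in> tree_zeros n J \<Lambda> \<and> (\<forall>p\<in>A. snd p u = t p))"
  using assms(1-5,7)
proof (induction J arbitrary: A rule: finite_linorder_max_induct)
  case empty
  then have "A = {}" by auto
  then show ?case by (simp add: mean_def tuples_empty tree_zeros_def)
next
  case (insert b J)
  define q where "q = (1/2::real)^(k + N)"
  have q: "q > 0" "q \<le> 1" by (simp_all add: q_def power_le_one)
  define A' where "A' = {p\<in>A. fst p \<subseteq> J}"
  have bJ: "b \<notin> J" using insert.hyps by auto
  have seg: "{j\<in>insert b J. j < i} = {j\<in>J. j < i}" if "i \<in> J" for i using that insert.hyps by auto
  have segb: "{j\<in>insert b J. j < b} = J" using insert.hyps by auto
  have tJ: "ctree n J k \<Lambda>"
    using insert.prems(1) seg unfolding ctree_def by (metis insert_iff)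
  have A': "finite A'" "card A' \<le> N"
    using insert.prems(2,3) by (auto simp: A'_def intro: order_trans[OF card_mono])
  have maxb: "Max (fst p) = b" "b \<in> fst p" if "p \<in> A - A'" for p
  proof -
    obtain S f where p: "p = (S, f)" by (cases p)
    then have S: "S \<subseteq> insert b J" "b \<in> S" using that insert.prems(4)[of S f] by (auto simp: A'_def)
    then have "finite S" using insert.hyps finite_subset by auto
    moreover have "y \<le> b" if "y \<in> S" for y using that S(1) insert.hyps(2) by fastforce
    ultimately have "Max S = b" using S by (intro Max_eqI) auto
    then show "Max (fst p) = b" "b \<in> fst p" using p S by auto
  qed
  have maxJ: "Max (fst p) \<noteq> b" if "p \<in> A'" for p
  proof -
    obtain S f where p: "p = (S, f)" by (cases p)
    then have S: "S \<subseteq> J" "S \<noteq> {}" using that insert.prems(4)[of S f] by (auto simp: A'_def)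
    then have "finite S" using insert.hyps finite_subset by auto
    then have "Max S \<in> J" using S Max_in[of S] by (meson subsetD)
    then have "Max S \<noteq> b" using bJ by metis
    then show ?thesis using p by simp
  qed
  have Ab: "{p\<in>A. Max (fst p) = b} = A - A'"
  proof (intro equalityI subsetI)
    fix p assume "p \<in> {p\<in>A. Max (fst p) = b}"
    then show "p \<in> A - A'" using maxJ[of p] by blast
  next
    fix p assume "p \<in> A - A'"
    then show "p \<in> {p\<in>A. Max (fst p) = b}" using maxb(1)[of p] by blast
  qed
  define Y where "Y u \<longleftrightarrow> u \<in> tree_zeros n J \<Lambda> \<and> (\<forall>p\<in>A'. snd p u = t p)" for u
  have IH: "q ^ card J - card J * c \<le> prob n J Y"
    unfolding q_def Y_def
  proof (rule insert.IH[OF tJ A'])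
    show "S \<subseteq> J \<and> S \<noteq> {} \<and> mlform n S f" if "(S, f) \<in> A'" for S f
      using that insert.prems(4)[of S f] by (auto simp: A'_def)
    fix i assume i: "i \<in> J"
    have "dependent_at \<Lambda> A' n i u \<Longrightarrow> dependent_at \<Lambda> A n i u" for u
      unfolding dependent_at_def A'_def by blast
    then have "prob n {j\<in>J. j < i} (dependent_at \<Lambda> A' n i) \<le> prob n {j\<in>J. j < i} (dependent_at \<Lambda> A n i)"
      by (intro mean_mono) auto
    then show "prob n {j\<in>J. j < i} (dependent_at \<Lambda> A' n i) \<le> c"
      using insert.prems(5)[of i] seg[OF i] i by simp
  qed
  define P where "P u \<longleftrightarrow> u \<in> tree_zeros n (insert b J) \<Lambda> \<and> (\<forall>p\<in>A. snd p u = t p)" for u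
  let ?G = "vecs {..<n b}"
  have P: "P (u(b := x)) \<longleftrightarrow> Y u \<and> (\<forall>y\<in>\<Lambda> b u. dot {..<n b} x y = 0) \<and>
      (\<forall>p\<in>A - A'. dot {..<n b} x (partial n b (snd p) u) = t p)" for u x
  proof -
    have L: "\<Lambda> i (u(b := x)) = \<Lambda> i u" if "i \<in> insert b J" for i
      using that insert.hyps by (intro ctreeD(4)[OF insert.prems(1)] agree_upd_notin) auto
    then have "u(b := x) \<in> tree_zeros n (insert b J) \<Lambda> \<longleftrightarrow> u \<in> tree_zeros n J \<Lambda> \<and> (\<forall>y\<in>\<Lambda> b u. dot {..<n b} x y = 0)"
      using bJ by (auto simp: tree_zeros_def)
    moreover have "snd p (u(b := x)) = snd p u" if "p \<in> A'" for p
    proof -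
      obtain S f where p: "p = (S, f)" by (cases p)
      then have "mlform n S f" "b \<notin> S" using that insert.prems(4)[of S f] bJ by (auto simp: A'_def)
      then show ?thesis using p mlform_agree agree_upd_notin by fastforce
    qed
    moreover have "snd p (u(b := x)) = dot {..<n b} x (partial n b (snd p) u)" if "p \<in> A - A'" for p
    proof -
      obtain S f where p: "p = (S, f)" by (cases p)
      then have "mlform n S f" "b \<in> S" using that insert.prems(4)[of S f] maxb[OF that] by auto
      then show ?thesis using p mlform_partial by fastforce
    qed
    moreover have "(\<forall>p\<in>A. Q p) \<longleftrightarrow> (\<forall>p\<in>A'. Q p) \<and> (\<forall>p\<in>A - A'. Q p)" for Q
      by (auto simp: A'_def)
    ultimately show ?thesis unfolding P_def Y_def by (simp, simp only: conj_ac)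
  qed
  \<comment> \<open>At dependent tuples the left side is at most 0, so nothing has to be counted
    there.\<close>
  have cnt: "q * (of_bool (Y u) - of_bool (dependent_at \<Lambda> A n b u)) \<le> (\<Sum>x\<in>?G. of_bool (P (u(b := x)))) / card ?G" for u
  proof (cases "Y u \<and> \<not> dependent_at \<Lambda> A n b u")
    case True
    have Lb: "finite (\<Lambda> b u)" "\<Lambda> b u \<subseteq> ?G" "card (\<Lambda> b u) \<le> k"
      using ctreeD[OF insert.prems(1), of b u] by auto
    let ?S = "{x\<in>?G. (\<forall>y\<in>\<Lambda> b u. dot {..<n b} x y = 0) \<and> (\<forall>p\<in>A - A'. dot {..<n b} x (partial n b (snd p) u) = t p)}"
    have nd: "(\<Sum>p\<in>B. partial n b (snd p) u) \<noteq> \<Sum>C" if "B \<subseteq> A - A'" "B \<noteq> {}" "C \<subseteq> \<Lambda> b u" for B C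
      using True that unfolding dependent_at_def Ab by blast
    have fA: "finite (A - A')" using insert.prems(2) by simp
    have "card (A - A') \<le> card A" using insert.prems(2) by (intro card_mono) auto
    then have cA: "card (A - A') \<le> N" using insert.prems(3) by simp
    have im: "(\<lambda>p. partial n b (snd p) u) ` (A - A') \<subseteq> ?G" using partial_vecs by blast
    have "card ?G \<le> card ?S * 2 ^ (card (\<Lambda> b u) + card (A - A'))"
      by (rule card_solutions[OF _ Lb(1,2) fA im nd]) simp
    also have "\<dots> \<le> card ?S * 2 ^ (k + N)"
      using Lb(3) cA by (intro mult_left_mono power_increasing add_mono) auto
    finally have "real (card ?G) \<le> real (card ?S * 2 ^ (k + N))" by (simp only: of_nat_le_iff)
    then have "q * card ?G \<le> card ?S" by (simp add: q_def field_simps power_divide)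
    moreover have "(\<Sum>x\<in>?G. of_bool (P (u(b := x)))) = real (card ?S)"
      using True card_vecs(1)[of "{..<n b}"] by (simp add: P of_bool_def sum.If_cases Int_def)
    ultimately show ?thesis using True by (simp add: le_divide_eq)
  next
    case False
    then have "q * (of_bool (Y u) - of_bool (dependent_at \<Lambda> A n b u)) \<le> 0" using q by (auto simp: mult_le_0_iff)
    then show ?thesis by (rule order_trans) (intro divide_nonneg_nonneg sum_nonneg, auto)
  qed
  \<comment> \<open>Since \<open>q \<le> 1\<close>, losses from earlier coordinates only shrink, and
    the total loss is at most their sum.\<close>
  have "q ^ card (insert b J) - card (insert b J) * c \<le> q * (q ^ card J - card J * c - c)"
  proof -
    have "q * ((real (card J) + 1) * c) \<le> 1 * ((real (card J) + 1) * c)" using q c by (intro mult_right_mono) auto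
    then show ?thesis using bJ insert.hyps by (simp add: algebra_simps)
  qed
  also have "\<dots> \<le> q * (prob n J Y - prob n J (dependent_at \<Lambda> A n b))"
  proof (rule mult_left_mono)
    have "prob n J (dependent_at \<Lambda> A n b) \<le> c" using insert.prems(5)[of b] unfolding segb by simp
    with IH show "q ^ card J - card J * c - c \<le> prob n J Y - prob n J (dependent_at \<Lambda> A n b)" by linarith
  qed (use q in simp)
  also have "\<dots> = mean n J (\<lambda>u. q * (of_bool (Y u) - of_bool (dependent_at \<Lambda> A n b u)))"
    by (simp add: mean_mult mean_diff)
  also have "\<dots> \<le> mean n J (\<lambda>u. (\<Sum>x\<in>?G. of_bool (P (u(b := x)))) / card ?G)"
    by (rule mean_mono[OF cnt])
  also have "\<dots> = prob n (insert b J) P"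
    by (rule mean_insert'[symmetric]) (use insert.hyps bJ in auto)
  finally show ?case unfolding q_def P_def .
qed

text \<open>Exposure without forms, where no dependency can occur.\<close>

lemma ctree_density:
  assumes "finite J" "ctree n J k \<Lambda>"
  shows "((1/2)^k)^card J \<le> prob n J (\<lambda>u. u \<in> tree_zeros n J \<Lambda>)"
proof -
  have "prob n K (dependent_at \<Lambda> {} n i) \<le> 0" for K i by (simp add: dependent_at_def mean_def)
  from expose[OF assms, of "{}" 0 0, OF _ _ _ _ this] show ?thesis by simp
qed

subsection \<open>Forms vanishing on most of a dense set vanish on a tree\<close>

lemma ctree_UN:
  assumes "finite L" "\<And>l. l \<in> L \<Longrightarrow> ctree n J k (\<Lambda> l)"
  shows "ctree n J (card L * k) (\<lambda>i u. \<Union>l\<in>L. \<Lambda> l i u)"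
  unfolding ctree_def
proof (intro ballI allI conjI impI)
  fix i u assume i: "i \<in> J"
  note D = ctreeD[OF assms(2) i]
  show "finite (\<Union>l\<in>L. \<Lambda> l i u)" "(\<Union>l\<in>L. \<Lambda> l i u) \<subseteq> vecs {..<n i}"
    using D(1) assms(1) apply simp
    using D(2) by blast
  have "card (\<Union>l\<in>L. \<Lambda> l i u) \<le> (\<Sum>l\<in>L. card (\<Lambda> l i u))" by (rule card_UN_le[OF assms(1)])
  also have "\<dots> \<le> card L * k" using sum_bounded_above[of L "\<lambda>l. card (\<Lambda> l i u)" k] D(3) by simp
  finally show "card (\<Union>l\<in>L. \<Lambda> l i u) \<le> card L * k" .
  fix v assume "agree n {j\<in>J. j < i} u v"
  then show "(\<Union>l\<in>L. \<Lambda> l i u) = (\<Union>l\<in>L. \<Lambda> l i v)" using D(4) by (intro SUP_cong) auto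
qed

text \<open>The level \<beta> is relative to the mean of \<nu>, so the notion is insensitive to
  scaling \<nu>; \<open>common_ctree\<close> scales a density down to stay below 1.\<close>

definition captures :: "(nat \<Rightarrow> nat) \<Rightarrow> nat set \<Rightarrow> nat \<Rightarrow> real \<Rightarrow> (tup \<Rightarrow> real) \<Rightarrow> (nat \<Rightarrow> tup \<Rightarrow> (nat \<Rightarrow> bit) set) \<Rightarrow> bool"
  where "captures n J k \<beta> \<nu> \<Lambda> \<longleftrightarrow> ctree n J k \<Lambda> \<and> (\<forall>r. mlform n J r \<and>
       mean n J (\<lambda>u. \<nu> u * of_bool (r u = 1)) \<le> \<beta> * mean n J \<nu> \<longrightarrow> (\<forall>u\<in>tree_zeros n J \<Lambda>. r u = 0))"

text \<open>\<beta> precedes \<delta>; this is what finally makes \<epsilon> independent of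
  \<delta>. Weights replace sets because \<open>common_ctree\<close> applies the statement to a
  mixture of uniform distributions.\<close>

definition tree_for_dense :: "nat \<Rightarrow> bool"
  where "tree_for_dense d \<longleftrightarrow> (\<exists>\<beta>>0. \<forall>\<delta>>0. \<exists>k. \<forall>n J \<nu>. finite J \<and> card J = d \<and>
    (\<forall>u\<in>tuples n J. 0 \<le> \<nu> u \<and> \<nu> u \<le> 1) \<and> \<delta> \<le> mean n J \<nu> \<longrightarrow> (\<exists>\<Lambda>. captures n J k \<beta> \<nu> \<Lambda>))"

definition dominates :: "(nat \<Rightarrow> nat) \<Rightarrow> nat set \<Rightarrow> nat \<Rightarrow> real \<Rightarrow> 'w set \<Rightarrow>
    ('w \<Rightarrow> nat \<Rightarrow> tup \<Rightarrow> (nat \<Rightarrow> bit) set) \<Rightarrow> (nat \<Rightarrow> tup \<Rightarrow> (nat \<Rightarrow> bit) set) \<Rightarrow> bool"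
  where "dominates n J k c \<Omega> \<Lambda> \<Lambda>' \<longleftrightarrow> ctree n J k \<Lambda>' \<and> (\<forall>r. mlform n J r \<and>
    c * card \<Omega> \<le> card {\<omega>\<in>\<Omega>. \<forall>u\<in>tree_zeros n J (\<Lambda> \<omega>). r u = 0} \<longrightarrow> (\<forall>u\<in>tree_zeros n J \<Lambda>'. r u = 0))"

text \<open>Draw \<open>s\<close> members of \<Omega> at random, then a random common zero of their
  trees. A form vanishing on the zeros of a proportion \<open>c\<close> of the trees can be 1 at
  that point only if all \<open>s\<close> draws miss these trees, an event of probability below
  \<beta>. Applying \<open>tree_for_dense\<close> in the same number of coordinates to the
  distribution of the point yields one tree for all such forms.\<close>

lemma common_ctree:
  fixes c :: real
  assumes T: "tree_for_dense d" and "c > 0"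
  shows "\<exists>k'. \<forall>n J (\<Omega> :: 'w set) \<Lambda>. finite J \<and> card J = d \<and> finite \<Omega> \<and> \<Omega> \<noteq> {} \<and>
    (\<forall>\<omega>\<in>\<Omega>. ctree n J k (\<Lambda> \<omega>)) \<longrightarrow> (\<exists>\<Lambda>'. dominates n J k' c \<Omega> \<Lambda> \<Lambda>')"
proof -
  obtain \<beta> where \<beta>: "\<beta> > 0" and T': "\<And>\<delta>. \<delta> > 0 \<Longrightarrow> \<exists>k. \<forall>n J \<nu>. finite J \<and> card J = d \<and>
    (\<forall>u\<in>tuples n J. 0 \<le> \<nu> u \<and> \<nu> u \<le> 1) \<and> \<delta> \<le> mean n J \<nu> \<longrightarrow> (\<exists>\<Lambda>. captures n J k \<beta> \<nu> \<Lambda>)"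
    using T unfolding tree_for_dense_def by blast
  \<comment> \<open>The maximum keeps the powers nonnegative when \<open>c > 1\<close>.\<close>
  define e where "e = max 0 (1 - c)"
  have e: "0 \<le> e" "e < 1" using assms(2) by (auto simp: e_def)
  obtain s where s: "e ^ s < \<beta>"
    using real_arch_pow_inv[OF \<beta> e(2)] by blast
  \<comment> \<open>The lower bound from \<open>ctree_density\<close> for the common zeros of
    \<open>s\<close> trees of width \<open>k\<close>.\<close>
  define \<eta> where "\<eta> = ((1/2::real) ^ (s * k)) ^ d"
  have \<eta>: "\<eta> > 0" by (simp add: \<eta>_def)
  obtain k' where k': "\<And>n J \<nu>. finite J \<Longrightarrow> card J = d \<Longrightarrow>
    (\<forall>u\<in>tuples n J. 0 \<le> \<nu> u \<and> \<nu> u \<le> 1) \<Longrightarrow> \<eta> \<le> mean n J \<nu> \<Longrightarrow> (\<exists>\<Lambda>. captures n J k' \<beta> \<nu> \<Lambda>)"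
    using T'[OF \<eta>] by blast
  show ?thesis
  proof (rule exI[of _ k'], intro allI impI, elim conjE)
    fix n J and \<Omega> :: "'w set" and \<Lambda>
    assume J: "finite J" "card J = d" and \<Omega>: "finite \<Omega>" "\<Omega> \<noteq> {}" and tr: "\<forall>\<omega>\<in>\<Omega>. ctree n J k (\<Lambda> \<omega>)"
    define W where "W = ({..<s} \<rightarrow>\<^sub>E \<Omega>)"
    define D where "D xs = tree_zeros n J (\<lambda>i u. \<Union>l\<in>{..<s}. \<Lambda> (xs l) i u)" for xs
    define p where "p xs = prob n J (\<lambda>u. u \<in> D xs)" for xs
    have W: "finite W" "card W > 0" and cW: "card W = card \<Omega> ^ s"
      using \<Omega> by (auto simp: W_def finite_PiE card_PiE card_gt_0_iff)
    have p: "\<eta> \<le> p xs" if "xs \<in> W" for xs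
    proof -
      have "ctree n J (card {..<s} * k) (\<lambda>i u. \<Union>l\<in>{..<s}. \<Lambda> (xs l) i u)"
        using that tr by (intro ctree_UN) (auto simp: W_def)
      from ctree_density[OF J(1) this] show ?thesis by (simp add: \<eta>_def p_def D_def J)
    qed
    have p0: "0 < p xs" if "xs \<in> W" for xs using p[OF that] \<eta> by simp
    \<comment> \<open>The density of the drawn point times \<eta>. Dividing by \<open>p xs\<close>
      gives all draws the same total weight, and \<eta> \<le> \<open>p xs\<close> keeps \<nu> at
      most 1.\<close>
    define \<nu> where "\<nu> u = (\<Sum>xs\<in>W. \<eta> / p xs * of_bool (u \<in> D xs)) / card W" for u
    have \<nu>: "0 \<le> \<nu> u" "\<nu> u \<le> 1" for u
    proof -
      show "0 \<le> \<nu> u" unfolding \<nu>_def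
        using \<eta> p0 by (intro divide_nonneg_nonneg sum_nonneg mult_nonneg_nonneg) (auto intro: less_imp_le)
      have "(\<Sum>xs\<in>W. \<eta> / p xs * of_bool (u \<in> D xs)) \<le> (\<Sum>xs\<in>W. 1)"
        using p p0 by (intro sum_mono) (auto simp: divide_le_eq intro: less_imp_le)
      then show "\<nu> u \<le> 1" using W by (simp add: \<nu>_def divide_le_eq)
    qed
    have avF: "mean n J (\<lambda>u. \<nu> u * F u) = (\<Sum>xs\<in>W. \<eta> / p xs * mean n J (\<lambda>u. of_bool (u \<in> D xs) * F u)) / card W" for F
    proof -
      have "\<nu> u * F u = (\<Sum>xs\<in>W. \<eta> / p xs * (of_bool (u \<in> D xs) * F u)) * (1 / card W)" for u
        by (simp add: \<nu>_def sum_distrib_left sum_distrib_right sum_divide_distrib mult_ac)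
      then show ?thesis by (simp only: mean_mult_right mean_sum mean_mult) simp
    qed
    have av\<nu>: "mean n J \<nu> = \<eta>"
    proof -
      have "mean n J \<nu> = (\<Sum>xs\<in>W. \<eta> / p xs * p xs) / card W" using avF[of "\<lambda>_. 1"] by (simp add: p_def)
      also have "\<dots> = (\<Sum>xs\<in>W. \<eta>) / card W" using p0 by (intro arg_cong2[of _ _ _ _ "(/)"] sum.cong) force+
      finally show ?thesis using W by (auto simp: card_gt_0_iff)
    qed
    have "\<exists>\<Lambda>'. captures n J k' \<beta> \<nu> \<Lambda>'"
      by (rule k'[OF J]) (use \<nu> av\<nu> in auto)
    then obtain \<Lambda>' where "captures n J k' \<beta> \<nu> \<Lambda>'" by blast
    then have \<Lambda>': "ctree n J k' \<Lambda>'" and van: "\<And>r. mlform n J r \<Longrightarrow>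
       mean n J (\<lambda>u. \<nu> u * of_bool (r u = 1)) \<le> \<beta> * mean n J \<nu> \<Longrightarrow> (\<forall>u\<in>tree_zeros n J \<Lambda>'. r u = 0)"
      unfolding captures_def by blast+
    show "\<exists>\<Lambda>'. dominates n J k' c \<Omega> \<Lambda> \<Lambda>'"
      unfolding dominates_def
    proof (rule exI[of _ \<Lambda>'], intro conjI \<Lambda>' allI impI, elim conjE)
      fix r assume r: "mlform n J r" and big: "c * card \<Omega> \<le> card {\<omega>\<in>\<Omega>. \<forall>u\<in>tree_zeros n J (\<Lambda> \<omega>). r u = 0}"
      define Gd where "Gd = {\<omega>\<in>\<Omega>. \<forall>u\<in>tree_zeros n J (\<Lambda> \<omega>). r u = 0}"
      have Gd: "Gd \<subseteq> \<Omega>" "finite Gd" using \<Omega> by (auto simp: Gd_def)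
      have "real (card (\<Omega> - Gd)) = real (card \<Omega>) - real (card Gd)"
        using Gd \<Omega> by (simp add: card_Diff_subset card_mono of_nat_diff)
      also have "\<dots> \<le> e * card \<Omega>"
      proof -
        have "(1 - c) * card \<Omega> \<le> e * card \<Omega>" by (intro mult_right_mono) (auto simp: e_def)
        then show ?thesis using big by (simp add: Gd_def algebra_simps)
      qed
      finally have bad: "real (card (\<Omega> - Gd)) \<le> e * card \<Omega>" .
      have each: "\<eta> / p xs * mean n J (\<lambda>u. of_bool (u \<in> D xs) * of_bool (r u = 1))
          \<le> \<eta> * of_bool (xs \<in> {..<s} \<rightarrow>\<^sub>E (\<Omega> - Gd))" if xs: "xs \<in> W" for xs
      proof (cases "xs \<in> {..<s} \<rightarrow>\<^sub>E (\<Omega> - Gd)")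
        case True
        have "mean n J (\<lambda>u. of_bool (u \<in> D xs) * of_bool (r u = 1)) \<le> p xs"
          unfolding p_def by (intro mean_mono) auto
        then have "\<eta> / p xs * mean n J (\<lambda>u. of_bool (u \<in> D xs) * of_bool (r u = 1)) \<le> \<eta> / p xs * p xs"
          using \<eta> p0[OF xs] by (intro mult_left_mono) auto
        then show ?thesis using True p0[OF xs] by simp
      next
        case False
        then obtain l where l: "l < s" "xs l \<in> Gd" using xs by (auto simp: W_def PiE_iff)
        have "r u = 0" if "u \<in> D xs" for u
        proof -
          have "u \<in> tree_zeros n J (\<Lambda> (xs l))" using that l(1) by (auto simp: D_def tree_zeros_def)
          then show ?thesis using l(2) by (simp add: Gd_def)
        qed
        then have "mean n J (\<lambda>u. of_bool (u \<in> D xs) * of_bool (r u = 1)) = mean n J (\<lambda>u. 0)"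
          by (intro mean_cong) auto
        then show ?thesis using \<eta> J by (simp add: mean_const)
      qed
      have "mean n J (\<lambda>u. \<nu> u * of_bool (r u = 1)) \<le> (\<Sum>xs\<in>W. \<eta> * of_bool (xs \<in> {..<s} \<rightarrow>\<^sub>E (\<Omega> - Gd))) / card W"
        unfolding avF by (intro divide_right_mono sum_mono each) auto
      also have "\<dots> = \<eta> * card ({..<s} \<rightarrow>\<^sub>E (\<Omega> - Gd)) / card W"
      proof -
        have "({..<s} \<rightarrow>\<^sub>E (\<Omega> - Gd)) \<subseteq> W" unfolding W_def by (rule PiE_mono) auto
        then have "{xs\<in>W. xs \<in> {..<s} \<rightarrow>\<^sub>E (\<Omega> - Gd)} = {..<s} \<rightarrow>\<^sub>E (\<Omega> - Gd)" by blast
        then have "(\<Sum>xs\<in>W. of_bool (xs \<in> {..<s} \<rightarrow>\<^sub>E (\<Omega> - Gd))) = real (card ({..<s} \<rightarrow>\<^sub>E (\<Omega> - Gd)))"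
          using W by (simp add: of_bool_def sum.If_cases Int_def)
        then show ?thesis by (simp only: sum_distrib_left[symmetric])
      qed
      also have "\<dots> = \<eta> * (real (card (\<Omega> - Gd)) ^ s / real (card \<Omega>) ^ s)"
        by (simp add: cW card_PiE)
      also have "\<dots> \<le> \<eta> * ((e * card \<Omega>) ^ s / real (card \<Omega>) ^ s)"
        using \<eta> bad by (intro mult_left_mono divide_right_mono power_mono) auto
      also have "\<dots> = \<eta> * e ^ s" using \<Omega> by (simp add: power_mult_distrib)
      also have "\<dots> \<le> \<eta> * \<beta>" using \<eta> s by (intro mult_left_mono) auto
      finally show "\<forall>u\<in>tree_zeros n J \<Lambda>'. r u = 0"
        by (intro van[OF r]) (simp add: av\<nu> mult.commute)
    qed
  qed
qed

text \<open>Without coordinates a form is constant, and any level below 1 rules out the constant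
  1.\<close>

lemma tree_for_dense_0: "tree_for_dense 0"
proof -
  have "\<exists>\<Lambda>. captures n J 0 (1/2) \<nu> \<Lambda>" if J: "finite J" "card J = 0" and av: "\<delta> > 0" "\<delta> \<le> mean n J \<nu>"
    for n J and \<nu> :: "tup \<Rightarrow> real" and \<delta> :: real
  proof -
    have J0: "J = {}" using J by simp
    have "r u = 0" if r: "mlform n J r" and le: "mean n J (\<lambda>u. \<nu> u * of_bool (r u = 1)) \<le> 1/2 * mean n J \<nu>" for r u
    proof -
      have "r u = r (\<lambda>_. undefined)" by (rule mlform_agree[OF r]) (simp add: J0 agree_def)
      then show ?thesis using le av by (cases "r (\<lambda>_. undefined)") (auto simp: J0 mean_def tuples_empty)
    qed
    then show ?thesis unfolding captures_def using ctree_empty by blast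
  qed
  note * = this
  show ?thesis unfolding tree_for_dense_def
  proof (rule exI[of _ "1/2"], intro conjI allI impI)
    fix \<delta> :: real assume "\<delta> > 0"
    with * show "\<exists>k. \<forall>n J \<nu>. finite J \<and> card J = 0 \<and> (\<forall>u\<in>tuples n J. 0 \<le> \<nu> u \<and> \<nu> u \<le> 1) \<and> \<delta> \<le> mean n J \<nu> \<longrightarrow>
      (\<exists>\<Lambda>. captures n J k (1/2) \<nu> \<Lambda>)"
      by (intro exI[of _ 0] allI impI) (elim conjE, rule *)
  qed simp
qed

text \<open>Slice along the first coordinate. Each dense slice has a tree by induction. If
  \<open>h\<close> is a sum of \<open>m\<close> vectors with well-behaved slices, linearity makes
  the form at \<open>h\<close> vanish on the common zeros of their trees. By
  \<open>robust_bogolyubov\<close> this happens for a positive proportion of the representations of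
  \<open>h\<close>, and \<open>common_ctree\<close> merges the trees of all representations into one
  that depends on \<open>h\<close> but not on the form.\<close>

lemma tree_for_dense_Suc:
  assumes T: "tree_for_dense d"
  shows "tree_for_dense (Suc d)"
proof -
  obtain \<beta> where \<beta>: "\<beta> > 0" and T': "\<And>\<delta>. \<delta> > 0 \<Longrightarrow> \<exists>k. \<forall>n J \<nu>. finite J \<and> card J = d \<and>
    (\<forall>u\<in>tuples n J. 0 \<le> \<nu> u \<and> \<nu> u \<le> 1) \<and> \<delta> \<le> mean n J \<nu> \<longrightarrow> (\<exists>\<Lambda>. captures n J k \<beta> \<nu> \<Lambda>)"
    using T unfolding tree_for_dense_def by blast
  show ?thesis unfolding tree_for_dense_def
  \<comment> \<open>A quarter of the weight may be lost: one eighth goes to slices of density below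
    \<delta> / 8, one eighth to slices on which the form is 1 too often.\<close>
  proof (rule exI[of _ "\<beta> / 8"], intro conjI allI impI)
    fix \<delta> :: real assume \<delta>: "\<delta> > 0"
    then have \<delta>8: "\<delta> / 8 > 0" by simp
    obtain k1 where k1: "\<And>n J \<nu>. finite J \<Longrightarrow> card J = d \<Longrightarrow>
      (\<forall>u\<in>tuples n J. 0 \<le> \<nu> u \<and> \<nu> u \<le> 1) \<Longrightarrow> \<delta> / 8 \<le> mean n J \<nu> \<Longrightarrow> (\<exists>\<Lambda>. captures n J k1 \<beta> \<nu> \<Lambda>)"
      using T'[OF \<delta>8] by blast
    obtain m k2 c where c: "c > 0"
      and RB: "\<forall>(M :: nat set) f. finite M \<and> (\<forall>x\<in>vecs M. 0 \<le> f x \<and> f x \<le> 1) \<and>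
        sum f (vecs M) \<ge> \<delta> * card (vecs M) \<longrightarrow> (\<exists>\<Lambda>. bogolyubov_set M f m k2 c \<Lambda>)"
      using robust_bogolyubov[OF \<delta>, where 'm = nat] by (elim exE conjE) (rule that)
    obtain k3 where k3: "\<forall>n J (\<Omega> :: (nat \<Rightarrow> nat \<Rightarrow> bit) set) \<Lambda>. finite J \<and> card J = d \<and> finite \<Omega> \<and> \<Omega> \<noteq> {} \<and>
      (\<forall>\<omega>\<in>\<Omega>. ctree n J (m * k1) (\<Lambda> \<omega>)) \<longrightarrow> (\<exists>\<Lambda>'. dominates n J k3 c \<Omega> \<Lambda> \<Lambda>')"
      using common_ctree[OF T c, of "m * k1", where 'w = "nat \<Rightarrow> nat \<Rightarrow> bit"] by (elim exE) (rule that)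
    show "\<exists>k. \<forall>n J \<nu>. finite J \<and> card J = Suc d \<and> (\<forall>u\<in>tuples n J. 0 \<le> \<nu> u \<and> \<nu> u \<le> 1) \<and> \<delta> \<le> mean n J \<nu> \<longrightarrow>
      (\<exists>\<Lambda>. captures n J k (\<beta> / 8) \<nu> \<Lambda>)"
    proof (rule exI[of _ "max k2 k3"], intro allI impI, elim conjE)
      fix n J and \<nu> :: "tup \<Rightarrow> real"
      assume J: "finite J" "card J = Suc d" and \<nu>: "\<forall>u\<in>tuples n J. 0 \<le> \<nu> u \<and> \<nu> u \<le> 1" and av: "\<delta> \<le> mean n J \<nu>"
      \<comment> \<open>The smallest coordinate is exposed first, so the conditions on all others
        may depend on its value.\<close>
      define i where "i = Min J"
      define J' where "J' = J - {i}"
      have "J \<noteq> {}" using J by auto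
      then have i: "i \<in> J" "\<And>j. j \<in> J \<Longrightarrow> i \<le> j" using J by (auto simp: i_def)
      have J': "J = insert i J'" "finite J'" "i \<notin> J'" "card J' = d" "\<And>j. j \<in> J' \<Longrightarrow> i < j"
        using i J by (auto simp: J'_def order.not_eq_order_implies_strict)
      define G where "G = vecs {..<n i}"
      have G: "finite G" "card G > 0" by (simp_all add: G_def card_vecs)
      define \<mu> where "\<mu> x = mean n J' (\<lambda>u. \<nu> (u(i := x)))" for x
      have \<nu>': "\<forall>u\<in>tuples n J'. 0 \<le> \<nu> (u(i := x)) \<and> \<nu> (u(i := x)) \<le> 1" if "x \<in> G" for x
        using \<nu> tuples_upd[of _ n J' x i] that J'(1) by (auto simp: G_def)
      have \<mu>: "0 \<le> \<mu> x \<and> \<mu> x \<le> 1" if "x \<in> G" for x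
      proof -
        have "\<mu> x \<le> mean n J' (\<lambda>_. 1)" unfolding \<mu>_def using \<nu>'[OF that] by (intro mean_mono) auto
        moreover have "0 \<le> \<mu> x" unfolding \<mu>_def using \<nu>'[OF that] by (intro mean_nonneg) auto
        ultimately show ?thesis using J' by (simp add: mean_const)
      qed
      have av\<mu>: "mean n J \<nu> = sum \<mu> G / card G"
        unfolding J'(1) \<mu>_def G_def using J' by (intro mean_insert) auto
      have sum\<mu>: "\<delta> * card G \<le> sum \<mu> G"
        using av G unfolding av\<mu> by (simp add: pos_le_divide_eq)
      \<comment> \<open>Thin slices get the empty tree. Every \<open>x\<close> needs some tree,
        since a representation of \<open>h\<close> may involve any vectors.\<close>
      have E1: "\<exists>\<Lambda>. ctree n J' k1 \<Lambda> \<and> (x \<in> G \<and> \<delta> / 8 \<le> \<mu> x \<longrightarrow> captures n J' k1 \<beta> (\<lambda>u. \<nu> (u(i := x))) \<Lambda>)" for x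
      proof (cases "x \<in> G \<and> \<delta> / 8 \<le> \<mu> x")
        case True
        then have "\<exists>\<Lambda>. captures n J' k1 \<beta> (\<lambda>u. \<nu> (u(i := x))) \<Lambda>"
          using \<nu>'[of x] by (intro k1[OF J'(2,4)]) (simp_all add: \<mu>_def)
        then show ?thesis unfolding captures_def by blast
      next
        case False
        then show ?thesis using ctree_mono[OF ctree_empty, of k1 n J'] by (intro exI[of _ "\<lambda>i u. {}"] conjI impI) simp_all
      qed
      obtain \<Lambda>1 where C1: "\<forall>x. ctree n J' k1 (\<Lambda>1 x) \<and>
          (x \<in> G \<and> \<delta> / 8 \<le> \<mu> x \<longrightarrow> captures n J' k1 \<beta> (\<lambda>u. \<nu> (u(i := x))) (\<Lambda>1 x))"
        by (rule choice[THEN exE, OF allI[OF E1]])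
      have \<Lambda>1: "\<And>x. ctree n J' k1 (\<Lambda>1 x)"
        "\<And>x r u. x \<in> G \<Longrightarrow> \<delta> / 8 \<le> \<mu> x \<Longrightarrow> mlform n J' r \<Longrightarrow>
         mean n J' (\<lambda>u. \<nu> (u(i := x)) * of_bool (r u = 1)) \<le> \<beta> * \<mu> x \<Longrightarrow> u \<in> tree_zeros n J' (\<Lambda>1 x) \<Longrightarrow> r u = 0"
        using C1 unfolding captures_def \<mu>_def by blast+
      have "\<exists>\<Lambda>. bogolyubov_set {..<n i} \<mu> m k2 c \<Lambda>"
        by (rule RB[rule_format]) (use \<mu> sum\<mu> in \<open>simp add: G_def\<close>)
      then obtain \<Lambda>0 where \<Lambda>0: "finite \<Lambda>0" "\<Lambda>0 \<subseteq> G" "card \<Lambda>0 \<le> k2"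
        and bog: "\<And>U h. U \<subseteq> G \<Longrightarrow> sum \<mu> (G - U) \<le> sum \<mu> G / 4 \<Longrightarrow> h \<in> G \<Longrightarrow> \<forall>y\<in>\<Lambda>0. dot {..<n i} h y = 0 \<Longrightarrow>
          {xs \<in> {..<m} \<rightarrow>\<^sub>E G. sum xs {..<m} = h} \<noteq> {} \<and>
          c * real (card {xs \<in> {..<m} \<rightarrow>\<^sub>E G. sum xs {..<m} = h})
            \<le> real (card {xs \<in> {..<m} \<rightarrow>\<^sub>E U. sum xs {..<m} = h})"
        unfolding bogolyubov_set_def G_def[symmetric] by (elim exE conjE) (rule that, assumption+, simp_all)
      define \<Omega> where "\<Omega> h = {xs \<in> {..<m} \<rightarrow>\<^sub>E G. sum xs {..<m} = h}" for h
      define \<Lambda>s where "\<Lambda>s xs = (\<lambda>i u. \<Union>l\<in>{..<m}. \<Lambda>1 (xs l) i u)" for xs :: "nat \<Rightarrow> nat \<Rightarrow> bit"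
      have \<Omega>: "finite (\<Omega> h)" for h
        unfolding \<Omega>_def using G by (intro finite_Collect_conjI disjI1) (simp add: finite_PiE)
      have \<Lambda>s: "\<forall>xs\<in>\<Omega> h. ctree n J' (m * k1) (\<Lambda>s xs)" for h
      proof
        fix xs assume "xs \<in> \<Omega> h"
        then have "ctree n J' (card {..<m} * k1) (\<Lambda>s xs)"
          unfolding \<Lambda>s_def by (intro ctree_UN \<Lambda>1) (auto simp: \<Omega>_def)
        then show "ctree n J' (m * k1) (\<Lambda>s xs)" by simp
      qed
      have E2: "\<exists>\<Lambda>. ctree n J' k3 \<Lambda> \<and> (h \<in> G \<and> (\<forall>y\<in>\<Lambda>0. dot {..<n i} h y = 0) \<longrightarrow> dominates n J' k3 c (\<Omega> h) \<Lambda>s \<Lambda>)" for h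
      proof (cases "h \<in> G \<and> (\<forall>y\<in>\<Lambda>0. dot {..<n i} h y = 0)")
        case True
        have "\<Omega> h \<noteq> {}" unfolding \<Omega>_def
          using bog[of G h] True \<mu> by (auto intro: sum_nonneg)
        then have "\<exists>\<Lambda>'. dominates n J' k3 c (\<Omega> h) \<Lambda>s \<Lambda>'"
          using J'(2,4) \<Omega> \<Lambda>s by (intro k3[rule_format]) simp
        then show ?thesis unfolding dominates_def by blast
      next
        case False
        then show ?thesis using ctree_mono[OF ctree_empty, of k3 n J'] by (intro exI[of _ "\<lambda>i u. {}"] conjI impI) simp_all
      qed
      obtain \<Lambda>2 where C2: "\<forall>h. ctree n J' k3 (\<Lambda>2 h) \<and>
          (h \<in> G \<and> (\<forall>y\<in>\<Lambda>0. dot {..<n i} h y = 0) \<longrightarrow> dominates n J' k3 c (\<Omega> h) \<Lambda>s (\<Lambda>2 h))"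
        by (rule choice[THEN exE, OF allI[OF E2]])
      have \<Lambda>2: "\<And>h. ctree n J' k3 (\<Lambda>2 h)"
        "\<And>h r u. h \<in> G \<Longrightarrow> \<forall>y\<in>\<Lambda>0. dot {..<n i} h y = 0 \<Longrightarrow> mlform n J' r \<Longrightarrow>
         c * card (\<Omega> h) \<le> card {\<omega>\<in>\<Omega> h. \<forall>u\<in>tree_zeros n J' (\<Lambda>s \<omega>). r u = 0} \<Longrightarrow> u \<in> tree_zeros n J' (\<Lambda>2 h) \<Longrightarrow> r u = 0"
        using C2 unfolding dominates_def by blast+
      \<comment> \<open>The entries of a tuple are arbitrary functions. Truncation makes
        \<open>u i\<close> a vector of the coordinate space and makes the tree depend only on its
        first \<open>n i\<close> values.\<close>
      define tr where "tr x = (\<lambda>j. if j < n i then x j else 0)" for x :: "nat \<Rightarrow> bit"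
      have tr: "tr x \<in> G" "dot {..<n i} (tr x) y = dot {..<n i} x y" for x y
        by (auto simp: tr_def G_def vecs_def dot_def)
      define \<Lambda> where "\<Lambda> j u = (if j = i then \<Lambda>0 else \<Lambda>2 (tr (u i)) j u)" for j and u :: tup
      have ctree: "ctree n J (max k2 k3) \<Lambda>"
        unfolding ctree_def
      proof (intro ballI allI)
        fix j u assume j: "j \<in> J"
        show "finite (\<Lambda> j u) \<and> \<Lambda> j u \<subseteq> vecs {..<n j} \<and> card (\<Lambda> j u) \<le> max k2 k3 \<and>
          (\<forall>v. agree n {l\<in>J. l < j} u v \<longrightarrow> \<Lambda> j u = \<Lambda> j v)"
        proof (cases "j = i")
          case True
          then show ?thesis using \<Lambda>0 by (auto simp: \<Lambda>_def G_def)
        next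
          case False
          then have j': "j \<in> J'" using j by (simp add: J'_def)
          have "\<Lambda> j u = \<Lambda> j v" if uv: "agree n {l\<in>J. l < j} u v" for v
          proof -
            have "tr (u i) = tr (v i)"
              using uv J'(1,5) j' by (auto simp: tr_def agree_def fun_eq_iff)
            moreover have "agree n {l\<in>J'. l < j} u v"
              using uv by (rule agree_mono) (auto simp: J'_def)
            ultimately show ?thesis using ctreeD(4)[OF \<Lambda>2(1) j'] False by (simp add: \<Lambda>_def)
          qed
          moreover have "\<Lambda> j u = \<Lambda>2 (tr (u i)) j u" using False by (simp add: \<Lambda>_def)
          ultimately show ?thesis using ctreeD(1-3)[OF \<Lambda>2(1) j', of "tr (u i)" u] by auto
        qed
      qed
      show "\<exists>\<Lambda>. captures n J (max k2 k3) (\<beta> / 8) \<nu> \<Lambda>"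
        unfolding captures_def
      proof (rule exI[of _ \<Lambda>], intro conjI ctree allI impI ballI, elim conjE)
        fix r u
        assume r: "mlform n J r" and small: "mean n J (\<lambda>u. \<nu> u * of_bool (r u = 1)) \<le> \<beta> / 8 * mean n J \<nu>"
          and u: "u \<in> tree_zeros n J \<Lambda>"
        define h where "h = tr (u i)"
        have h: "h \<in> G" by (simp add: h_def tr)
        have h0: "\<forall>y\<in>\<Lambda>0. dot {..<n i} h y = 0"
          using u i(1) by (auto simp: tree_zeros_def \<Lambda>_def h_def tr)
        have u': "u \<in> tree_zeros n J' (\<Lambda>2 h)"
          unfolding tree_zeros_def
        proof (intro CollectI ballI)
          fix j y assume j: "j \<in> J'" and y: "y \<in> \<Lambda>2 h j u"
          then have "j \<noteq> i" "j \<in> J" using J'(1,3) by auto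
          moreover from this have "y \<in> \<Lambda> j u" using y by (simp add: \<Lambda>_def h_def)
          ultimately show "dot {..<n j} (u j) y = 0" using u by (simp add: tree_zeros_def)
        qed
        have ru: "r u = r (u(i := h))"
          by (rule mlform_agree[OF r]) (auto simp: agree_def h_def tr_def)
        have rx: "mlform n J' (\<lambda>u. r (u(i := x)))" for x
          unfolding J'_def by (rule mlform_fix[OF r])
        define U where "U = {x\<in>G. \<delta> / 8 \<le> \<mu> x \<and> (\<forall>u\<in>tree_zeros n J' (\<Lambda>1 x). r (u(i := x)) = 0)}"
        define a where "a x = mean n J' (\<lambda>u. \<nu> (u(i := x)) * of_bool (r (u(i := x)) = 1))" for x
        \<comment> \<open>Outside \<open>U\<close> a slice is thin, or else it is not covered by the
          captured level and \<open>a x > \<beta> * \<mu> x\<close>.\<close>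
        have "sum \<mu> (G - U) \<le> (\<Sum>x\<in>G - U. \<delta> / 8 + a x / \<beta>)"
        proof (rule sum_mono)
          fix x assume x: "x \<in> G - U"
          have a0: "0 \<le> a x" unfolding a_def using \<nu>'[of x] x by (intro mean_nonneg) auto
          show "\<mu> x \<le> \<delta> / 8 + a x / \<beta>"
          proof (cases "\<delta> / 8 \<le> \<mu> x")
            case True
            have "\<not> a x \<le> \<beta> * \<mu> x"
            proof
              assume ax: "a x \<le> \<beta> * \<mu> x"
              have xG: "x \<in> G" using x by simp
              have "\<forall>u\<in>tree_zeros n J' (\<Lambda>1 x). r (u(i := x)) = 0"
              proof
                fix v assume "v \<in> tree_zeros n J' (\<Lambda>1 x)"
                then show "r (v(i := x)) = 0"
                  by (rule \<Lambda>1(2)[OF xG True rx ax[unfolded a_def]])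
              qed
              then show False using x True by (simp add: U_def)
            qed
            then have "\<mu> x \<le> a x / \<beta>" using \<beta> by (simp add: field_simps)
            then show ?thesis using \<delta> by simp
          next
            case False
            moreover have "0 \<le> a x / \<beta>" using a0 \<beta> by simp
            ultimately show ?thesis by linarith
          qed
        qed
        also have "\<dots> \<le> (\<Sum>x\<in>G. \<delta> / 8 + a x / \<beta>)"
          using G \<delta> \<beta> \<nu>' by (intro sum_mono2 add_nonneg_nonneg divide_nonneg_nonneg)
            (auto simp: a_def intro!: mean_nonneg)
        also have "\<dots> = \<delta> * card G / 8 + sum a G / \<beta>"
          by (simp add: sum.distrib sum_divide_distrib)
        also have "sum a G = card G * mean n J (\<lambda>u. \<nu> u * of_bool (r u = 1))"
          unfolding a_def J'(1) G_def using J' G by (subst mean_insert) (auto simp: G_def)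
        also have "\<delta> * card G / 8 + card G * mean n J (\<lambda>u. \<nu> u * of_bool (r u = 1)) / \<beta> \<le>
          sum \<mu> G / 8 + card G * (\<beta> / 8 * mean n J \<nu>) / \<beta>"
          using sum\<mu> small \<beta> by (intro add_mono divide_right_mono mult_left_mono) auto
        also have "\<dots> = sum \<mu> G / 4" using \<beta> G by (simp add: av\<mu> field_simps)
        finally have UG: "sum \<mu> (G - U) \<le> sum \<mu> G / 4" .
        have "c * card (\<Omega> h) \<le> card {xs \<in> {..<m} \<rightarrow>\<^sub>E U. sum xs {..<m} = h}"
          unfolding \<Omega>_def using bog[of U h] UG h h0 by (auto simp: U_def)
        also have "\<dots> \<le> card {\<omega>\<in>\<Omega> h. \<forall>u\<in>tree_zeros n J' (\<Lambda>s \<omega>). r (u(i := h)) = 0}"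
        proof -
          have "{xs \<in> {..<m} \<rightarrow>\<^sub>E U. sum xs {..<m} = h} \<subseteq> {\<omega>\<in>\<Omega> h. \<forall>u\<in>tree_zeros n J' (\<Lambda>s \<omega>). r (u(i := h)) = 0}"
          proof safe
            fix xs assume xs: "xs \<in> {..<m} \<rightarrow>\<^sub>E U" "h = sum xs {..<m}"
            then show "xs \<in> \<Omega> (sum xs {..<m})" by (auto simp: \<Omega>_def U_def PiE_iff)
            fix v assume v: "v \<in> tree_zeros n J' (\<Lambda>s xs)"
            have "r (v(i := sum xs {..<m})) = (\<Sum>l<m. r (v(i := xs l)))"
              using mlform_upd_sum(2)[OF r i(1)] by simp
            also have "\<dots> = 0"
            proof (rule sum.neutral, rule ballI)
              fix l assume l: "l \<in> {..<m}"
              have "v \<in> tree_zeros n J' (\<Lambda>1 (xs l))" using v l by (auto simp: tree_zeros_def \<Lambda>s_def)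
              moreover have "xs l \<in> U" using xs l by auto
              ultimately show "r (v(i := xs l)) = 0" by (simp add: U_def)
            qed
            finally show "r (v(i := sum xs {..<m})) = 0" .
          qed
          then show ?thesis using \<Omega>[of h] by (intro of_nat_mono card_mono) auto
        qed
        finally show "r u = 0" unfolding ru by (intro \<Lambda>2(2)[OF h h0 rx _ u'])
      qed
    qed
  qed (use \<beta> in simp)
qed

lemma tree_for_dense: "tree_for_dense d"
  by (induction d) (auto intro: tree_for_dense_0 tree_for_dense_Suc)

subsection \<open>Bounded partition rank\<close>

text \<open>Partition rank with one factor of each product taken from the fixed family
  \<open>V\<close> and the other one free; for \<open>I = J\<close> the free factor is a
  constant.\<close>

definition structured :: "(nat \<Rightarrow> nat) \<Rightarrow> nat set \<Rightarrow> (nat set \<Rightarrow> (tup \<Rightarrow> bit) set) \<Rightarrow> (tup \<Rightarrow> bit) set"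
  where "structured n J V = {r. \<exists>g. (\<forall>I f. mlform n (J - I) (g I f)) \<and>
    r = (\<lambda>u. \<Sum>I\<in>Pow J - {{}}. \<Sum>f\<in>V I. f u * g I f u)}"

definition bounded_forms :: "(nat \<Rightarrow> nat) \<Rightarrow> nat \<Rightarrow> (nat set \<Rightarrow> (tup \<Rightarrow> bit) set) \<Rightarrow> bool"
  where "bounded_forms n K V \<longleftrightarrow> (\<forall>I. finite (V I) \<and> card (V I) \<le> K \<and> (\<forall>f\<in>V I. mlform n I f))"

text \<open>Forms carry their index set along, because the function does not determine it: the zero
  function is a form on every index set.\<close>

definition fam_prod :: "(nat set \<times> (tup \<Rightarrow> bit)) set \<Rightarrow> tup \<Rightarrow> bit"
  where "fam_prod B = (\<lambda>u. \<Prod>p\<in>B. snd p u)"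

definition partitions :: "(nat set \<times> (tup \<Rightarrow> bit)) set \<Rightarrow> nat set \<Rightarrow> bool"
  where "partitions B S \<longleftrightarrow> (\<Union>p\<in>B. fst p) = S \<and> (\<forall>p\<in>B. \<forall>q\<in>B. p \<noteq> q \<longrightarrow> fst p \<inter> fst q = {})"

definition prod_span :: "nat set \<Rightarrow> (nat set \<times> (tup \<Rightarrow> bit)) set \<Rightarrow> (tup \<Rightarrow> bit) set"
  where "prod_span S A = fun_vs.span {fam_prod B |B. B \<subseteq> A \<and> partitions B S}"

definition form_family :: "(nat \<Rightarrow> nat) \<Rightarrow> (nat set \<times> (tup \<Rightarrow> bit)) set \<Rightarrow> bool"
  where "form_family n A \<longleftrightarrow> finite A \<and> (\<forall>p\<in>A. fst p \<noteq> {} \<and> finite (fst p) \<and> mlform n (fst p) (snd p))"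

text \<open>All factors live on proper subsets of \<open>S\<close>, so such a form can be traded for
  boundedly many forms of smaller degree.\<close>

definition low_rank :: "(nat \<Rightarrow> nat) \<Rightarrow> nat \<Rightarrow> nat set \<Rightarrow> (tup \<Rightarrow> bit) \<Rightarrow> bool"
  where "low_rank n K S \<rho> \<longleftrightarrow> (\<exists>A. form_family n A \<and> card A \<le> K \<and> (\<forall>p\<in>A. fst p \<subset> S) \<and> \<rho> \<in> prod_span S A)"

lemma structured_0: "(\<lambda>u. 0) \<in> structured n J V"
  unfolding structured_def by (intro CollectI exI[of _ "\<lambda>I f u. 0"]) (simp add: mlform_0)

lemma structured_add:
  assumes "r \<in> structured n J V" "s \<in> structured n J V"
  shows "(\<lambda>u. r u + s u) \<in> structured n J V"
proof -
  obtain g h where "\<forall>I f. mlform n (J - I) (g I f)" "r = (\<lambda>u. \<Sum>I\<in>Pow J - {{}}. \<Sum>f\<in>V I. f u * g I f u)"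
    "\<forall>I f. mlform n (J - I) (h I f)" "s = (\<lambda>u. \<Sum>I\<in>Pow J - {{}}. \<Sum>f\<in>V I. f u * h I f u)"
    using assms unfolding structured_def by blast
  then show ?thesis unfolding structured_def
    by (intro CollectI exI[of _ "\<lambda>I f u. g I f u + h I f u"])
      (auto simp: algebra_simps sum.distrib intro: mlform_add)
qed

lemma structured_sum: "(\<And>a. a \<in> A \<Longrightarrow> r a \<in> structured n J V) \<Longrightarrow> (\<lambda>u. \<Sum>a\<in>A. r a u) \<in> structured n J V"
  by (induction A rule: infinite_finite_induct) (auto intro: structured_0 structured_add)

lemma structured_mono:
  assumes "\<And>I. V I \<subseteq> V' I" "\<And>I. finite (V' I)"
  shows "structured n J V \<subseteq> structured n J V'"
proof
  fix r assume "r \<in> structured n J V"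
  then obtain g where g: "\<forall>I f. mlform n (J - I) (g I f)" "r = (\<lambda>u. \<Sum>I\<in>Pow J - {{}}. \<Sum>f\<in>V I. f u * g I f u)"
    unfolding structured_def by blast
  define g' where "g' I f = (if f \<in> V I then g I f else (\<lambda>u. 0))" for I f
  have "(\<Sum>f\<in>V I. f u * g I f u) = (\<Sum>f\<in>V' I. f u * g' I f u)" for I u
    using assms[of I] by (intro sum.mono_neutral_cong_left) (auto simp: g'_def)
  then have "r = (\<lambda>u. \<Sum>I\<in>Pow J - {{}}. \<Sum>f\<in>V' I. f u * g' I f u)" using g(2) by simp
  moreover have "\<forall>I f. mlform n (J - I) (g' I f)" using g(1) by (auto simp: g'_def mlform_0)
  ultimately show "r \<in> structured n J V'" unfolding structured_def by blast
qed

lemma structured_gen: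
  assumes "finite J" "I \<subseteq> J" "I \<noteq> {}" "f \<in> V I" "finite (V I)" "mlform n (J - I) h"
  shows "(\<lambda>u. f u * h u) \<in> structured n J V"
proof -
  define g where "g I' f' = (if I' = I \<and> f' = f then h else (\<lambda>u. 0))" for I' f'
  have "(\<Sum>I'\<in>Pow J - {{}}. \<Sum>f'\<in>V I'. f' u * g I' f' u) = f u * h u" for u
  proof -
    have "(\<Sum>I'\<in>Pow J - {{}}. \<Sum>f'\<in>V I'. f' u * g I' f' u) = (\<Sum>I'\<in>Pow J - {{}}. if I' = I then f u * h u else 0)"
    proof (rule sum.cong[OF refl])
      fix I'
      have "(\<Sum>f'\<in>V I. f' u * g I f' u) = (\<Sum>f'\<in>V I. if f' = f then f u * h u else 0)"
        by (rule sum.cong) (auto simp: g_def)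
      then have "(\<Sum>f'\<in>V I. f' u * g I f' u) = f u * h u" using assms by (simp add: sum.delta)
      moreover have "(\<Sum>f'\<in>V I'. f' u * g I' f' u) = 0" if "I' \<noteq> I" using that by (simp add: g_def)
      ultimately show "(\<Sum>f'\<in>V I'. f' u * g I' f' u) = (if I' = I then f u * h u else 0)" by auto
    qed
    then show ?thesis using assms by (simp add: sum.delta)
  qed
  moreover have "\<forall>I' f'. mlform n (J - I') (g I' f')" using assms by (auto simp: g_def mlform_0)
  ultimately show ?thesis unfolding structured_def by (intro CollectI exI[of _ g]) auto
qed

lemma structured_vanish:
  assumes "w \<in> structured n J V" "\<And>I f. I \<subseteq> J \<Longrightarrow> I \<noteq> {} \<Longrightarrow> f \<in> V I \<Longrightarrow> f u = 0"
  shows "w u = 0"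
proof -
  obtain g where "w = (\<lambda>u. \<Sum>I\<in>Pow J - {{}}. \<Sum>f\<in>V I. f u * g I f u)"
    using assms(1) unfolding structured_def by blast
  then have "w u = (\<Sum>I\<in>Pow J - {{}}. \<Sum>f\<in>V I. f u * g I f u)" by simp
  also have "\<dots> = (\<Sum>I\<in>Pow J - {{}}. \<Sum>f\<in>V I. 0)"
  proof (intro sum.cong refl)
    fix I f assume "I \<in> Pow J - {{}}" "f \<in> V I"
    then have "f u = 0" by (intro assms(2)[of I]) auto
    then show "f u * g I f u = 0" by simp
  qed
  finally show ?thesis by simp
qed

section \<open>Low rank from gradients that often vanish\<close>

lemma low_rank_0: "low_rank n K S (\<lambda>u. 0)"
proof -
  have "(0 :: tup \<Rightarrow> bit) \<in> prod_span S {}" unfolding prod_span_def by (rule fun_vs.span_zero)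
  then have "(\<lambda>u. 0) \<in> prod_span S {}" by (simp add: zero_fun_def)
  then show ?thesis unfolding low_rank_def form_family_def by (intro exI[of _ "{}"]) simp
qed

lemma low_rank_mono: "low_rank n K S \<rho> \<Longrightarrow> K \<le> K' \<Longrightarrow> low_rank n K' S \<rho>"
  unfolding low_rank_def by (meson order_trans)

text \<open>\<open>V\<close> comes before \<open>r\<close>: \<open>bias_low_rank\<close> applies one
  family to all entries of a gradient, whose number is unbounded.\<close>

definition zeros_structured :: "nat \<Rightarrow> bool"
  where "zeros_structured d \<longleftrightarrow> (\<forall>k. \<exists>K. \<forall>n J \<Lambda>. finite J \<and> card J = d \<and> ctree n J k \<Lambda> \<longrightarrow>
    (\<exists>V. bounded_forms n K V \<and> (\<forall>r. mlform n J r \<and> (\<forall>u\<in>tree_zeros n J \<Lambda>. r u = 0) \<longrightarrow> r \<in> structured n J V)))"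

text \<open>The entries of the gradient are forms on the other \<open>d\<close> coordinates that
  vanish together on a dense set, so a single family \<open>V\<close> structures all of them.
  Collecting the terms with the same member of \<open>V\<close> moves the last coordinate into the
  cofactor and leaves boundedly many products.\<close>

lemma bias_low_rank:
  fixes c :: real
  assumes FT: "zeros_structured d" and c: "c > 0"
  shows "\<exists>K. \<forall>n S \<rho>. finite S \<and> card S = Suc d \<and> mlform n S \<rho> \<and>
    c \<le> prob n (S - {Max S}) (\<lambda>u. partial n (Max S) \<rho> u = 0) \<longrightarrow> low_rank n K S \<rho>"
proof -
  obtain \<beta> where \<beta>: "\<beta> > 0" and T': "\<And>\<delta>. \<delta> > 0 \<Longrightarrow> \<exists>k. \<forall>n J \<nu>. finite J \<and> card J = d \<and>
    (\<forall>u\<in>tuples n J. 0 \<le> \<nu> u \<and> \<nu> u \<le> 1) \<and> \<delta> \<le> mean n J \<nu> \<longrightarrow> (\<exists>\<Lambda>. captures n J k \<beta> \<nu> \<Lambda>)"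
    using tree_for_dense[of d] unfolding tree_for_dense_def by blast
  obtain k where k: "\<And>n J \<nu>. finite J \<Longrightarrow> card J = d \<Longrightarrow>
    (\<forall>u\<in>tuples n J. 0 \<le> \<nu> u \<and> \<nu> u \<le> 1) \<Longrightarrow> c \<le> mean n J \<nu> \<Longrightarrow> (\<exists>\<Lambda>. captures n J k \<beta> \<nu> \<Lambda>)"
    using T'[OF c] by blast
  obtain K where K: "\<And>n J \<Lambda>. finite J \<Longrightarrow> card J = d \<Longrightarrow> ctree n J k \<Lambda> \<Longrightarrow>
    (\<exists>V. bounded_forms n K V \<and> (\<forall>r. mlform n J r \<and> (\<forall>u\<in>tree_zeros n J \<Lambda>. r u = 0) \<longrightarrow> r \<in> structured n J V))"
    using FT unfolding zeros_structured_def by meson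
  show ?thesis
  \<comment> \<open>Both factors of at most \<open>2 ^ d * K\<close> products are listed.\<close>
  proof (rule exI[of _ "2 ^ d * K + 2 ^ d * K"], intro allI impI, elim conjE)
    fix n S \<rho>
    assume S: "finite S" "card S = Suc d" and \<rho>: "mlform n S \<rho>"
      and big: "c \<le> prob n (S - {Max S}) (\<lambda>u. partial n (Max S) \<rho> u = 0)"
    define i where "i = Max S"
    define S' where "S' = S - {i}"
    have "S \<noteq> {}" using S by auto
    then have i: "i \<in> S" using S by (simp add: i_def)
    have S': "finite S'" "card S' = d" using S i by (simp_all add: S'_def)
    let ?\<nu> = "\<lambda>u. of_bool (partial n i \<rho> u = 0) :: real"
    have "\<exists>\<Lambda>. captures n S' k \<beta> ?\<nu> \<Lambda>"
      by (rule k[OF S']) (use big in \<open>simp_all add: i_def S'_def\<close>)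
    then obtain \<Lambda> where \<Lambda>: "captures n S' k \<beta> ?\<nu> \<Lambda>" by blast
    then have "ctree n S' k \<Lambda>" by (simp add: captures_def)
    then obtain V where V: "bounded_forms n K V" "\<forall>r. mlform n S' r \<and> (\<forall>u\<in>tree_zeros n S' \<Lambda>. r u = 0) \<longrightarrow> r \<in> structured n S' V"
      using K[OF S'] by meson
    have "(\<lambda>u. \<rho> (u(i := unit_vec j))) \<in> structured n S' V" if j: "j < n i" for j
    proof -
      have m: "mlform n S' (\<lambda>u. \<rho> (u(i := unit_vec j)))" unfolding S'_def by (rule mlform_fix[OF \<rho>])
      have "\<rho> (u(i := unit_vec j)) = 0" if "partial n i \<rho> u = 0" for u
        using j fun_cong[OF that, of j] by (simp add: partial_def)
      then have "mean n S' (\<lambda>u. ?\<nu> u * of_bool (\<rho> (u(i := unit_vec j)) = 1)) = mean n S' (\<lambda>u. 0)"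
        by (intro mean_cong) auto
      also have "\<dots> \<le> \<beta> * mean n S' ?\<nu>"
        using S' \<beta> by (simp add: mean_const mean_nonneg)
      finally show ?thesis using V(2) \<Lambda> m unfolding captures_def by blast
    qed
    then have "\<forall>j. \<exists>g. j < n i \<longrightarrow> (\<forall>I f. mlform n (S' - I) (g I f)) \<and>
      (\<lambda>u. \<rho> (u(i := unit_vec j))) = (\<lambda>u. \<Sum>I\<in>Pow S' - {{}}. \<Sum>f\<in>V I. f u * g I f u)"
      unfolding structured_def by blast
    then obtain g where "\<forall>j. j < n i \<longrightarrow> (\<forall>I f. mlform n (S' - I) (g j I f)) \<and>
      (\<lambda>u. \<rho> (u(i := unit_vec j))) = (\<lambda>u. \<Sum>I\<in>Pow S' - {{}}. \<Sum>f\<in>V I. f u * g j I f u)"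
    by (rule choice[THEN exE])
    then have g: "\<And>j I f. j < n i \<Longrightarrow> mlform n (S' - I) (g j I f)"
      "\<And>j. j < n i \<Longrightarrow> (\<lambda>u. \<rho> (u(i := unit_vec j))) = (\<lambda>u. \<Sum>I\<in>Pow S' - {{}}. \<Sum>f\<in>V I. f u * g j I f u)"
      by blast+
    define G where "G I f u = (\<Sum>j<n i. u i j * g j I f u)" for I f and u :: tup
    have G: "mlform n (S - I) (G I f)" if "I \<subseteq> S'" for I f
      unfolding G_def
    proof (rule mlform_sum)
      fix j assume j: "j \<in> {..<n i}"
      have "mlform n {i} (\<lambda>u. u i j)" using j by (auto simp: mlform_def agree_def)
      then have "mlform n ({i} \<union> (S' - I)) (\<lambda>u. u i j * g j I f u)"
        using g(1)[of j I f] j by (intro mlform_mult) (auto simp: S'_def)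
      moreover have "{i} \<union> (S' - I) = S - I" using that i by (auto simp: S'_def)
      ultimately show "mlform n (S - I) (\<lambda>u. u i j * g j I f u)" by simp
    qed
    have \<rho>_eq: "\<rho> u = (\<Sum>I\<in>Pow S' - {{}}. \<Sum>f\<in>V I. f u * G I f u)" for u
    proof -
      have "\<rho> u = (\<Sum>j<n i. u i j * \<rho> (u(i := unit_vec j)))"
        using mlform_dot_partial[OF \<rho> i, of u] by (simp add: dot_def partial_def)
      also have "\<dots> = (\<Sum>j<n i. \<Sum>I\<in>Pow S' - {{}}. \<Sum>f\<in>V I. f u * (u i j * g j I f u))"
      proof (rule sum.cong[OF refl])
        fix j assume "j \<in> {..<n i}"
        then have "\<rho> (u(i := unit_vec j)) = (\<Sum>I\<in>Pow S' - {{}}. \<Sum>f\<in>V I. f u * g j I f u)"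
          using fun_cong[OF g(2)[of j], of u] by simp
        then show "u i j * \<rho> (u(i := unit_vec j)) = (\<Sum>I\<in>Pow S' - {{}}. \<Sum>f\<in>V I. f u * (u i j * g j I f u))"
          by (simp add: sum_distrib_left mult.left_commute)
      qed
      also have "\<dots> = (\<Sum>I\<in>Pow S' - {{}}. \<Sum>f\<in>V I. \<Sum>j<n i. f u * (u i j * g j I f u))"
        by (subst sum.swap, rule sum.cong[OF refl], rule sum.swap)
      finally show ?thesis by (simp add: G_def sum_distrib_left)
    qed
    have fV: "finite (V I)" "card (V I) \<le> K" "\<And>f. f \<in> V I \<Longrightarrow> mlform n I f" for I using V(1) by (auto simp: bounded_forms_def)
    define Z where "Z = (SIGMA I : Pow S' - {{}}. V I)"
    have Z: "finite Z" "card Z \<le> 2 ^ d * K"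
    proof -
      show "finite Z" unfolding Z_def using S' fV by (intro finite_SigmaI) auto
      have "card Z = (\<Sum>I\<in>Pow S' - {{}}. card (V I))"
        unfolding Z_def using S' fV by (intro card_SigmaI) auto
      also have "\<dots> \<le> card (Pow S' - {{}}) * K" using fV by (intro sum_bounded_above[THEN order_trans]) auto
      also have "\<dots> \<le> 2 ^ d * K"
        using S' by (intro mult_right_mono) (auto simp: card_Diff_singleton card_Pow)
      finally show "card Z \<le> 2 ^ d * K" .
    qed
    define A where "A = Z \<union> (\<lambda>(I, f). (S - I, G I f)) ` Z"
    have "card A \<le> 2 ^ d * K + 2 ^ d * K"
      unfolding A_def using Z card_image_le[OF Z(1), of "\<lambda>(I, f). (S - I, G I f)"]
      by (intro card_Un_le[THEN order_trans] add_mono) auto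
    moreover have "form_family n A"
      unfolding form_family_def
    proof (intro conjI ballI)
      show "finite A" using Z(1) by (simp add: A_def)
      fix p assume "p \<in> A"
      then obtain I f where If: "I \<subseteq> S'" "I \<noteq> {}" "f \<in> V I" "p = (I, f) \<or> p = (S - I, G I f)"
        unfolding A_def Z_def by auto
      then have "finite I" "i \<in> S - I" using finite_subset[OF _ S'(1)] i by (auto simp: S'_def)
      then show "fst p \<noteq> {}" "finite (fst p)" "mlform n (fst p) (snd p)" using If S(1) fV(3) G[of I f] by auto
    qed
    moreover have "\<forall>p\<in>A. fst p \<subset> S"
    proof
      fix p assume "p \<in> A"
      then obtain I f where If: "I \<subseteq> S'" "I \<noteq> {}" "f \<in> V I" "p = (I, f) \<or> p = (S - I, G I f)"
        unfolding A_def Z_def by auto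
      have "I \<subset> S" "S - I \<subset> S" using If(1,2) i unfolding S'_def by blast+
      then show "fst p \<subset> S" using If(4) by (elim disjE) simp_all
    qed
    moreover have "\<rho> \<in> prod_span S A"
    proof -
      have b: "fam_prod {(I, f), (S - I, G I f)} \<in> prod_span S A" if "(I, f) \<in> Z" for I f
      proof -
        have "partitions {(I, f), (S - I, G I f)} S" using that by (auto simp: partitions_def Z_def S'_def)
        moreover have "{(I, f), (S - I, G I f)} \<subseteq> A" using that by (auto simp: A_def intro!: image_eqI)
        ultimately show ?thesis unfolding prod_span_def by (intro fun_vs.span_base) blast
      qed
      have e: "fam_prod {(I, f), (S - I, G I f)} u = f u * G I f u" if "(I, f) \<in> Z" for I f u
      proof -
        have "(I, f) \<noteq> (S - I, G I f)" using that by (auto simp: Z_def)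
        then show ?thesis by (simp add: fam_prod_def)
      qed
      have "\<rho> = (\<Sum>p\<in>Z. fam_prod {(fst p, snd p), (S - fst p, G (fst p) (snd p))})"
      proof
        fix u
        have "\<rho> u = (\<Sum>(I, f)\<in>Z. f u * G I f u)"
          unfolding \<rho>_eq Z_def using S' fV by (subst sum.Sigma) auto
        also have "\<dots> = (\<Sum>p\<in>Z. fam_prod {(fst p, snd p), (S - fst p, G (fst p) (snd p))} u)"
          by (rule sum.cong) (auto simp: e)
        finally show "\<rho> u = (\<Sum>p\<in>Z. fam_prod {(fst p, snd p), (S - fst p, G (fst p) (snd p))}) u"
          by (simp add: sum_fun_apply)
      qed
      also have "\<dots> \<in> prod_span S A"
        unfolding prod_span_def by (intro fun_vs.span_sum) (use b in \<open>auto simp: prod_span_def\<close>)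
      finally show ?thesis .
    qed
    ultimately show "low_rank n (2 ^ d * K + 2 ^ d * K) S \<rho>" unfolding low_rank_def by blast
  qed
qed

lemma bias_low_rank_le:
  fixes c :: real
  assumes FT: "\<And>d'. d' < d \<Longrightarrow> zeros_structured d'" and c: "c > 0"
  shows "\<exists>K. \<forall>n S \<rho>. finite S \<and> S \<noteq> {} \<and> card S \<le> d \<and> mlform n S \<rho> \<and>
    c \<le> prob n (S - {Max S}) (\<lambda>u. partial n (Max S) \<rho> u = 0) \<longrightarrow> low_rank n K S \<rho>"
proof -
  have "\<forall>d'. \<exists>K. d' < d \<longrightarrow> (\<forall>n S \<rho>. finite S \<and> card S = Suc d' \<and> mlform n S \<rho> \<and>
    c \<le> prob n (S - {Max S}) (\<lambda>u. partial n (Max S) \<rho> u = 0) \<longrightarrow> low_rank n K S \<rho>)"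
    using bias_low_rank[OF FT c] by blast
  then obtain K where K: "\<forall>d'. d' < d \<longrightarrow> (\<forall>n S \<rho>. finite S \<and> card S = Suc d' \<and> mlform n S \<rho> \<and>
    c \<le> prob n (S - {Max S}) (\<lambda>u. partial n (Max S) \<rho> u = 0) \<longrightarrow> low_rank n (K d') S \<rho>)"
    by (rule choice[THEN exE])
  show ?thesis
  proof (rule exI[of _ "\<Sum>d'<d. K d'"], intro allI impI, elim conjE)
    fix n S \<rho>
    assume S: "finite S" "S \<noteq> {}" "card S \<le> d" and \<rho>: "mlform n S \<rho>"
      and big: "c \<le> prob n (S - {Max S}) (\<lambda>u. partial n (Max S) \<rho> u = 0)"
    obtain d' where d': "card S = Suc d'" using S by (cases "card S") auto
    then have d'd: "d' < d" using S by simp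
    have "low_rank n (K d') S \<rho>" using K[rule_format, OF d'd] S(1) d' \<rho> big by blast
    then show "low_rank n (\<Sum>d'<d. K d') S \<rho>"
      by (rule low_rank_mono) (use d'd in \<open>auto intro: member_le_sum\<close>)
  qed
qed

text \<open>Translating by a fixed zero of the sum removes the summands that do not depend on coordinate \<open>i'\<close>.\<close>

lemma prob_partial_sum_step:
  fixes S :: "'t \<Rightarrow> nat set"
  assumes K: "finite K" "i' \<in> K" "i' \<noteq> i" and T: "finite T" "\<And>\<tau>. \<tau> \<in> T \<Longrightarrow> mlform n (S \<tau>) (f \<tau>)"
  shows "prob n K (\<lambda>u. (\<Sum>\<tau>\<in>T. partial n i (f \<tau>) u) = 0)
    \<le> prob n K (\<lambda>u. (\<Sum>\<tau>\<in>{\<tau>\<in>T. i' \<in> S \<tau>}. partial n i (f \<tau>) u) = 0)"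
proof -
  define h where "h u = (\<Sum>\<tau>\<in>T. partial n i (f \<tau>) u)" for u
  define h' where "h' u = (\<Sum>\<tau>\<in>{\<tau>\<in>T. i' \<in> S \<tau>}. partial n i (f \<tau>) u)" for u
  define K0 where "K0 = K - {i'}"
  have K0: "finite K0" "i' \<notin> K0" "insert i' K0 = K" using K by (auto simp: K0_def)
  let ?G = "vecs {..<n i'}"
  have hh: "h (u(i' := x)) + h (u(i' := y)) = h' (u(i' := x + y))" for u x y
  proof -
    have "h (u(i' := x)) + h (u(i' := y)) = (\<Sum>\<tau>\<in>T. if i' \<in> S \<tau> then partial n i (f \<tau>) (u(i' := x + y)) else 0)"
      unfolding h_def sum.distrib[symmetric]
    proof (rule sum.cong[OF refl])
      fix \<tau> assume \<tau>: "\<tau> \<in> T"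
      show "partial n i (f \<tau>) (u(i' := x)) + partial n i (f \<tau>) (u(i' := y)) =
        (if i' \<in> S \<tau> then partial n i (f \<tau>) (u(i' := x + y)) else 0)"
      proof (cases "i' \<in> S \<tau>")
        case True
        then show ?thesis using partial_upd_add[OF T(2)[OF \<tau>] True K(3)] by simp
      next
        case False
        then have "partial n i (f \<tau>) (u(i' := x)) = partial n i (f \<tau>) (u(i' := y))"
          by (intro partial_agree[OF T(2)[OF \<tau>]]) (auto simp: agree_def)
        then show ?thesis using False by simp
      qed
    qed
    also have "\<dots> = h' (u(i' := x + y))" unfolding h'_def
      using T(1) by (simp only: sum.inter_filter)
    finally show ?thesis .
  qed
  have "mean n K0 (\<lambda>u. (\<Sum>x\<in>?G. of_bool (h (u(i' := x)) = 0)) / card ?G)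
     \<le> mean n K0 (\<lambda>u. (\<Sum>x\<in>?G. of_bool (h' (u(i' := x)) = 0)) / card ?G)"
  proof (intro mean_mono divide_right_mono)
    fix u
    have cnt: "(\<Sum>x\<in>?G. of_bool (Q x)) = real (card {x\<in>?G. Q x})" for Q
      using card_vecs(1)[of "{..<n i'}"] by (simp add: of_bool_def sum.If_cases Int_def)
    have "card {x\<in>?G. h (u(i' := x)) = 0} \<le> card {x\<in>?G. h' (u(i' := x)) = 0}"
    proof (cases "{x\<in>?G. h (u(i' := x)) = 0} = {}")
      case False
      then obtain x0 where x0: "x0 \<in> ?G" "h (u(i' := x0)) = 0" by blast
      show ?thesis
      proof (rule card_inj_on_le[where f = "\<lambda>x. x + x0"])
        show "(\<lambda>x. x + x0) ` {x\<in>?G. h (u(i' := x)) = 0} \<subseteq> {x\<in>?G. h' (u(i' := x)) = 0}"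
          using x0 hh[of u _ x0] by (auto simp: sp_add simp flip: hh)
      qed (use card_vecs(1)[of "{..<n i'}"] in \<open>auto simp: inj_on_def\<close>)
    qed (simp only: card.empty)
    then show "(\<Sum>x\<in>?G. of_bool (h (u(i' := x)) = 0)) \<le> (\<Sum>x\<in>?G. of_bool (h' (u(i' := x)) = 0) :: real)"
      by (simp only: cnt of_nat_le_iff)
  qed simp
  then have "prob n (insert i' K0) (\<lambda>u. h u = 0) \<le> prob n (insert i' K0) (\<lambda>u. h' u = 0)"
    unfolding mean_insert'[OF K0(1,2)] .
  then show ?thesis by (simp only: K0(3) h_def h'_def)
qed

text \<open>Used with \<open>Z\<close> the coordinates of an index set other than its last one: only
  forms on supersets survive, so unwanted summands on incomparable index sets disappear.\<close>

lemma prob_partial_sum: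
  fixes S :: "'t \<Rightarrow> nat set"
  assumes K: "finite K" and Z: "finite Z" "Z \<subseteq> K - {i}"
    and T: "finite T" "\<And>\<tau>. \<tau> \<in> T \<Longrightarrow> mlform n (S \<tau>) (f \<tau>)"
  shows "prob n K (\<lambda>u. (\<Sum>\<tau>\<in>T. partial n i (f \<tau>) u) = 0)
    \<le> prob n K (\<lambda>u. (\<Sum>\<tau>\<in>{\<tau>\<in>T. Z \<subseteq> S \<tau>}. partial n i (f \<tau>) u) = 0)"
  using Z
proof (induction Z rule: finite_induct)
  case (insert z Z)
  have "prob n K (\<lambda>u. (\<Sum>\<tau>\<in>T. partial n i (f \<tau>) u) = 0)
     \<le> prob n K (\<lambda>u. (\<Sum>\<tau>\<in>{\<tau>\<in>T. Z \<subseteq> S \<tau>}. partial n i (f \<tau>) u) = 0)"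
    by (rule insert.IH) (use insert.prems in auto)
  also have "\<dots> \<le> prob n K (\<lambda>u. (\<Sum>\<tau>\<in>{\<tau>\<in>{\<tau>\<in>T. Z \<subseteq> S \<tau>}. z \<in> S \<tau>}. partial n i (f \<tau>) u) = 0)"
    using insert.prems K T by (intro prob_partial_sum_step) auto
  also have "{\<tau>\<in>{\<tau>\<in>T. Z \<subseteq> S \<tau>}. z \<in> S \<tau>} = {\<tau>\<in>T. insert z Z \<subseteq> S \<tau>}" by auto
  finally show ?case .
qed simp

section \<open>Popular forms and their dependencies\<close>

lemma sum_sym_diff:
  fixes f :: "'a \<Rightarrow> 'b \<Rightarrow> bit"
  assumes "finite A" "finite B"
  shows "sum f A + sum f B = sum f ((A - B) \<union> (B - A))"
proof -
  have "sum f A = sum f (A - B) + sum f (A \<inter> B)" "sum f B = sum f (B - A) + sum f (A \<inter> B)"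
    using sum.Int_Diff[OF assms(1), of f B] sum.Int_Diff[OF assms(2), of f A]
    by (simp_all only: add.commute Int_commute)
  moreover have "sum f ((A - B) \<union> (B - A)) = sum f (A - B) + sum f (B - A)"
    using assms by (intro sum.union_disjoint) auto
  moreover have "(a + c) + (b + c) = a + b" for a b c :: "'b \<Rightarrow> bit"
    by (metis add.assoc add.commute bit_fun_add_self(2))
  ultimately show ?thesis by metis
qed

text \<open>In characteristic 2 two subset sums add up to the sum over the symmetric difference, so
  the subset sums of \<open>L\<close> form a subspace.\<close>

lemma subset_sum_closed:
  fixes f :: "'a \<Rightarrow> 'b \<Rightarrow> bit"
  assumes "finite L" "finite A" "\<And>a. a \<in> A \<Longrightarrow> \<exists>C\<subseteq>L. f a = \<Sum>C"
  shows "\<exists>C\<subseteq>L. sum f A = \<Sum>C"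
  using assms(2,3)
proof (induction A rule: finite_induct)
  case empty
  then show ?case by (intro exI[of _ "{}"]) simp
next
  case (insert a A)
  then obtain C D where C: "C \<subseteq> L" "f a = \<Sum>C" "D \<subseteq> L" "sum f A = \<Sum>D" by (meson insertCI)
  then have "finite C" "finite D" using assms(1) finite_subset by auto
  then have "sum f (insert a A) = \<Sum>((C - D) \<union> (D - C))"
    using C insert.hyps sum_sym_diff[of C D "\<lambda>x. x"] by simp
  then show ?case using C(1,3) by (intro exI[of _ "(C - D) \<union> (D - C)"]) auto
qed

text \<open>The tree often decides the gradient of \<open>a\<close> only after adding the other
  members of \<open>B\<close>. None of their index sets contains \<open>S\<close>, which is what
  lets \<open>prob_partial_sum\<close> discard them later.\<close>

definition popular :: "(nat \<Rightarrow> nat) \<Rightarrow> nat set \<Rightarrow> (nat \<Rightarrow> tup \<Rightarrow> (nat \<Rightarrow> bit) set) \<Rightarrow> real \<Rightarrow> nat set \<Rightarrow> (tup \<Rightarrow> bit) \<Rightarrow> bool"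
  where "popular n J \<Lambda> c S a \<longleftrightarrow> mlform n S a \<and> (\<exists>B. finite B \<and> (S, a) \<in> B \<and>
    (\<forall>p\<in>B. mlform n (fst p) (snd p) \<and> Max S \<in> fst p \<and> (S \<subseteq> fst p \<longrightarrow> p = (S, a))) \<and>
    c \<le> prob n {j\<in>J. j < Max S} (\<lambda>u. \<exists>C\<subseteq>\<Lambda> (Max S) u. (\<Sum>p\<in>B. partial n (Max S) (snd p) u) = \<Sum>C))"

text \<open>Often more than \<open>k\<close> of the \<open>N\<close> completed gradients are subset
  sums of at most \<open>k\<close> vectors. Then two subsets of these forms have equal gradient
  sums, and the symmetric difference has sum 0. Some fixed \<open>Q'\<close> occurs with probability
  \<open>c1\<close>; after discarding the completions, the gradient of the sum over
  \<open>Q'\<close> often vanishes, and \<open>bias_low_rank_le\<close> applies.\<close>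

lemma popular_dependent:
  fixes c :: real
  assumes FT: "\<And>d'. d' < d \<Longrightarrow> zeros_structured d'" and c: "c > 0"
  shows "\<exists>N K. \<forall>n J \<Lambda> S Q. finite J \<and> ctree n J k \<Lambda> \<and> S \<subseteq> J \<and> S \<noteq> {} \<and> card S \<le> d \<and> finite Q \<and> card Q = N \<and>
    (\<forall>a\<in>Q. popular n J \<Lambda> c S a) \<longrightarrow> (\<exists>Q'\<subseteq>Q. Q' \<noteq> {} \<and> low_rank n K S (\<lambda>u. \<Sum>a\<in>Q'. a u))"
proof -
  \<comment> \<open>Makes the expected number of captured forms, at least \<open>N * c\<close>,
    exceed \<open>k\<close> by at least \<open>N * (c / 2)\<close>.\<close>
  define N where "N = nat \<lceil>2 * k / c\<rceil> + 1"
  have N: "2 * k / c \<le> N" "N > 0" by (simp_all add: N_def) linarith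
  \<comment> \<open>The probability \<open>c / 2\<close> is shared among the at most
    \<open>2 ^ N\<close> subsets of \<open>Q\<close>.\<close>
  define c1 where "c1 = c / 2 / 2 ^ N"
  have c1: "c1 > 0" using c by (simp add: c1_def)
  obtain K where K: "\<forall>n S \<rho>. finite S \<and> S \<noteq> {} \<and> card S \<le> d \<and> mlform n S \<rho> \<and>
    c1 \<le> prob n (S - {Max S}) (\<lambda>u. partial n (Max S) \<rho> u = 0) \<longrightarrow> low_rank n K S \<rho>"
    using bias_low_rank_le[OF FT c1, of d] by blast
  show ?thesis
  proof (rule exI[of _ N], rule exI[of _ K], intro allI impI, elim conjE)
    fix n J \<Lambda> S Q
    assume J: "finite J" and tr: "ctree n J k \<Lambda>" and S: "S \<subseteq> J" "S \<noteq> {}" "card S \<le> d"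
      and Q: "finite Q" "card Q = N" and popular: "\<forall>a\<in>Q. popular n J \<Lambda> c S a"
    define i where "i = Max S"
    have fS: "finite S" using S J finite_subset by blast
    then have i: "i \<in> S" "\<And>j. j \<in> S \<Longrightarrow> j \<le> i" using S by (simp_all add: i_def)
    define K0 where "K0 = {j\<in>J. j < i}"
    have K0: "finite K0" "S - {i} \<subseteq> K0 - {i}" using J S(1) i(2) by (auto simp: K0_def order.not_eq_order_implies_strict)
    have \<Lambda>: "finite (\<Lambda> i u)" "card (\<Lambda> i u) \<le> k" for u
      using ctreeD(1,3)[OF tr] i(1) S(1) by blast+
    have "\<forall>a. \<exists>B. a \<in> Q \<longrightarrow> finite B \<and> (S, a) \<in> B \<and>
      (\<forall>p\<in>B. mlform n (fst p) (snd p) \<and> i \<in> fst p \<and> (S \<subseteq> fst p \<longrightarrow> p = (S, a))) \<and>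
      c \<le> prob n K0 (\<lambda>u. \<exists>C\<subseteq>\<Lambda> i u. (\<Sum>p\<in>B. partial n i (snd p) u) = \<Sum>C)"
      using popular unfolding popular_def i_def[symmetric] K0_def[symmetric] by blast
    then obtain B where B: "\<forall>a. a \<in> Q \<longrightarrow> finite (B a) \<and> (S, a) \<in> B a \<and>
      (\<forall>p\<in>B a. mlform n (fst p) (snd p) \<and> i \<in> fst p \<and> (S \<subseteq> fst p \<longrightarrow> p = (S, a))) \<and>
      c \<le> prob n K0 (\<lambda>u. \<exists>C\<subseteq>\<Lambda> i u. (\<Sum>p\<in>B a. partial n i (snd p) u) = \<Sum>C)"
    by (rule choice[THEN exE])
    define h where "h a u = (\<Sum>p\<in>B a. partial n i (snd p) u)" for a u
    define P where "P a u \<longleftrightarrow> (\<exists>C\<subseteq>\<Lambda> i u. h a u = \<Sum>C)" for a u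
    have Pc: "c \<le> prob n K0 (P a)" if "a \<in> Q" for a using B that unfolding P_def h_def by blast
    define D where "D u \<longleftrightarrow> k < card {a\<in>Q. P a u}" for u
    have "N * c \<le> (\<Sum>a\<in>Q. prob n K0 (P a))"
      using sum_bounded_below[of Q c "\<lambda>a. prob n K0 (P a)"] Pc Q by simp
    also have "\<dots> = mean n K0 (\<lambda>u. \<Sum>a\<in>Q. of_bool (P a u))" by (rule mean_sum[symmetric])
    also have "\<dots> \<le> mean n K0 (\<lambda>u. real k + real N * of_bool (D u))"
    proof (rule mean_mono)
      fix u
      have "(\<Sum>a\<in>Q. of_bool (P a u)) = real (card {a\<in>Q. P a u})"
        using Q by (simp add: of_bool_def sum.If_cases Int_def)
      moreover have "card {a\<in>Q. P a u} \<le> N" using Q card_mono[of Q "{a\<in>Q. P a u}"] by auto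
      ultimately show "(\<Sum>a\<in>Q. of_bool (P a u)) \<le> real k + real N * of_bool (D u)" by (auto simp: D_def)
    qed
    also have "\<dots> = k + N * prob n K0 D"
      by (simp only: mean_add mean_mult mean_const[OF K0(1)])
    finally have "N * c - k \<le> N * prob n K0 D" by simp
    moreover have "k \<le> N * (c / 2)" using N c by (simp add: field_simps)
    ultimately have "N * (c / 2) \<le> N * prob n K0 D" by (simp add: field_simps)
    then have D: "c / 2 \<le> prob n K0 D" using N(2) by (simp add: mult_le_cancel_left)
    define Z where "Z Q' u \<longleftrightarrow> (\<Sum>a\<in>Q'. h a u) = 0" for Q' u
    have DZ: "\<exists>Q'\<in>Pow Q - {{}}. Z Q' u" if "D u" for u
    proof -
      let ?Q = "{a\<in>Q. P a u}"
      let ?s = "\<lambda>R. \<Sum>a\<in>R. h a u"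
      have "?s ` Pow ?Q \<subseteq> Sum ` Pow (\<Lambda> i u)"
      proof (intro image_subsetI)
        fix R assume R: "R \<in> Pow ?Q"
        then have "finite R" using Q finite_subset by fastforce
        then have "\<exists>C\<subseteq>\<Lambda> i u. ?s R = \<Sum>C"
          using R by (intro subset_sum_closed \<Lambda>) (auto simp: P_def)
        then show "?s R \<in> Sum ` Pow (\<Lambda> i u)" by auto
      qed
      then have "card (?s ` Pow ?Q) \<le> card (Sum ` Pow (\<Lambda> i u))"
        using \<Lambda>(1) by (intro card_mono) auto
      also have "\<dots> \<le> card (Pow (\<Lambda> i u))" using \<Lambda>(1) by (intro card_image_le) auto
      also have "\<dots> \<le> 2 ^ k" using \<Lambda> by (simp add: card_Pow)
      also have "\<dots> < 2 ^ card ?Q" using that by (simp add: D_def)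
      also have "\<dots> = card (Pow ?Q)" using Q by (simp add: card_Pow)
      finally have "\<not> inj_on ?s (Pow ?Q)" using card_image by fastforce
      then obtain Q1 Q2 where Q12: "Q1 \<subseteq> ?Q" "Q2 \<subseteq> ?Q" "Q1 \<noteq> Q2" "?s Q1 = ?s Q2"
        unfolding inj_on_def by blast
      then have "finite Q1" "finite Q2" using Q finite_subset by fastforce+
      then have "?s ((Q1 - Q2) \<union> (Q2 - Q1)) = ?s Q1 + ?s Q2" by (rule sum_sym_diff[symmetric])
      also have "\<dots> = 0" by (simp only: Q12(4) bit_fun_add_self)
      finally have "Z ((Q1 - Q2) \<union> (Q2 - Q1)) u" by (simp only: Z_def)
      moreover have "(Q1 - Q2) \<union> (Q2 - Q1) \<in> Pow Q - {{}}" using Q12 by auto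
      ultimately show ?thesis by blast
    qed
    have "\<exists>Q'\<in>Pow Q - {{}}. c1 \<le> prob n K0 (Z Q')"
    proof (rule ccontr)
      assume none: "\<not> ?thesis"
      have fP: "finite (Pow Q - {{}})" using Q by simp
      have "prob n K0 D \<le> mean n K0 (\<lambda>u. \<Sum>Q'\<in>Pow Q - {{}}. of_bool (Z Q' u))"
      proof (rule mean_mono)
        fix u
        show "of_bool (D u) \<le> (\<Sum>Q'\<in>Pow Q - {{}}. of_bool (Z Q' u) :: real)"
        proof (cases "D u")
          case True
          then obtain Q' where Q': "Q' \<in> Pow Q - {{}}" "Z Q' u" using DZ by blast
          have "of_bool (Z Q' u) \<le> (\<Sum>Q'\<in>Pow Q - {{}}. of_bool (Z Q' u) :: real)"
            using Q'(1) fP by (intro member_le_sum) auto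
          then show ?thesis using Q' True by simp
        qed (simp add: sum_nonneg)
      qed
      also have "\<dots> = (\<Sum>Q'\<in>Pow Q - {{}}. prob n K0 (Z Q'))" by (rule mean_sum)
      also have "\<dots> \<le> of_nat (card (Pow Q - {{}})) * c1"
        using none by (intro sum_bounded_above) (auto simp: not_le less_imp_le)
      also have "\<dots> < 2 ^ N * c1"
        using c1 Q by (simp add: card_Diff_singleton card_Pow of_nat_diff)
      also have "\<dots> = c / 2" by (simp add: c1_def)
      finally show False using D by simp
    qed
    then obtain Q' where Q': "Q' \<subseteq> Q" "Q' \<noteq> {}" and Zc: "c1 \<le> prob n K0 (Z Q')" by auto
    define \<rho> where "\<rho> u = (\<Sum>a\<in>Q'. a u)" for u :: tup
    have fQ': "finite Q'" using Q Q' finite_subset by blast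
    have aQ: "mlform n S a" if "a \<in> Q'" for a using that Q'(1) popular by (auto simp: popular_def)
    then have \<rho>: "mlform n S \<rho>" unfolding \<rho>_def by (intro mlform_sum)
    define T where "T = (SIGMA a : Q'. B a)"
    have BQ: "finite (B a)" "(S, a) \<in> B a" "\<And>p. p \<in> B a \<Longrightarrow> mlform n (fst p) (snd p)"
      "\<And>p. p \<in> B a \<Longrightarrow> i \<in> fst p" "\<And>p. p \<in> B a \<Longrightarrow> S \<subseteq> fst p \<Longrightarrow> p = (S, a)" if "a \<in> Q'" for a
      using B that Q'(1) by blast+
    have T: "finite T" "\<And>\<tau>. \<tau> \<in> T \<Longrightarrow> mlform n (fst (snd \<tau>)) (snd (snd \<tau>))"
      unfolding T_def using fQ' BQ(1,3) by auto
    have "Z Q' u \<longleftrightarrow> (\<Sum>\<tau>\<in>T. partial n i (snd (snd \<tau>)) u) = 0" for u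
    proof -
      have "(\<Sum>a\<in>Q'. h a u) = (\<Sum>(a, p)\<in>T. partial n i (snd p) u)"
        unfolding h_def T_def using fQ' BQ(1) by (intro sum.Sigma) auto
      then show ?thesis unfolding Z_def by (simp only: case_prod_unfold)
    qed
    then have "c1 \<le> prob n K0 (\<lambda>u. (\<Sum>\<tau>\<in>T. partial n i (snd (snd \<tau>)) u) = 0)" using Zc by (simp only:)
    \<comment> \<open>Each summand other than the forms \<open>a\<close> themselves misses a
      coordinate of \<open>S\<close> and drops out.\<close>
    also have "\<dots> \<le> prob n K0 (\<lambda>u. (\<Sum>\<tau>\<in>{\<tau>\<in>T. S - {i} \<subseteq> fst (snd \<tau>)}. partial n i (snd (snd \<tau>)) u) = 0)"
      using fS K0 T by (intro prob_partial_sum) auto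
    also have "{\<tau>\<in>T. S - {i} \<subseteq> fst (snd \<tau>)} = (\<lambda>a. (a, (S, a))) ` Q'"
    proof (intro equalityI subsetI)
      fix \<tau> assume "\<tau> \<in> {\<tau>\<in>T. S - {i} \<subseteq> fst (snd \<tau>)}"
      then obtain a p where ap: "\<tau> = (a, p)" "a \<in> Q'" "p \<in> B a" "S - {i} \<subseteq> fst p" by (auto simp: T_def)
      then have "S \<subseteq> fst p" using BQ(4)[OF ap(2,3)] by blast
      then show "\<tau> \<in> (\<lambda>a. (a, (S, a))) ` Q'" using BQ(5)[OF ap(2,3)] ap by auto
    next
      fix \<tau> assume "\<tau> \<in> (\<lambda>a. (a, (S, a))) ` Q'"
      then show "\<tau> \<in> {\<tau>\<in>T. S - {i} \<subseteq> fst (snd \<tau>)}" using BQ(2) by (auto simp: T_def)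
    qed
    also have "(\<lambda>u. of_bool ((\<Sum>\<tau>\<in>(\<lambda>a. (a, (S, a))) ` Q'. partial n i (snd (snd \<tau>)) u) = 0) :: real)
       = (\<lambda>u. of_bool (partial n i \<rho> u = 0))"
    proof
      fix u
      have "(\<Sum>\<tau>\<in>(\<lambda>a. (a, (S, a))) ` Q'. partial n i (snd (snd \<tau>)) u) = (\<Sum>a\<in>Q'. partial n i a u)"
        by (subst sum.reindex) (auto simp: inj_on_def)
      also have "\<dots> = partial n i \<rho> u" unfolding \<rho>_def by (rule partial_sum[symmetric])
      finally show "of_bool ((\<Sum>\<tau>\<in>(\<lambda>a. (a, (S, a))) ` Q'. partial n i (snd (snd \<tau>)) u) = 0)
        = (of_bool (partial n i \<rho> u = 0) :: real)" by (simp only:)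
    qed
    also have "prob n K0 (\<lambda>u. partial n i \<rho> u = 0) = prob n (S - {i}) (\<lambda>u. partial n i \<rho> u = 0)"
    proof (rule mean_subset[OF K0(1)])
      show "S - {i} \<subseteq> K0" using K0(2) by auto
      fix u v :: tup assume "\<forall>j\<in>S - {i}. u j = v j"
      then have "partial n i \<rho> u = partial n i \<rho> v" by (intro partial_agree[OF \<rho>]) (auto simp: agree_def)
      then show "of_bool (partial n i \<rho> u = 0) = (of_bool (partial n i \<rho> v = 0) :: real)" by (simp only:)
    qed
    finally have "low_rank n K S \<rho>" using K fS S(2,3) \<rho> unfolding i_def by blast
    then show "\<exists>Q'\<subseteq>Q. Q' \<noteq> {} \<and> low_rank n K S (\<lambda>u. \<Sum>a\<in>Q'. a u)"
      using Q' unfolding \<rho>_def by blast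
  qed
qed

subsection \<open>Forms vanishing on a tree\<close>

lemma prod_span_0: "(\<lambda>u. 0) \<in> prod_span S A"
  using fun_vs.span_zero[of "{fam_prod B |B. B \<subseteq> A \<and> partitions B S}"]
  by (simp only: prod_span_def zero_fun_def)

lemma prod_span_add: "f \<in> prod_span S A \<Longrightarrow> g \<in> prod_span S A \<Longrightarrow> (\<lambda>u. f u + g u) \<in> prod_span S A"
  using fun_vs.span_add[of f "{fam_prod B |B. B \<subseteq> A \<and> partitions B S}" g]
  by (simp only: prod_span_def plus_fun_def)

lemma prod_span_sum: "(\<And>a. a \<in> I \<Longrightarrow> f a \<in> prod_span S A) \<Longrightarrow> (\<lambda>u. \<Sum>a\<in>I. f a u) \<in> prod_span S A"
  by (induction I rule: infinite_finite_induct) (simp_all add: prod_span_0 prod_span_add)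

lemma prod_span_base: "B \<subseteq> A \<Longrightarrow> partitions B S \<Longrightarrow> fam_prod B \<in> prod_span S A"
  unfolding prod_span_def by (intro fun_vs.span_base) blast

lemma prod_span_induct [consumes 1, case_names zero add]:
  assumes "h \<in> prod_span S A" "P (\<lambda>u. 0)"
    and "\<And>B h. B \<subseteq> A \<Longrightarrow> partitions B S \<Longrightarrow> P h \<Longrightarrow> P (\<lambda>u. fam_prod B u + h u)"
  shows "P h"
  using assms(1) unfolding prod_span_def
proof (induction rule: fun_vs.span_induct_alt)
  case base
  then show ?case using assms(2) by (simp only: zero_fun_def)
next
  case (step c x y)
  then obtain B where B: "x = fam_prod B" "B \<subseteq> A" "partitions B S" by blast
  show ?case
  proof (cases "c = 0")
    case True
    then have "fun_scale c x + y = y" by (simp add: fun_scale_def fun_eq_iff)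
    then show ?thesis using step by (simp only:)
  next
    case False
    then have "fun_scale c x + y = (\<lambda>u. fam_prod B u + y u)" using B by (simp add: fun_scale_def fun_eq_iff)
    then show ?thesis using assms(3)[OF B(2,3) step(2)] by (simp only:)
  qed
qed

lemma prod_span_explicit:
  assumes "h \<in> prod_span S A" "finite A"
  shows "\<exists>\<C>\<subseteq>{B. B \<subseteq> A \<and> partitions B S}. h = (\<lambda>u. \<Sum>B\<in>\<C>. fam_prod B u)"
  using assms(1)
proof (induction rule: prod_span_induct)
  case zero
  then show ?case by (intro exI[of _ "{}"]) simp
next
  case (add B h)
  then obtain \<C> where \<C>: "\<C> \<subseteq> {B. B \<subseteq> A \<and> partitions B S}" "h = (\<lambda>u. \<Sum>B\<in>\<C>. fam_prod B u)" by blast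
  have "\<C> \<subseteq> Pow A" using \<C>(1) by auto
  then have fin: "finite \<C>" using assms(2) finite_subset by blast
  show ?case
  proof (cases "B \<in> \<C>")
    case True
    then have "(\<lambda>u. fam_prod B u + h u) = (\<lambda>u. \<Sum>B\<in>\<C> - {B}. fam_prod B u)"
      using fin by (simp add: \<C>(2) sum.remove[of \<C> B])
    then show ?thesis using \<C>(1) by (intro exI[of _ "\<C> - {B}"]) auto
  next
    case False
    then have "(\<lambda>u. fam_prod B u + h u) = (\<lambda>u. \<Sum>B\<in>insert B \<C>. fam_prod B u)"
      using fin by (simp add: \<C>(2))
    then show ?thesis using \<C>(1) add(1,2) by (intro exI[of _ "insert B \<C>"]) auto
  qed
qed

text \<open>Expand \<open>f0\<close> inside every product containing it. The terms from
  \<open>F\<close> are again products from \<open>A\<close> without \<open>f0\<close>; those from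
  \<open>l\<close> split the block \<open>S\<close> into blocks of \<open>L\<close>; those from
  \<open>R\<close> have a factor in \<open>V S\<close>, hence are structured and go into
  \<open>w\<close>.\<close>

lemma prod_span_replace:
  assumes J: "finite J" and A: "form_family n A" "(S, f0) \<in> A" "S \<subseteq> J"
    and f0: "f0 = (\<lambda>u. (\<Sum>f\<in>F. f u) + (\<Sum>v\<in>R. v u) + l u)"
    and F: "\<And>f. f \<in> F \<Longrightarrow> (S, f) \<in> A \<and> f \<noteq> f0"
    and R: "R \<subseteq> V S" "finite (V S)"
    and L: "l \<in> prod_span S L" "form_family n L" "\<And>p. p \<in> L \<Longrightarrow> fst p \<subset> S"
    and h: "h \<in> prod_span J A"
  shows "\<exists>w\<in>structured n J V. (\<lambda>u. h u + w u) \<in> prod_span J (A - {(S, f0)} \<union> L)"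
  using h
proof (induction rule: prod_span_induct)
  case zero
  show ?case using structured_0[of n J V] prod_span_0 by (intro bexI[of _ "\<lambda>u. 0"]) simp_all
next
  case (add B h)
  let ?A' = "A - {(S, f0)} \<union> L"
  obtain w where w: "w \<in> structured n J V" "(\<lambda>u. h u + w u) \<in> prod_span J ?A'" using add.IH by blast
  have "\<exists>w'\<in>structured n J V. (\<lambda>u. fam_prod B u + w' u) \<in> prod_span J ?A'"
  proof (cases "(S, f0) \<in> B")
    case False
    then have "fam_prod B \<in> prod_span J ?A'" using add.hyps by (intro prod_span_base) auto
    then show ?thesis using structured_0[of n J V] by (intro bexI[of _ "\<lambda>u. 0"]) simp_all
  next
    case True
    define B' where "B' = B - {(S, f0)}"
    have finB: "finite B" using A(1) add.hyps(1) finite_subset by (auto simp: form_family_def)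
    have S0: "S \<noteq> {}" using A(1,2) by (auto simp: form_family_def)
    have un: "(\<Union>p\<in>B'. fst p) = J - S" and disj: "\<And>p. p \<in> B' \<Longrightarrow> fst p \<inter> S = {}"
    proof -
      show d: "fst p \<inter> S = {}" if "p \<in> B'" for p
        using add.hyps(2) True that unfolding partitions_def B'_def by fastforce
      have "J = S \<union> (\<Union>p\<in>B'. fst p)" using add.hyps(2) True unfolding partitions_def B'_def by auto
      then show "(\<Union>p\<in>B'. fst p) = J - S" using d by blast
    qed
    have B'A: "B' \<subseteq> ?A'" using add.hyps(1) by (auto simp: B'_def)
    have finB': "finite B'" using finB by (simp add: B'_def)
    have B'd: "\<And>p q. p \<in> B' \<Longrightarrow> q \<in> B' \<Longrightarrow> p \<noteq> q \<Longrightarrow> fst p \<inter> fst q = {}"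
      using add.hyps(2) unfolding partitions_def B'_def by blast
    have mB': "mlform n (J - S) (fam_prod B')"
    proof -
      have "mlform n (\<Union>p\<in>B'. fst p) (\<lambda>u. \<Prod>p\<in>B'. snd p u)"
        using A(1) add.hyps(1) B'd finB' by (intro mlform_prod) (auto simp: form_family_def B'_def)
      then show ?thesis by (simp only: un fam_prod_def)
    qed
    have pB: "fam_prod B u = f0 u * fam_prod B' u" for u
      using True finB by (simp add: fam_prod_def B'_def prod.remove)
    have 1: "(\<lambda>u. f u * fam_prod B' u) \<in> prod_span J ?A'" if f: "f \<in> F" for f
    proof -
      have notin: "(S, f) \<notin> B'" using disj[of "(S, f)"] S0 by auto
      have "partitions (insert (S, f) B') J"
        unfolding partitions_def
      proof (intro conjI ballI impI)
        show "(\<Union>p\<in>insert (S, f) B'. fst p) = J" using un A(3) by auto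
        fix p q assume pq: "p \<in> insert (S, f) B'" "q \<in> insert (S, f) B'" "p \<noteq> q"
        show "fst p \<inter> fst q = {}"
        proof (cases "p \<in> B'"; cases "q \<in> B'")
          assume "p \<in> B'" "q \<in> B'"
          then show ?thesis using B'd pq(3) by blast
        next
          assume "p \<in> B'" "q \<notin> B'"
          then show ?thesis using disj[of p] pq(2) by simp
        next
          assume "p \<notin> B'" "q \<in> B'"
          then show ?thesis using disj[of q] pq(1) by (simp add: Int_commute)
        next
          assume "p \<notin> B'" "q \<notin> B'"
          then show ?thesis using pq by simp
        qed
      qed
      moreover have "insert (S, f) B' \<subseteq> ?A'" using B'A F[OF f] by auto
      ultimately have "fam_prod (insert (S, f) B') \<in> prod_span J ?A'" by (rule prod_span_base[rotated])
      moreover have "fam_prod (insert (S, f) B') = (\<lambda>u. f u * fam_prod B' u)"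
        using notin finB' by (simp add: fam_prod_def fun_eq_iff)
      ultimately show ?thesis by simp
    qed
    have 2: "(\<lambda>u. \<Sum>v\<in>R. v u * fam_prod B' u) \<in> structured n J V"
      using J A(3) S0 R mB' by (intro structured_sum structured_gen[where I = S]) auto
    have 3: "(\<lambda>u. l u * fam_prod B' u) \<in> prod_span J ?A'"
      using L(1)
    proof (induction rule: prod_span_induct)
      case zero
      show ?case using prod_span_0 by simp
    next
      case (add B1 l)
      have ne: "fst p \<noteq> {}" "fst p \<subset> S" if "p \<in> B1" for p
      proof -
        have "p \<in> L" using that add.hyps(1) by blast
        then show "fst p \<noteq> {}" "fst p \<subset> S" using L(2) L(3)[of p] unfolding form_family_def by blast+
      qed
      have dj: "B1 \<inter> B' = {}" using ne disj by fastforce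
      have fin1: "finite B1" using add.hyps(1) L(2) finite_subset by (auto simp: form_family_def)
      have "partitions (B1 \<union> B') J"
        unfolding partitions_def
      proof (intro conjI ballI impI)
        have "(\<Union>p\<in>B1. fst p) = S" using add.hyps(2) by (simp add: partitions_def)
        then show "(\<Union>p\<in>B1 \<union> B'. fst p) = J" using un A(3) by auto
        fix p q assume pq: "p \<in> B1 \<union> B'" "q \<in> B1 \<union> B'" "p \<noteq> q"
        show "fst p \<inter> fst q = {}"
        proof (cases "p \<in> B1"; cases "q \<in> B1")
          assume "p \<in> B1" "q \<in> B1"
          then show ?thesis using add.hyps(2) pq(3) unfolding partitions_def by blast
        next
          assume "p \<in> B1" "q \<notin> B1"
          then show ?thesis using ne(2)[of p] disj[of q] pq by blast
        next
          assume "p \<notin> B1" "q \<in> B1"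
          then show ?thesis using ne(2)[of q] disj[of p] pq by blast
        next
          assume "p \<notin> B1" "q \<notin> B1"
          then show ?thesis using B'd pq by blast
        qed
      qed
      moreover have "B1 \<union> B' \<subseteq> ?A'" using add.hyps(1) B'A by auto
      ultimately have "fam_prod (B1 \<union> B') \<in> prod_span J ?A'" by (rule prod_span_base[rotated])
      moreover have "fam_prod (B1 \<union> B') = (\<lambda>u. fam_prod B1 u * fam_prod B' u)"
        using dj fin1 finB' by (simp add: fam_prod_def prod.union_disjoint fun_eq_iff)
      ultimately have "(\<lambda>u. fam_prod B1 u * fam_prod B' u) \<in> prod_span J ?A'" by simp
      from prod_span_add[OF this add.IH] show ?case by (simp add: distrib_right)
    qed
    have "(\<lambda>u. fam_prod B u + (\<Sum>v\<in>R. v u * fam_prod B' u)) = (\<lambda>u. (\<Sum>f\<in>F. f u * fam_prod B' u) + l u * fam_prod B' u)"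
    proof
      fix u
      have "fam_prod B u = (\<Sum>f\<in>F. f u * fam_prod B' u) + (\<Sum>v\<in>R. v u * fam_prod B' u) + l u * fam_prod B' u"
        unfolding pB by (subst f0) (simp add: distrib_right sum_distrib_right)
      then show "fam_prod B u + (\<Sum>v\<in>R. v u * fam_prod B' u) = (\<Sum>f\<in>F. f u * fam_prod B' u) + l u * fam_prod B' u"
        by (simp add: add_ac)
    qed
    also have "\<dots> \<in> prod_span J ?A'" by (intro prod_span_add prod_span_sum 1 3)
    finally have 4: "(\<lambda>u. fam_prod B u + (\<Sum>v\<in>R. v u * fam_prod B' u)) \<in> prod_span J ?A'" .
    show ?thesis by (rule bexI[OF _ 2]) (rule 4)
  qed
  then obtain w' where w': "w' \<in> structured n J V" "(\<lambda>u. fam_prod B u + w' u) \<in> prod_span J ?A'" by blast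
  have 5: "(\<lambda>u. (fam_prod B u + h u) + (w' u + w u)) \<in> prod_span J ?A'"
    using prod_span_add[OF w'(2) w(2)] by (simp add: add_ac)
  show ?case by (rule bexI[OF _ structured_add[OF w'(1) w(1)]]) (rule 5)
qed

section \<open>The exchange of forms along a tree\<close>

definition extend_tree :: "(nat \<Rightarrow> nat) \<Rightarrow> nat set \<Rightarrow> (nat \<Rightarrow> tup \<Rightarrow> (nat \<Rightarrow> bit) set) \<Rightarrow> (nat set \<Rightarrow> (tup \<Rightarrow> bit) set) \<Rightarrow>
    nat \<Rightarrow> tup \<Rightarrow> (nat \<Rightarrow> bit) set"
  where "extend_tree n J \<Lambda> V i u = \<Lambda> i u \<union> (\<Union>I\<in>{I\<in>Pow J - {{}}. Max I = i}. (\<lambda>f. partial n i f u) ` V I)"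

text \<open>The gradient of a form in its last coordinate depends on earlier coordinates only, so it
  is an admissible condition there. At most \<open>2 ^ card J\<close> index sets end at a given
  coordinate.\<close>

lemma extend_tree_ctree:
  assumes J: "finite J" and "ctree n J k \<Lambda>" "bounded_forms n k V"
  shows "ctree n J (k + 2 ^ card J * k) (extend_tree n J \<Lambda> V)"
  unfolding extend_tree_def
proof (rule ctree_Un[OF assms(2)], unfold ctree_def, intro ballI allI conjI impI)
  fix i u assume i: "i \<in> J"
  have V: "finite (V I)" "card (V I) \<le> k" "\<And>f. f \<in> V I \<Longrightarrow> mlform n I f" for I
    using assms(3) by (auto simp: bounded_forms_def)
  let ?P = "{I\<in>Pow J - {{}}. Max I = i}"
  have P: "finite ?P" "card ?P \<le> 2 ^ card J"
    using J card_mono[of "Pow J" ?P] by (auto simp: card_Pow)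
  show "finite (\<Union>I\<in>?P. (\<lambda>f. partial n i f u) ` V I)" using P V by auto
  show "(\<Union>I\<in>?P. (\<lambda>f. partial n i f u) ` V I) \<subseteq> vecs {..<n i}" using partial_vecs by auto
  have "card (\<Union>I\<in>?P. (\<lambda>f. partial n i f u) ` V I) \<le> (\<Sum>I\<in>?P. card ((\<lambda>f. partial n i f u) ` V I))"
    by (rule card_UN_le[OF P(1)])
  also have "\<dots> \<le> of_nat (card ?P) * k"
    using V by (intro sum_bounded_above) (meson card_image_le order_trans)
  also have "\<dots> \<le> 2 ^ card J * k" using P by (intro mult_right_mono) auto
  finally show "card (\<Union>I\<in>?P. (\<lambda>f. partial n i f u) ` V I) \<le> 2 ^ card J * k" .
  fix v assume uv: "agree n {j\<in>J. j < i} u v"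
  have "(\<lambda>f. partial n i f u) ` V I = (\<lambda>f. partial n i f v) ` V I" if I: "I \<in> ?P" for I
  proof (rule image_cong[OF refl])
    fix f assume "f \<in> V I"
    have fI: "finite I" using I J finite_subset by auto
    have "I - {i} \<subseteq> {j\<in>J. j < i}"
    proof
      fix j assume j: "j \<in> I - {i}"
      then have "j \<le> Max I" using fI by simp
      then show "j \<in> {j\<in>J. j < i}" using j I by auto
    qed
    then have "agree n (I - {i}) u v" using uv agree_mono by blast
    then show "partial n i f u = partial n i f v" by (rule partial_agree[OF V(3)[OF \<open>f \<in> V I\<close>]])
  qed
  then show "(\<Union>I\<in>?P. (\<lambda>f. partial n i f u) ` V I) = (\<Union>I\<in>?P. (\<lambda>f. partial n i f v) ` V I)"
    by (rule SUP_cong[OF refl])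
qed

text \<open>A form is the inner product of its last vector with its gradient there, which the
  extended tree forces to be 0. With the members of \<open>V\<close>, all structured forms vanish
  too.\<close>

lemma extend_tree_tree_zeros:
  assumes J: "finite J" and V: "bounded_forms n k V" and u: "u \<in> tree_zeros n J (extend_tree n J \<Lambda> V)"
  shows "u \<in> tree_zeros n J \<Lambda>" "\<And>I f. I \<subseteq> J \<Longrightarrow> I \<noteq> {} \<Longrightarrow> f \<in> V I \<Longrightarrow> f u = 0"
proof -
  show "u \<in> tree_zeros n J \<Lambda>" using u by (auto simp: tree_zeros_def extend_tree_def)
  fix I f assume I: "I \<subseteq> J" "I \<noteq> {}" "f \<in> V I"
  have "finite I" using I J finite_subset by blast
  then have m: "Max I \<in> I" using I by simp
  then have "partial n (Max I) f u \<in> extend_tree n J \<Lambda> V (Max I) u" "Max I \<in> J" using I by (auto simp: extend_tree_def)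
  then have "dot {..<n (Max I)} (u (Max I)) (partial n (Max I) f u) = 0" using u by (simp add: tree_zeros_def)
  moreover have "mlform n I f" using V I by (simp add: bounded_forms_def)
  ultimately show "f u = 0" using mlform_dot_partial[OF _ m] by metis
qed

text \<open>Take a largest set of popular forms without a nonempty subset sum of low rank. The
  hypothesis bounds its size, and adding another popular form creates a dependency involving that
  form.\<close>

lemma popular_basis:
  fixes c :: real
  assumes "\<And>Q. finite Q \<Longrightarrow> card Q = N \<Longrightarrow> (\<forall>a\<in>Q. popular n J \<Lambda> c S a) \<Longrightarrow>
    (\<exists>Q'\<subseteq>Q. Q' \<noteq> {} \<and> low_rank n K S (\<lambda>u. \<Sum>a\<in>Q'. a u))"
  shows "\<exists>Q. finite Q \<and> card Q \<le> N \<and> (\<forall>a\<in>Q. mlform n S a) \<and>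
    (\<forall>a. popular n J \<Lambda> c S a \<longrightarrow> (\<exists>R\<subseteq>Q. low_rank n K S (\<lambda>u. a u + (\<Sum>v\<in>R. v u))))"
proof -
  define ind where "ind Q \<longleftrightarrow> finite Q \<and> (\<forall>a\<in>Q. popular n J \<Lambda> c S a) \<and>
    \<not> (\<exists>Q'\<subseteq>Q. Q' \<noteq> {} \<and> low_rank n K S (\<lambda>u. \<Sum>a\<in>Q'. a u))" for Q
  have bound: "card Q < N" if "ind Q" for Q
  proof (rule ccontr)
    assume "\<not> card Q < N"
    then obtain Q0 where Q0: "Q0 \<subseteq> Q" "card Q0 = N" "finite Q0"
      using obtain_subset_with_card_n[of N Q] by auto
    then have "\<exists>Q'\<subseteq>Q0. Q' \<noteq> {} \<and> low_rank n K S (\<lambda>u. \<Sum>a\<in>Q'. a u)"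
      using that by (intro assms) (auto simp: ind_def)
    then show False using that Q0(1) unfolding ind_def by (meson order_trans)
  qed
  have "ind {}" by (auto simp: ind_def)
  then obtain Q where Q: "ind Q" "\<And>Q'. ind Q' \<Longrightarrow> card Q' \<le> card Q"
    using ex_has_greatest_nat[of ind "{}" card N] bound by blast
  have "\<exists>R\<subseteq>Q. low_rank n K S (\<lambda>u. a u + (\<Sum>v\<in>R. v u))" if a: "popular n J \<Lambda> c S a" for a
  proof (cases "a \<in> Q")
    case True
    \<comment> \<open>Here \<open>a + a = 0\<close>.\<close>
    then show ?thesis using low_rank_0[of n K S] by (intro exI[of _ "{a}"]) simp
  next
    case False
    have finQ: "finite Q" using Q by (simp add: ind_def)
    then have "\<not> ind (insert a Q)" using Q(2)[of "insert a Q"] False by auto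
    then obtain Q' where Q': "Q' \<subseteq> insert a Q" "Q' \<noteq> {}" "low_rank n K S (\<lambda>u. \<Sum>a\<in>Q'. a u)"
      using Q(1) a finQ unfolding ind_def by blast
    have "a \<in> Q'" using Q' Q(1) unfolding ind_def by blast
    moreover have "finite Q'" using Q'(1) finQ finite_subset by blast
    ultimately have "(\<lambda>u. \<Sum>a\<in>Q'. a u) = (\<lambda>u. a u + (\<Sum>v\<in>Q' - {a}. v u))"
      by (simp add: sum.remove)
    then show ?thesis using Q' by (intro exI[of _ "Q' - {a}"]) auto
  qed
  then show ?thesis using Q(1) bound[OF Q(1)] unfolding ind_def popular_def
    by (intro exI[of _ Q]) auto
qed

text \<open>A state of the exchange: \<open>w\<close> is the part already structured, and
  \<open>m\<close> bounds the degrees of the forms in \<open>A\<close> with multiplicity.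
  \<open>V'\<close> is fixed before \<open>r\<close>, \<open>w\<close> and \<open>A\<close>.\<close>

definition absorbed :: "(nat \<Rightarrow> nat) \<Rightarrow> nat set \<Rightarrow> (nat \<Rightarrow> tup \<Rightarrow> (nat \<Rightarrow> bit) set) \<Rightarrow>
    (nat set \<Rightarrow> (tup \<Rightarrow> bit) set) \<Rightarrow> nat multiset \<Rightarrow> nat \<Rightarrow> (nat set \<Rightarrow> (tup \<Rightarrow> bit) set) \<Rightarrow> bool"
  where "absorbed n J \<Lambda> V m K V' \<longleftrightarrow> bounded_forms n K V' \<and>
    (\<forall>r w A. mlform n J r \<and> (\<forall>u\<in>tree_zeros n J \<Lambda>. r u = 0) \<and> w \<in> structured n J V \<and>
      form_family n A \<and> (\<forall>p\<in>A. fst p \<subseteq> J) \<and> image_mset (\<lambda>p. card (fst p)) (mset_set A) \<subseteq># m \<and>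
      (\<lambda>u. r u + w u) \<in> prod_span J A \<longrightarrow> r \<in> structured n J V')"

definition absorbs :: "nat \<Rightarrow> nat multiset \<Rightarrow> bool"
  where "absorbs d m \<longleftrightarrow> (\<forall>k. \<exists>K. \<forall>n J \<Lambda> V. finite J \<and> card J = d \<and> ctree n J k \<Lambda> \<and> bounded_forms n k V \<longrightarrow>
    (\<exists>V'. absorbed n J \<Lambda> V m K V'))"

lemma mset_set_Un_subset: "finite A \<Longrightarrow> finite B \<Longrightarrow> mset_set (A \<union> B) \<subseteq># mset_set A + mset_set B"
  by (rule mset_subset_eqI) (auto simp: count_mset_set')

text \<open>One form of degree \<open>t\<close> is traded for at most \<open>K\<close> forms of
  smaller degrees. These degrees are not known in advance, so \<open>K\<close> copies of each are
  provided; the multiset order still drops.\<close>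

definition lower :: "nat \<Rightarrow> nat multiset \<Rightarrow> nat \<Rightarrow> nat multiset"
  where "lower K m t = m - {#t#} + (\<Sum>t'<t. replicate_mset K t')"

lemma lower_less:
  assumes "t \<in># m"
  shows "lower K m t < m"
proof -
  have "x < t" if "x \<in># (\<Sum>t'<t. replicate_mset K t')" for x
    using that by (auto simp: set_mset_sum split: if_splits)
  then have "multp (<) (m - {#t#} + (\<Sum>t'<t. replicate_mset K t')) (m - {#t#} + {#t#})"
    by (intro one_step_implies_multp) auto
  then show ?thesis using assms by (simp add: lower_def less_multiset_def)
qed

lemma subset_lower:
  fixes M :: "nat multiset"
  assumes "size M \<le> K" "\<And>x. x \<in># M \<Longrightarrow> x < t"
  shows "M \<subseteq># (\<Sum>t'<t. replicate_mset K t')"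
proof (rule mset_subset_eqI)
  fix x
  show "count M x \<le> count (\<Sum>t'<t. replicate_mset K t') x"
  proof (cases "x \<in># M")
    case True
    then have "x < t" by (rule assms(2))
    then have "(\<Sum>a<t. if x = a then K else 0) = K" by (subst sum.delta') auto
    then have "count (\<Sum>t'<t. replicate_mset K t') x = K" by (simp add: count_sum)
    then show ?thesis using assms(1) count_le_size[of M x] by simp
  next
    case False
    then show ?thesis by (simp add: not_in_iff)
  qed
qed

lemma diff_subset_mset_mono: "(A :: 'a multiset) \<subseteq># B \<Longrightarrow> A - C \<subseteq># B - C"
  by (meson subset_eq_diff_conv subset_mset.order_refl subset_mset.trans)

lemma replace_subset_lower:
  assumes "finite A" "p0 \<in> A" "image_mset g (mset_set A) \<subseteq># m" "finite L" "card L \<le> K"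
    and "\<And>p. p \<in> L \<Longrightarrow> g p < g p0"
  shows "image_mset g (mset_set (A - {p0} \<union> L)) \<subseteq># lower K m (g p0)"
proof -
  have "image_mset g (mset_set (A - {p0} \<union> L)) \<subseteq># image_mset g (mset_set (A - {p0})) + image_mset g (mset_set L)"
    using image_mset_subseteq_mono[OF mset_set_Un_subset[of "A - {p0}" L], of g] assms(1,4) by simp
  also have "image_mset g (mset_set (A - {p0})) = image_mset g (mset_set A) - {#g p0#}"
    using assms(1,2) by (simp add: mset_set_Diff image_mset_Diff)
  also have "image_mset g (mset_set A) - {#g p0#} + image_mset g (mset_set L) \<subseteq># lower K m (g p0)"
    unfolding lower_def using assms
    by (intro subset_mset.add_mono diff_subset_mset_mono subset_lower) auto
  finally show ?thesis .
qed

text \<open>One of at most \<open>2 ^ N\<close> subfamilies is dependent with probability at least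
  \<open>c / 2 ^ N\<close>. An index set \<open>S\<close> of largest size in it is properly
  contained in no other, so the sum of its forms on \<open>S\<close> is popular, completed by the
  remaining forms.\<close>

lemma irregular_popular:
  fixes c :: real
  assumes J: "finite J" and A: "form_family n A" "\<And>p. p \<in> A \<Longrightarrow> fst p \<subseteq> J" "card A \<le> N" and c: "c \<ge> 0"
    and i: "i \<in> J" "c < prob n {j\<in>J. j < i} (dependent_at \<Lambda> A n i)"
  shows "\<exists>S f0 F. (S, f0) \<in> A \<and> finite F \<and> (\<forall>f\<in>F. (S, f) \<in> A \<and> f \<noteq> f0) \<and>
    popular n J \<Lambda> (c / 2 ^ N) S (\<lambda>u. f0 u + (\<Sum>f\<in>F. f u))"
proof -
  define Ai where "Ai = {p\<in>A. Max (fst p) = i}"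
  have fA: "finite A" using A(1) by (simp add: form_family_def)
  have Ai: "finite Ai" "card Ai \<le> N" using fA A(3) card_mono[of A Ai] by (auto simp: Ai_def)
  define Z where "Z B u \<longleftrightarrow> (\<exists>C\<subseteq>\<Lambda> i u. (\<Sum>p\<in>B. partial n i (snd p) u) = \<Sum>C)"
    for B :: "(nat set \<times> (tup \<Rightarrow> bit)) set" and u
  let ?K = "{j\<in>J. j < i}"
  have "\<exists>B\<in>Pow Ai - {{}}. c / 2 ^ N \<le> prob n ?K (Z B)"
  proof (rule ccontr)
    assume none: "\<not> ?thesis"
    have fP: "finite (Pow Ai - {{}})" using Ai by simp
    have "prob n ?K (dependent_at \<Lambda> A n i) \<le> mean n ?K (\<lambda>u. \<Sum>B\<in>Pow Ai - {{}}. of_bool (Z B u))"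
    proof (rule mean_mono)
      fix u
      show "of_bool (dependent_at \<Lambda> A n i u) \<le> (\<Sum>B\<in>Pow Ai - {{}}. of_bool (Z B u) :: real)"
      proof (cases "dependent_at \<Lambda> A n i u")
        case True
        then obtain B where B: "B \<in> Pow Ai - {{}}" "Z B u"
          unfolding dependent_at_def Ai_def[symmetric] Z_def by blast
        have "of_bool (Z B u) \<le> (\<Sum>B\<in>Pow Ai - {{}}. of_bool (Z B u) :: real)"
          using B(1) fP by (intro member_le_sum) auto
        then show ?thesis using B True by simp
      qed (simp add: sum_nonneg)
    qed
    also have "\<dots> = (\<Sum>B\<in>Pow Ai - {{}}. prob n ?K (Z B))" by (rule mean_sum)
    also have "\<dots> \<le> of_nat (card (Pow Ai - {{}})) * (c / 2 ^ N)"
      using none by (intro sum_bounded_above) (auto simp: not_le less_imp_le)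
    also have "\<dots> \<le> 2 ^ N * (c / 2 ^ N)"
    proof (intro mult_right_mono)
      have "card (Pow Ai - {{}}) \<le> card (Pow Ai)" using Ai by (intro card_mono) auto
      also have "\<dots> \<le> 2 ^ N" using Ai by (simp add: card_Pow)
      finally show "of_nat (card (Pow Ai - {{}})) \<le> (2 ^ N :: real)"
        by (metis of_nat_le_iff of_nat_numeral of_nat_power)
    qed (use c in simp)
    also have "\<dots> = c" by simp
    finally show False using i by simp
  qed
  then obtain B where B: "B \<subseteq> Ai" "B \<noteq> {}" and Zc: "c / 2 ^ N \<le> prob n ?K (Z B)" by auto
  have fB: "finite B" using B Ai finite_subset by blast
  have BA: "fst p \<subseteq> J" "finite (fst p)" "mlform n (fst p) (snd p)" "i \<in> fst p" "Max (fst p) = i" if "p \<in> B" for p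
  proof -
    have p: "p \<in> A" "Max (fst p) = i" using that B by (auto simp: Ai_def)
    then show "fst p \<subseteq> J" "finite (fst p)" "mlform n (fst p) (snd p)" "i \<in> fst p" "Max (fst p) = i"
      using A(1,2) Max_in[of "fst p"] unfolding form_family_def by blast+
  qed
  obtain p0 where p0: "p0 \<in> B" "\<And>q. q \<in> B \<Longrightarrow> card (fst q) \<le> card (fst p0)"
  proof -
    have "Max ((\<lambda>p. card (fst p)) ` B) \<in> (\<lambda>p. card (fst p)) ` B" using B(2) fB by (intro Max_in) auto
    then obtain p0 where p0: "p0 \<in> B" "Max ((\<lambda>p. card (fst p)) ` B) = card (fst p0)" by blast
    have "card (fst q) \<le> card (fst p0)" if "q \<in> B" for q
      unfolding p0(2)[symmetric] using fB that by (intro Max_ge) auto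
    then show ?thesis using p0(1) that by blast
  qed
  obtain S f0 where p0': "p0 = (S, f0)" by (cases p0)
  define F0 where "F0 = {f. (S, f) \<in> B}"
  have F0im: "F0 = snd ` {p\<in>B. fst p = S}" by (force simp: F0_def)
  have fF0: "finite F0" using fB by (simp add: F0im)
  define a where "a u = (\<Sum>f\<in>F0. f u)" for u :: tup
  have f0: "f0 \<in> F0" using p0 p0' by (simp add: F0_def)
  have mS: "Max S = i" using BA(5)[OF p0(1)] p0' by simp
  have fS: "finite S" using BA(2)[OF p0(1)] p0' by simp
  have ma: "mlform n S a" unfolding a_def
    using BA(3) by (intro mlform_sum) (fastforce simp: F0_def)
  define Bp where "Bp = insert (S, a) {p\<in>B. fst p \<noteq> S}"
  have "popular n J \<Lambda> (c / 2 ^ N) S a"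
    unfolding popular_def mS
  proof (intro conjI ma exI[of _ Bp] ballI impI)
    show "finite Bp" using fB by (simp add: Bp_def)
    show "(S, a) \<in> Bp" by (simp add: Bp_def)
    fix p assume p: "p \<in> Bp"
    show "mlform n (fst p) (snd p)" using p ma BA(3)[of p] by (auto simp: Bp_def)
    show "i \<in> fst p" using p BA(4)[of p] BA(4)[OF p0(1)] p0' by (auto simp: Bp_def)
    show "p = (S, a)" if sub: "S \<subseteq> fst p"
    proof (rule ccontr)
      assume "p \<noteq> (S, a)"
      then have pB: "p \<in> B" "fst p \<noteq> S" using p by (auto simp: Bp_def)
      then have "card S < card (fst p)" using sub BA(2)[of p] by (intro psubset_card_mono) auto
      then show False using p0(2)[OF pB(1)] p0' by simp
    qed
  next
    have "(\<Sum>p\<in>Bp. partial n i (snd p) u) = (\<Sum>p\<in>B. partial n i (snd p) u)" for u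
    proof -
      have "(\<Sum>p\<in>{p\<in>B. fst p = S}. partial n i (snd p) u) = partial n i a u"
      proof -
        have "partial n i a u = (\<Sum>f\<in>F0. partial n i f u)" unfolding a_def by (rule partial_sum)
        also have "\<dots> = (\<Sum>p\<in>{p\<in>B. fst p = S}. partial n i (snd p) u)"
          unfolding F0im by (subst sum.reindex) (auto simp: inj_on_def)
        finally show ?thesis by simp
      qed
      moreover have "(\<Sum>p\<in>B. partial n i (snd p) u) =
        (\<Sum>p\<in>{p\<in>B. fst p = S}. partial n i (snd p) u) + (\<Sum>p\<in>{p\<in>B. fst p \<noteq> S}. partial n i (snd p) u)"
        by (subst sum.union_disjoint[symmetric]) (use fB in \<open>auto intro: sum.cong\<close>)
      moreover have "(\<Sum>p\<in>Bp. partial n i (snd p) u) =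
        partial n i a u + (\<Sum>p\<in>{p\<in>B. fst p \<noteq> S}. partial n i (snd p) u)"
        unfolding Bp_def using fB by (subst sum.insert) auto
      ultimately show ?thesis by (simp only:)
    qed
    then show "c / 2 ^ N \<le> prob n ?K (\<lambda>u. \<exists>C\<subseteq>\<Lambda> i u. (\<Sum>p\<in>Bp. partial n i (snd p) u) = \<Sum>C)"
      using Zc unfolding Z_def by (simp only:)
  qed
  moreover have "a = (\<lambda>u. f0 u + (\<Sum>f\<in>F0 - {f0}. f u))"
    using f0 fF0 by (simp add: a_def fun_eq_iff sum.remove)
  moreover have "\<forall>f\<in>F0 - {f0}. (S, f) \<in> A \<and> f \<noteq> f0" "(S, f0) \<in> A"
    using B p0 p0' by (auto simp: F0_def Ai_def)
  moreover have "finite (F0 - {f0})" using fF0 by simp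
  ultimately show ?thesis by (intro exI[of _ S] exI[of _ f0] exI[of _ "F0 - {f0}"]) simp
qed

text \<open>If a product remained, exposure would provide a zero of the tree at which precisely the
  forms of one inclusion-minimal product are 1. All other products vanish there, so \<open>h\<close>
  would be 1.\<close>

lemma regular_trivial:
  fixes c :: real
  assumes J: "finite J" and \<Lambda>: "ctree n J k \<Lambda>" and A: "form_family n A" "\<And>p. p \<in> A \<Longrightarrow> fst p \<subseteq> J" "card A \<le> N"
    and c: "c \<ge> 0" "card J * c < ((1/2) ^ (k + N)) ^ card J"
    and reg: "\<And>i. i \<in> J \<Longrightarrow> prob n {j\<in>J. j < i} (dependent_at \<Lambda> A n i) \<le> c"
    and h: "h \<in> prod_span J A" "\<And>u. u \<in> tree_zeros n J \<Lambda> \<Longrightarrow> h u = 0"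
  shows "h = (\<lambda>u. 0)"
proof -
  have fA: "finite A" using A(1) by (simp add: form_family_def)
  obtain \<C> where \<C>: "\<C> \<subseteq> {B. B \<subseteq> A \<and> partitions B J}" "h = (\<lambda>u. \<Sum>B\<in>\<C>. fam_prod B u)"
    using prod_span_explicit[OF h(1) fA] by blast
  have CA: "\<C> \<subseteq> Pow A" using \<C>(1) by auto
  then have fC: "finite \<C>" using fA finite_subset by blast
  have "\<C> = {}"
  proof (rule ccontr)
    assume "\<C> \<noteq> {}"
    then obtain B where B: "B \<in> \<C>" "\<And>B'. B' \<in> \<C> \<Longrightarrow> B' \<subseteq> B \<Longrightarrow> B = B'"
      using finite_has_minimal[OF fC] by blast
    define t where "t p = (of_bool (p \<in> B) :: bit)" for p
    have "((1/2) ^ (k + N)) ^ card J - card J * c \<le> prob n J (\<lambda>u. u \<in> tree_zeros n J \<Lambda> \<and> (\<forall>p\<in>A. snd p u = t p))"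
    proof (rule expose[OF J \<Lambda> fA A(3) _ c(1) reg])
      fix S f assume "(S, f) \<in> A"
      then show "S \<subseteq> J \<and> S \<noteq> {} \<and> mlform n S f" using A(1,2) unfolding form_family_def by fastforce
    qed
    then have "0 < prob n J (\<lambda>u. u \<in> tree_zeros n J \<Lambda> \<and> (\<forall>p\<in>A. snd p u = t p))" using c(2) by simp
    then obtain u where "(0::real) < of_bool (u \<in> tree_zeros n J \<Lambda> \<and> (\<forall>p\<in>A. snd p u = t p))"
      using mean_pos_ex by blast
    then have u: "u \<in> tree_zeros n J \<Lambda>" "\<And>p. p \<in> A \<Longrightarrow> snd p u = t p" by (auto simp: of_bool_def split: if_splits)
    have "fam_prod B' u = of_bool (B' = B)" if "B' \<in> \<C>" for B'
    proof (cases "B' \<subseteq> B")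
      case True
      then have "B' = B" using B(2)[OF that] by simp
      moreover have "fam_prod B u = (\<Prod>p\<in>B. 1)"
        unfolding fam_prod_def
      proof (rule prod.cong[OF refl])
        fix p assume "p \<in> B"
        moreover from this have "p \<in> A" using B(1) CA by blast
        ultimately show "snd p u = 1" using u(2)[of p] by (simp add: t_def)
      qed
      ultimately show ?thesis by simp
    next
      case False
      then obtain p where p: "p \<in> B'" "p \<notin> B" by blast
      have "B' \<subseteq> A" using CA that by auto
      then have "snd p u = 0" "finite B'" using u(2)[of p] p fA finite_subset by (auto simp: t_def)
      then have "fam_prod B' u = 0" unfolding fam_prod_def using p(1) by (intro prod_zero) auto
      then show ?thesis using False by auto
    qed
    then have "h u = (\<Sum>B'\<in>\<C>. of_bool (B' = B))" unfolding \<C>(2) by (intro sum.cong) auto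
    also have "\<dots> = 1" using B(1) fC by (simp add: of_bool_def sum.delta)
    finally show False using h(2)[OF u(1)] by simp
  qed
  then show ?thesis using \<C>(2) by simp
qed

text \<open>Induction on the multiset of degrees. If dependencies are rare for the extended tree, on
  whose zeros \<open>w\<close> vanishes as well, then \<open>regular_trivial\<close> gives
  \<open>r = w\<close>. Otherwise a combination of forms in \<open>A\<close> is popular, hence a
  subset sum of the fixed set up to low rank, and trading one of its forms lowers the
  multiset.\<close>

lemma absorbs:
  assumes FT: "\<And>d'. d' < d \<Longrightarrow> zeros_structured d'"
  shows "absorbs d m"
proof (induction m rule: wfp_induct_rule[OF wfp_less_multiset, case_names wfp less])
  case wfp
  show ?case by simp
next
  case (less m)
  show ?case unfolding absorbs_def
  proof (rule allI)
    fix k :: nat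
    define N where "N = size m"
    \<comment> \<open>The width of the tree extended by the gradients of the members of
      \<open>V\<close>.\<close>
    define k' where "k' = k + 2 ^ d * k"
    define q where "q = ((1/2::real) ^ (k' + N)) ^ d"
    \<comment> \<open>Chosen for \<open>d * c < q\<close>, the condition of
      \<open>regular_trivial\<close>; the summand 1 covers \<open>d = 0\<close>.\<close>
    define c where "c = q / (2 * (d + 1))"
    \<comment> \<open>The popularity that \<open>irregular_popular\<close> guarantees for families
      of at most \<open>N\<close> forms.\<close>
    define c0 where "c0 = c / 2 ^ N"
    have q: "q > 0" by (simp add: q_def)
    then have c: "c > 0" by (simp add: c_def)
    then have c0: "c0 > 0" by (simp add: c0_def)
    have dc: "d * c < q"
    proof -
      have "d * c = q * (d / (2 * (d + 1)))" by (simp add: c_def)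
      also have "\<dots> < q * 1" using q by (intro mult_strict_left_mono) auto
      finally show ?thesis by simp
    qed
    obtain N1 K1 where NK: "\<forall>n J \<Lambda> S Q. finite J \<and> ctree n J k' \<Lambda> \<and> S \<subseteq> J \<and> S \<noteq> {} \<and> card S \<le> d \<and> finite Q \<and> card Q = N1 \<and>
      (\<forall>a\<in>Q. popular n J \<Lambda> c0 S a) \<longrightarrow> (\<exists>Q'\<subseteq>Q. Q' \<noteq> {} \<and> low_rank n K1 S (\<lambda>u. \<Sum>a\<in>Q'. a u))"
    proof -
      have "\<exists>N K. \<forall>n J \<Lambda> S Q. finite J \<and> ctree n J k' \<Lambda> \<and> S \<subseteq> J \<and> S \<noteq> {} \<and> card S \<le> d \<and> finite Q \<and> card Q = N \<and>
        (\<forall>a\<in>Q. popular n J \<Lambda> c0 S a) \<longrightarrow> (\<exists>Q'\<subseteq>Q. Q' \<noteq> {} \<and> low_rank n K S (\<lambda>u. \<Sum>a\<in>Q'. a u))"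
        by (rule popular_dependent[OF FT c0])
      then show ?thesis by (elim exE) (rule that)
    qed
    \<comment> \<open>Each \<open>V I\<close> gains at most \<open>N1\<close> exchange
      forms.\<close>
    define k1 where "k1 = k + N1"
    have "\<forall>t. \<exists>K. t \<in># m \<longrightarrow> (\<forall>n J \<Lambda> V. finite J \<and> card J = d \<and> ctree n J k1 \<Lambda> \<and> bounded_forms n k1 V \<longrightarrow>
      (\<exists>V'. absorbed n J \<Lambda> V (lower K1 m t) K V'))"
      using less.IH[OF lower_less] unfolding absorbs_def by blast
    then obtain K2 where K2: "\<forall>t. t \<in># m \<longrightarrow> (\<forall>n J \<Lambda> V. finite J \<and> card J = d \<and> ctree n J k1 \<Lambda> \<and> bounded_forms n k1 V \<longrightarrow>
      (\<exists>V'. absorbed n J \<Lambda> V (lower K1 m t) (K2 t) V'))"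
    by (rule choice[THEN exE])
    define K where "K = k1 + (\<Sum>t\<in>set_mset m. K2 t)"
    show "\<exists>K. \<forall>n J \<Lambda> V. finite J \<and> card J = d \<and> ctree n J k \<Lambda> \<and> bounded_forms n k V \<longrightarrow>
      (\<exists>V'. absorbed n J \<Lambda> V m K V')"
    proof (rule exI[of _ K], intro allI impI, elim conjE)
      fix n J \<Lambda> V
      assume J: "finite J" "card J = d" and \<Lambda>: "ctree n J k \<Lambda>" and V: "bounded_forms n k V"
      \<comment> \<open>The extended tree only serves to test for dependencies; the induction
        hypothesis is applied to \<Lambda> itself.\<close>
      define \<Lambda>' where "\<Lambda>' = extend_tree n J \<Lambda> V"
      have \<Lambda>': "ctree n J k' \<Lambda>'" using extend_tree_ctree[OF J(1) \<Lambda> V] J(2) by (simp add: \<Lambda>'_def k'_def)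
      have "\<forall>S. \<exists>Q. finite Q \<and> card Q \<le> N1 \<and> (\<forall>a\<in>Q. mlform n S a) \<and>
        (S \<subseteq> J \<and> S \<noteq> {} \<longrightarrow> (\<forall>a. popular n J \<Lambda>' c0 S a \<longrightarrow> (\<exists>R\<subseteq>Q. low_rank n K1 S (\<lambda>u. a u + (\<Sum>v\<in>R. v u)))))"
      proof
        fix S
        show "\<exists>Q. finite Q \<and> card Q \<le> N1 \<and> (\<forall>a\<in>Q. mlform n S a) \<and>
        (S \<subseteq> J \<and> S \<noteq> {} \<longrightarrow> (\<forall>a. popular n J \<Lambda>' c0 S a \<longrightarrow> (\<exists>R\<subseteq>Q. low_rank n K1 S (\<lambda>u. a u + (\<Sum>v\<in>R. v u)))))"
        proof (cases "S \<subseteq> J \<and> S \<noteq> {}")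
          case True
          have "card S \<le> d" using True J card_mono[of J S] by auto
          then have "\<exists>Q'\<subseteq>Q. Q' \<noteq> {} \<and> low_rank n K1 S (\<lambda>u. \<Sum>a\<in>Q'. a u)"
            if "finite Q" "card Q = N1" "\<forall>a\<in>Q. popular n J \<Lambda>' c0 S a" for Q
            using NK[rule_format, of J n \<Lambda>' S Q] J \<Lambda>' True that by simp
          then have "\<exists>Q. finite Q \<and> card Q \<le> N1 \<and> (\<forall>a\<in>Q. mlform n S a) \<and>
            (\<forall>a. popular n J \<Lambda>' c0 S a \<longrightarrow> (\<exists>R\<subseteq>Q. low_rank n K1 S (\<lambda>u. a u + (\<Sum>v\<in>R. v u))))"
            by (rule popular_basis)
          then show ?thesis using True by (simp only: True simp_thms)
        next
          case False
          then show ?thesis by (intro exI[of _ "{}"]) auto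
        qed
      qed
      then obtain Qs where Qs: "\<forall>S. finite (Qs S) \<and> card (Qs S) \<le> N1 \<and> (\<forall>a\<in>Qs S. mlform n S a) \<and>
        (S \<subseteq> J \<and> S \<noteq> {} \<longrightarrow> (\<forall>a. popular n J \<Lambda>' c0 S a \<longrightarrow> (\<exists>R\<subseteq>Qs S. low_rank n K1 S (\<lambda>u. a u + (\<Sum>v\<in>R. v u)))))"
    by (rule choice[THEN exE])
      define V1 where "V1 I = V I \<union> Qs I" for I
      have V1: "bounded_forms n k1 V1"
        unfolding bounded_forms_def
      proof (intro allI conjI)
        fix I
        show "finite (V1 I)" using V Qs by (simp add: V1_def bounded_forms_def)
        have "card (V1 I) \<le> card (V I) + card (Qs I)" unfolding V1_def by (rule card_Un_le)
        also have "\<dots> \<le> k1" using V Qs unfolding k1_def bounded_forms_def by (intro add_mono) auto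
        finally show "card (V1 I) \<le> k1" .
        show "\<forall>f\<in>V1 I. mlform n I f" using V Qs unfolding V1_def bounded_forms_def by blast
      qed
      have \<Lambda>1: "ctree n J k1 \<Lambda>" using \<Lambda> by (rule ctree_mono) (simp add: k1_def)
      have "\<forall>t. \<exists>V'. t \<in># m \<longrightarrow> absorbed n J \<Lambda> V1 (lower K1 m t) (K2 t) V'"
      proof
        fix t
        show "\<exists>V'. t \<in># m \<longrightarrow> absorbed n J \<Lambda> V1 (lower K1 m t) (K2 t) V'"
        proof (cases "t \<in># m")
          case True
          have "finite J \<and> card J = d \<and> ctree n J k1 \<Lambda> \<and> bounded_forms n k1 V1" using J \<Lambda>1 V1 by simp
          with K2[THEN spec, THEN mp, OF True, THEN spec, of n, THEN spec, of J, THEN spec, of \<Lambda>, THEN spec, of V1]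
          have "\<exists>V'. absorbed n J \<Lambda> V1 (lower K1 m t) (K2 t) V'" by (rule mp)
          then show ?thesis by (simp only: True simp_thms)
        qed simp
      qed
      then obtain V2 where V2: "\<forall>t. t \<in># m \<longrightarrow> absorbed n J \<Lambda> V1 (lower K1 m t) (K2 t) (V2 t)"
    by (rule choice[THEN exE])
      \<comment> \<open>The degree of the form to be traded depends on \<open>r\<close>, so every
        degree in \<open>m\<close> is provided for.\<close>
      define V' where "V' I = V1 I \<union> (\<Union>t\<in>set_mset m. V2 t I)" for I
      have V2ok: "finite (V2 t I)" "card (V2 t I) \<le> K2 t" "\<forall>f\<in>V2 t I. mlform n I f" if "t \<in># m" for t I
        using V2 that unfolding absorbed_def bounded_forms_def by blast+
      have V': "bounded_forms n K V'"
        unfolding bounded_forms_def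
      proof (intro allI conjI)
        fix I
        show "finite (V' I)" using V1 V2ok by (simp add: V'_def bounded_forms_def)
        have "card (V' I) \<le> card (V1 I) + card (\<Union>t\<in>set_mset m. V2 t I)" unfolding V'_def by (rule card_Un_le)
        also have "card (\<Union>t\<in>set_mset m. V2 t I) \<le> (\<Sum>t\<in>set_mset m. card (V2 t I))" by (rule card_UN_le) simp
        also have "\<dots> \<le> (\<Sum>t\<in>set_mset m. K2 t)" using V2ok by (intro sum_mono) auto
        also have "card (V1 I) \<le> k1" using V1 by (simp add: bounded_forms_def)
        finally show "card (V' I) \<le> K" by (simp add: K_def)
        show "\<forall>f\<in>V' I. mlform n I f" using V1 V2ok unfolding V'_def bounded_forms_def by blast
      qed
      have finV': "finite (V' I)" for I using V' by (simp add: bounded_forms_def)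
      have VV': "structured n J V \<subseteq> structured n J V'" by (rule structured_mono[OF _ finV']) (auto simp: V'_def V1_def)
      have V2V': "structured n J (V2 t) \<subseteq> structured n J V'" if "t \<in># m" for t
        by (rule structured_mono[OF _ finV']) (use that in \<open>auto simp: V'_def\<close>)
      show "\<exists>V'. absorbed n J \<Lambda> V m K V'"
        unfolding absorbed_def
      proof (rule exI[of _ V'], intro conjI V' allI impI, elim conjE)
        fix r w A
        assume r: "mlform n J r" "\<forall>u\<in>tree_zeros n J \<Lambda>. r u = 0" and w: "w \<in> structured n J V"
          and A: "form_family n A" "\<forall>p\<in>A. fst p \<subseteq> J" "image_mset (\<lambda>p. card (fst p)) (mset_set A) \<subseteq># m"
          and rw: "(\<lambda>u. r u + w u) \<in> prod_span J A"
        have fA: "finite A" using A(1) by (simp add: form_family_def)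
        have cA: "card A \<le> N" using size_mset_mono[OF A(3)] by (simp add: N_def)
        show "r \<in> structured n J V'"
        proof (cases "\<forall>i\<in>J. prob n {j\<in>J. j < i} (dependent_at \<Lambda>' A n i) \<le> c")
          case True
          have "(\<lambda>u. r u + w u) = (\<lambda>u. 0)"
          proof (rule regular_trivial[OF J(1) \<Lambda>' A(1) _ cA _ _ _ rw])
            show "card J * c < ((1/2) ^ (k' + N)) ^ card J" using dc by (simp add: J q_def)
            fix u assume u: "u \<in> tree_zeros n J \<Lambda>'"
            have "w u = 0"
              using extend_tree_tree_zeros(2)[OF J(1) V u[unfolded \<Lambda>'_def]] by (intro structured_vanish[OF w]) blast
            moreover have "r u = 0" using r(2) extend_tree_tree_zeros(1)[OF J(1) V u[unfolded \<Lambda>'_def]] by blast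
            ultimately show "r u + w u = 0" by simp
          qed (use A c True in auto)
          then have "r = w" by (simp add: fun_eq_iff bit_add_eq_0_iff)
          then show ?thesis using w VV' by blast
        next
          case False
          then obtain i where i: "i \<in> J" "c < prob n {j\<in>J. j < i} (dependent_at \<Lambda>' A n i)" by (auto simp: not_le)
          have "\<exists>S f0 F. (S, f0) \<in> A \<and> finite F \<and> (\<forall>f\<in>F. (S, f) \<in> A \<and> f \<noteq> f0) \<and>
            popular n J \<Lambda>' c0 S (\<lambda>u. f0 u + (\<Sum>f\<in>F. f u))"
            unfolding c0_def using A(2) c by (intro irregular_popular[OF J(1) A(1) _ cA _ i]) auto
          then obtain S f0 F where S: "(S, f0) \<in> A" "finite F" "\<And>f. f \<in> F \<Longrightarrow> (S, f) \<in> A \<and> f \<noteq> f0"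
            and pS: "popular n J \<Lambda>' c0 S (\<lambda>u. f0 u + (\<Sum>f\<in>F. f u))" by blast
          have SJ: "S \<subseteq> J" "S \<noteq> {}" using A S(1) unfolding form_family_def by fastforce+
          then have QS: "\<forall>a. popular n J \<Lambda>' c0 S a \<longrightarrow> (\<exists>R\<subseteq>Qs S. low_rank n K1 S (\<lambda>u. a u + (\<Sum>v\<in>R. v u)))"
            by (intro Qs[THEN spec, THEN conjunct2, THEN conjunct2, THEN conjunct2, THEN mp] conjI)
          obtain R where R: "R \<subseteq> Qs S" "low_rank n K1 S (\<lambda>u. f0 u + (\<Sum>f\<in>F. f u) + (\<Sum>v\<in>R. v u))"
            using QS[THEN spec, THEN mp, OF pS] by (elim exE conjE) (rule that)
          define l where "l u = f0 u + (\<Sum>f\<in>F. f u) + (\<Sum>v\<in>R. v u)" for u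
          obtain L where L: "form_family n L" "card L \<le> K1" "\<forall>p\<in>L. fst p \<subset> S" "l \<in> prod_span S L"
            using R(2) unfolding low_rank_def l_def by blast
          have f0: "f0 = (\<lambda>u. (\<Sum>f\<in>F. f u) + (\<Sum>v\<in>R. v u) + l u)"
          proof
            fix u
            have "a = b + e + (a + b + e)" for a b e :: bit by (cases a; cases b; cases e) simp_all
            then show "f0 u = (\<Sum>f\<in>F. f u) + (\<Sum>v\<in>R. v u) + l u" unfolding l_def .
          qed
          have "\<exists>w'\<in>structured n J V1. (\<lambda>u. (r u + w u) + w' u) \<in> prod_span J (A - {(S, f0)} \<union> L)"
          proof (rule prod_span_replace[OF J(1) A(1) S(1) SJ(1) f0 S(3) _ _ L(4,1) _ rw])
            show "R \<subseteq> V1 S" using R(1) by (auto simp: V1_def)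
            show "finite (V1 S)" using V1 by (simp add: bounded_forms_def)
            show "fst p \<subset> S" if "p \<in> L" for p using L(3) that by blast
          qed
          then obtain w' where w': "w' \<in> structured n J V1" "(\<lambda>u. (r u + w u) + w' u) \<in> prod_span J (A - {(S, f0)} \<union> L)" by blast
          have "w \<in> structured n J V1" using w structured_mono[of V V1 n J] V1 by (auto simp: V1_def bounded_forms_def)
          then have w1: "(\<lambda>u. w u + w' u) \<in> structured n J V1" using w'(1) by (rule structured_add)
          have "card S \<in> (\<lambda>p. card (fst p)) ` A" using S(1) by (intro image_eqI[of _ _ "(S, f0)"]) auto
          then have t: "card S \<in># m" using fA by (intro mset_subset_eqD[OF A(3)]) simp
          have "form_family n (A - {(S, f0)} \<union> L)" using A(1) L(1) by (auto simp: form_family_def)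
          moreover have "\<forall>p\<in>A - {(S, f0)} \<union> L. fst p \<subseteq> J" using A(2) L(3) SJ(1) by blast
          moreover have "image_mset (\<lambda>p. card (fst p)) (mset_set (A - {(S, f0)} \<union> L)) \<subseteq># lower K1 m (card S)"
          proof -
            have fS: "finite S" using SJ J finite_subset by blast
            have "image_mset (\<lambda>p. card (fst p)) (mset_set (A - {(S, f0)} \<union> L)) \<subseteq># lower K1 m (card (fst (S, f0)))"
              using L fS by (intro replace_subset_lower[OF fA S(1) A(3)]) (auto simp: form_family_def intro: psubset_card_mono)
            then show ?thesis by simp
          qed
          moreover have "(\<lambda>u. r u + (w u + w' u)) \<in> prod_span J (A - {(S, f0)} \<union> L)" using w'(2) by (simp only: add.assoc)
          ultimately have "mlform n J r \<and> (\<forall>u\<in>tree_zeros n J \<Lambda>. r u = 0) \<and> (\<lambda>u. w u + w' u) \<in> structured n J V1 \<and>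
            form_family n (A - {(S, f0)} \<union> L) \<and> (\<forall>p\<in>A - {(S, f0)} \<union> L. fst p \<subseteq> J) \<and>
            image_mset (\<lambda>p. card (fst p)) (mset_set (A - {(S, f0)} \<union> L)) \<subseteq># lower K1 m (card S) \<and>
            (\<lambda>u. r u + (w u + w' u)) \<in> prod_span J (A - {(S, f0)} \<union> L)"
            using r w1 by (intro conjI)
          with V2[unfolded absorbed_def, THEN spec, THEN mp, OF t, THEN conjunct2, THEN spec, of r, THEN spec, of "\<lambda>u. w u + w' u",
            THEN spec, of "A - {(S, f0)} \<union> L"]
          have "r \<in> structured n J (V2 (card S))" by (rule mp)
          then show ?thesis using V2V'[OF t] by blast
        qed
      qed
    qed
  qed
qed

text \<open>The exchange starts with \<open>r\<close> as the only auxiliary form, of degree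
  \<open>d\<close>, and with nothing structured yet.\<close>

lemma zeros_structured: "zeros_structured d"
proof (induction d rule: less_induct)
  case (less d)
  have ab: "absorbs d {#d#}" using less.IH by (rule absorbs)
  show ?case unfolding zeros_structured_def
  proof
    fix k
    obtain K where K: "\<forall>n J \<Lambda> V. finite J \<and> card J = d \<and> ctree n J k \<Lambda> \<and> bounded_forms n k V \<longrightarrow>
      (\<exists>V'. absorbed n J \<Lambda> V {#d#} K V')"
      using ab unfolding absorbs_def by (elim allE[of _ k] exE) (rule that)
    show "\<exists>K. \<forall>n J \<Lambda>. finite J \<and> card J = d \<and> ctree n J k \<Lambda> \<longrightarrow>
      (\<exists>V. bounded_forms n K V \<and> (\<forall>r. mlform n J r \<and> (\<forall>u\<in>tree_zeros n J \<Lambda>. r u = 0) \<longrightarrow> r \<in> structured n J V))"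
    proof (rule exI[of _ K], intro allI impI, elim conjE)
      fix n J \<Lambda> assume J: "finite J" "card J = d" and \<Lambda>: "ctree n J k \<Lambda>"
      have "bounded_forms n k (\<lambda>_. {})" by (simp add: bounded_forms_def)
      with K J \<Lambda> obtain V' where "absorbed n J \<Lambda> (\<lambda>_. {}) {#d#} K V'" by blast
      note V' = this[unfolded absorbed_def, THEN conjunct1] this[unfolded absorbed_def, THEN conjunct2]
      show "\<exists>V. bounded_forms n K V \<and> (\<forall>r. mlform n J r \<and> (\<forall>u\<in>tree_zeros n J \<Lambda>. r u = 0) \<longrightarrow> r \<in> structured n J V)"
      proof (rule exI[of _ V'], intro conjI V'(1) allI impI, elim conjE)
        fix r assume r: "mlform n J r" "\<forall>u\<in>tree_zeros n J \<Lambda>. r u = 0"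
        show "r \<in> structured n J V'"
        \<comment> \<open>Families exclude the empty index set. In that case every tuple is a zero
          of the tree.\<close>
        proof (cases "J = {}")
          case True
          then have "r = (\<lambda>u. 0)" using r(2) by (auto simp: tree_zeros_def fun_eq_iff)
          then show ?thesis using structured_0 by simp
        next
          case False
          have "fam_prod {(J, r)} \<in> prod_span J {(J, r)}" by (rule prod_span_base) (auto simp: partitions_def)
          moreover have "fam_prod {(J, r)} = (\<lambda>u. r u + 0)" by (simp add: fam_prod_def fun_eq_iff)
          ultimately have "(\<lambda>u. r u + 0) \<in> prod_span J {(J, r)}" by (simp only:)
          moreover have "form_family n {(J, r)}" using r J False by (simp add: form_family_def)
          moreover have "image_mset (\<lambda>p. card (fst p)) (mset_set {(J, r)}) \<subseteq># {#d#}" using J by simp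
          ultimately show ?thesis using V'(2)[rule_format, of r "\<lambda>u. 0" "{(J, r)}"] r structured_0[of n J "\<lambda>_. {}"] by simp
        qed
      qed
    qed
  qed
qed

subsection \<open>Tensors\<close>

definition confines :: "(nat \<Rightarrow> nat) \<Rightarrow> nat set \<Rightarrow> nat \<Rightarrow> real \<Rightarrow> (tup \<Rightarrow> real) \<Rightarrow> (nat set \<Rightarrow> (tup \<Rightarrow> bit) set) \<Rightarrow> bool"
  where "confines n J K \<beta> \<nu> V \<longleftrightarrow> bounded_forms n K V \<and> (\<forall>r. mlform n J r \<and>
    mean n J (\<lambda>u. \<nu> u * of_bool (r u = 1)) \<le> \<beta> * mean n J \<nu> \<longrightarrow> r \<in> structured n J V)"

lemma dense_confines:
  "\<exists>\<beta>>0. \<forall>\<delta>>0. \<exists>K. \<forall>n J \<nu>. finite J \<and> card J = d \<and>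
    (\<forall>u\<in>tuples n J. 0 \<le> \<nu> u \<and> \<nu> u \<le> 1) \<and> \<delta> \<le> mean n J \<nu> \<longrightarrow> (\<exists>V. confines n J K \<beta> \<nu> V)"
proof -
  obtain \<beta> where \<beta>: "\<beta> > 0" and T: "\<forall>\<delta>>0. \<exists>k. \<forall>n J \<nu>. finite J \<and> card J = d \<and>
    (\<forall>u\<in>tuples n J. 0 \<le> \<nu> u \<and> \<nu> u \<le> 1) \<and> \<delta> \<le> mean n J \<nu> \<longrightarrow> (\<exists>\<Lambda>. captures n J k \<beta> \<nu> \<Lambda>)"
    using tree_for_dense[of d] unfolding tree_for_dense_def by blast
  show ?thesis
  proof (rule exI[of _ \<beta>], intro conjI \<beta> allI impI)
    fix \<delta> :: real assume "\<delta> > 0"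
    then obtain k where k: "\<forall>n J \<nu>. finite J \<and> card J = d \<and>
      (\<forall>u\<in>tuples n J. 0 \<le> \<nu> u \<and> \<nu> u \<le> 1) \<and> \<delta> \<le> mean n J \<nu> \<longrightarrow> (\<exists>\<Lambda>. captures n J k \<beta> \<nu> \<Lambda>)"
      using T by blast
    obtain K where K: "\<forall>n J \<Lambda>. finite J \<and> card J = d \<and> ctree n J k \<Lambda> \<longrightarrow>
      (\<exists>V. bounded_forms n K V \<and> (\<forall>r. mlform n J r \<and> (\<forall>u\<in>tree_zeros n J \<Lambda>. r u = 0) \<longrightarrow> r \<in> structured n J V))"
      using zeros_structured[of d] unfolding zeros_structured_def by (elim allE[of _ k] exE) (rule that)
    have "\<exists>V. confines n J K \<beta> \<nu> V"
      if a: "finite J \<and> card J = d \<and> (\<forall>u\<in>tuples n J. 0 \<le> \<nu> u \<and> \<nu> u \<le> 1) \<and> \<delta> \<le> mean n J \<nu>" for n J \<nu>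
    proof -
      obtain \<Lambda> where \<Lambda>: "captures n J k \<beta> \<nu> \<Lambda>" using k a by blast
      then have "finite J \<and> card J = d \<and> ctree n J k \<Lambda>" using a by (simp add: captures_def)
      then obtain V where V: "bounded_forms n K V" "\<forall>r. mlform n J r \<and> (\<forall>u\<in>tree_zeros n J \<Lambda>. r u = 0) \<longrightarrow> r \<in> structured n J V"
        using K by blast
      show ?thesis unfolding confines_def
      proof (rule exI[of _ V], intro conjI V(1) allI impI)
        fix r assume r: "mlform n J r \<and> mean n J (\<lambda>u. \<nu> u * of_bool (r u = 1)) \<le> \<beta> * mean n J \<nu>"
        then have "\<forall>u\<in>tree_zeros n J \<Lambda>. r u = 0" using \<Lambda> unfolding captures_def by blast
        then show "r \<in> structured n J V" using V(2) r by blast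
      qed
    qed
    then show "\<exists>K. \<forall>n J \<nu>. finite J \<and> card J = d \<and>
      (\<forall>u\<in>tuples n J. 0 \<le> \<nu> u \<and> \<nu> u \<le> 1) \<and> \<delta> \<le> mean n J \<nu> \<longrightarrow> (\<exists>V. confines n J K \<beta> \<nu> V)"
      by (intro exI[of _ K] allI impI)
  qed
qed

lemma codim_kernel:
  assumes M: "finite M" and "finite E"
  shows "fun_vs.dim (vecs M) \<le> fun_vs.dim {x\<in>vecs M. \<forall>y\<in>E. dot M y x = 0} + card E"
  using assms(2)
proof (induction E rule: finite_induct)
  case (insert y E)
  define H where "H = {x\<in>vecs M. \<forall>y\<in>E. dot M y x = 0}"
  define H' where "H' = {x\<in>vecs M. \<forall>y\<in>insert y E. dot M y x = 0}"
  have H'H: "H' = {x\<in>H. dot M y x = 0}" by (auto simp: H_def H'_def)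
  obtain B where B: "B \<subseteq> H'" "fun_vs.independent B" "H' \<subseteq> fun_vs.span B" "card B = fun_vs.dim H'"
    using fun_vs.basis_exists by blast
  have "B \<subseteq> vecs M" using B(1) by (auto simp: H'_def)
  then have "finite B" using card_vecs(1)[OF M] finite_subset by blast
  have "fun_vs.dim H \<le> fun_vs.dim H' + 1"
  proof (cases "\<exists>x\<in>H. dot M y x = 1")
    case True
    then obtain x0 where x0: "x0 \<in> H" "dot M y x0 = 1" by blast
    have "H \<subseteq> fun_vs.span (insert x0 B)"
    proof
      fix x assume x: "x \<in> H"
      have sub: "H' \<subseteq> fun_vs.span (insert x0 B)"
        using B(3) fun_vs.span_mono[of B "insert x0 B"] by blast
      show "x \<in> fun_vs.span (insert x0 B)"
      proof (cases "dot M y x = 0")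
        case True
        then show ?thesis using x sub by (auto simp: H'H)
      next
        case False
        have "x + x0 \<in> H" using x x0 by (auto simp: H_def sp_add dot_add_right)
        moreover have "dot M y (x + x0) = 0" using False x0 by (simp add: dot_add_right)
        ultimately have "x + x0 \<in> fun_vs.span (insert x0 B)" using sub by (auto simp: H'H)
        moreover have "x0 \<in> fun_vs.span (insert x0 B)" by (rule fun_vs.span_base) simp
        ultimately have "x0 + (x + x0) \<in> fun_vs.span (insert x0 B)" by (rule fun_vs.span_add[rotated])
        moreover have "x0 + (x + x0) = x" by (metis add.commute bit_fun_add_self(2))
        ultimately show ?thesis by simp
      qed
    qed
    then have "fun_vs.dim H \<le> card (insert x0 B)" using \<open>finite B\<close> by (intro fun_vs.dim_le_card) auto
    also have "\<dots> \<le> card B + 1" using \<open>finite B\<close> by (simp add: card_insert_if)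
    finally show ?thesis using B(4) by simp
  next
    case False
    then have "H = H'" by (auto simp: H'H)
    then show ?thesis by simp
  qed
  then show ?case using insert by (simp add: H_def H'_def)
qed simp

section \<open>Tensors as coefficient arrays of forms, and annihilators\<close>

lemma tensor_space_vecs: "tensor_space n I = vecs (multi_idx n I)"
  by (simp add: tensor_space_def vecs_def)

lemma coord_space_vecs: "coord_space N = vecs {..<N}"
  by (simp add: coord_space_def vecs_def)

lemma multi_idx_finite: "finite I \<Longrightarrow> finite (multi_idx n I)"
  by (simp add: multi_idx_def finite_PiE)

text \<open>The value of a form at \<open>unit_tup m\<close> is its coefficient at the multi-index
  \<open>m\<close>.\<close>

definition unit_tup :: "(nat \<Rightarrow> nat) \<Rightarrow> tup"
  where "unit_tup m = (\<lambda>i. unit_vec (m i))"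

lemma pure_tensor_unit_tup:
  assumes "finite J" "m \<in> multi_idx n J"
  shows "pure_tensor n J (unit_tup m) = unit_vec m"
proof
  fix m'
  show "pure_tensor n J (unit_tup m) m' = unit_vec m m'"
  proof (cases "m' = m")
    case True
    then show ?thesis using assms by (simp add: pure_tensor_def unit_tup_def unit_vec_def)
  next
    case False
    have "(\<Prod>i\<in>J. unit_tup m i (m' i)) = 0" if "m' \<in> multi_idx n J"
    proof -
      have "\<exists>i\<in>J. m' i \<noteq> m i"
        using False that assms(2) unfolding multi_idx_def by (meson PiE_ext)
      then show ?thesis using assms(1) by (auto simp: unit_tup_def unit_vec_def prod_zero_iff)
    qed
    then show ?thesis using False by (simp add: pure_tensor_def unit_vec_def)
  qed
qed

text \<open>This turns a frequency of the Fourier transform into a multilinear form.\<close>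

lemma mlform_pure_tensor:
  assumes J: "finite J"
  shows "mlform n J (\<lambda>u. dot (multi_idx n J) r (pure_tensor n J u))"
  unfolding mlform_def
proof (intro conjI allI impI ballI)
  fix u v assume uv: "agree n J u v"
  have "pure_tensor n J u = pure_tensor n J v"
    using uv by (auto simp: pure_tensor_def agree_def multi_idx_def fun_eq_iff PiE_iff intro!: prod.cong)
  then show "dot (multi_idx n J) r (pure_tensor n J u) = dot (multi_idx n J) r (pure_tensor n J v)" by simp
next
  fix i and u :: tup and x y assume i: "i \<in> J"
  have "(\<Prod>j\<in>J. (u(i := z)) j (m j)) = z (m i) * (\<Prod>j\<in>J - {i}. u j (m j))" for z m
  proof -
    have "(\<Prod>j\<in>J. (u(i := z)) j (m j)) = (u(i := z)) i (m i) * (\<Prod>j\<in>J - {i}. (u(i := z)) j (m j))"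
      by (rule prod.remove[OF J i])
    also have "(\<Prod>j\<in>J - {i}. (u(i := z)) j (m j)) = (\<Prod>j\<in>J - {i}. u j (m j))" by (rule prod.cong) auto
    finally show ?thesis by simp
  qed
  then have "pure_tensor n J (u(i := x + y)) = pure_tensor n J (u(i := x)) + pure_tensor n J (u(i := y))"
    by (simp add: pure_tensor_def fun_eq_iff distrib_right del: fun_upd_apply)
  then show "dot (multi_idx n J) r (pure_tensor n J (u(i := x + y))) =
    dot (multi_idx n J) r (pure_tensor n J (u(i := x))) + dot (multi_idx n J) r (pure_tensor n J (u(i := y)))"
    by (simp only: dot_add_right)
qed

lemma sum_multi_idx_split:
  assumes J: "finite J" "I \<subseteq> J"
  shows "(\<Sum>m\<in>multi_idx n J. F (restrict m I) * G (restrict m (J - I))) =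
    (\<Sum>m\<in>multi_idx n I. F m) * (\<Sum>m\<in>multi_idx n (J - I). (G m :: bit))"
proof -
  let ?g = "\<lambda>p i. if i \<in> I then fst p i else snd p i"
  have "(\<Sum>m\<in>multi_idx n J. F (restrict m I) * G (restrict m (J - I))) =
    (\<Sum>p\<in>multi_idx n I \<times> multi_idx n (J - I). F (fst p) * G (snd p))"
  proof (rule sum.reindex_bij_witness[where j = "\<lambda>m. (restrict m I, restrict m (J - I))" and i = ?g])
    fix m assume m: "m \<in> multi_idx n J"
    show "?g (restrict m I, restrict m (J - I)) = m"
      using m J(2) by (auto simp: multi_idx_def fun_eq_iff PiE_iff extensional_def restrict_def)
    show "(restrict m I, restrict m (J - I)) \<in> multi_idx n I \<times> multi_idx n (J - I)"
      using m J(2) by (auto simp: multi_idx_def)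
  next
    fix p assume p: "p \<in> multi_idx n I \<times> multi_idx n (J - I)"
    show "?g p \<in> multi_idx n J"
      using p J(2) by (auto simp: multi_idx_def PiE_iff extensional_def)
    show "(restrict (?g p) I, restrict (?g p) (J - I)) = p"
      using p by (cases p) (auto simp: multi_idx_def PiE_iff extensional_def restrict_def fun_eq_iff)
  qed simp
  also have "\<dots> = (\<Sum>m\<in>multi_idx n I. \<Sum>m'\<in>multi_idx n (J - I). F m * G m')"
    by (simp add: sum.cartesian_product case_prod_unfold)
  finally show ?thesis by (simp add: sum_product)
qed

text \<open>The subspace \<open>H I\<close> of the simple set: one linear equation for the
  coefficient array of each member of \<open>V I\<close>.\<close>

definition annihilator :: "(nat \<Rightarrow> nat) \<Rightarrow> (nat set \<Rightarrow> (tup \<Rightarrow> bit) set) \<Rightarrow> nat set \<Rightarrow> ((nat \<Rightarrow> nat) \<Rightarrow> bit) set"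
  where "annihilator n V I = {x\<in>vecs (multi_idx n I). \<forall>y\<in>(\<lambda>f m. f (unit_tup m)) ` V I. dot (multi_idx n I) y x = 0}"

lemma annihilator_subspace: "fun_vs.subspace (annihilator n V I)"
  unfolding fun_vs.subspace_def
proof (intro conjI ballI allI)
  show "0 \<in> annihilator n V I" by (simp add: annihilator_def)
  show "x + y \<in> annihilator n V I" if "x \<in> annihilator n V I" "y \<in> annihilator n V I" for x y
    using that by (simp add: annihilator_def sp_add dot_add_right)
  show "fun_scale c x \<in> annihilator n V I" if "x \<in> annihilator n V I" for c x
  proof (cases "c = 0")
    case True
    then have "fun_scale c x = 0" by (simp add: fun_scale_def fun_eq_iff)
    then show ?thesis by (simp only:) (simp add: annihilator_def)
  next
    case False
    then have "fun_scale c x = x" by (simp add: fun_scale_def fun_eq_iff)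
    then show ?thesis using that by (simp only:)
  qed
qed

lemma dot_kernel_subspace: "fun_vs.subspace {x. dot M x y = 0}"
  unfolding fun_vs.subspace_def
proof (intro conjI ballI allI)
  show "fun_scale c x \<in> {x. dot M x y = 0}" if "x \<in> {x. dot M x y = 0}" for c x
    using that by (simp add: dot_def fun_scale_def mult.assoc flip: sum_distrib_left)
qed (auto simp: dot_add_left)

text \<open>Paired with the array of \<open>f\<close> times \<open>g\<close>, a product tensor gives
  a product of a sum over \<open>I\<close> and a sum over the complement; the first is 0. Linearity
  extends this to the span.\<close>

lemma annihilator_tensor:
  assumes J: "finite J" "I \<subseteq> J" and f: "f \<in> V I" "mlform n I f" and g: "mlform n (J - I) g"
    and t: "t \<in> tensor_subspaces n I (J - I) (annihilator n V I) (tensor_space n (J - I))"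
  shows "(\<Sum>m\<in>multi_idx n J. t m * (f (unit_tup m) * g (unit_tup m))) = 0"
proof -
  define \<phi> where "\<phi> m = f (unit_tup m) * g (unit_tup m)" for m
  have "{tensor_mult n I (J - I) x y |x y. x \<in> annihilator n V I \<and> y \<in> tensor_space n (J - I)} \<subseteq>
    {x. dot (multi_idx n J) x \<phi> = 0}"
  proof safe
    fix x y assume x: "x \<in> annihilator n V I"
    have IJ: "I \<union> (J - I) = J" using J by auto
    have "dot (multi_idx n J) (tensor_mult n I (J - I) x y) \<phi> =
      (\<Sum>m\<in>multi_idx n J. (x (restrict m I) * f (unit_tup (restrict m I))) *
        (y (restrict m (J - I)) * g (unit_tup (restrict m (J - I)))))"
      unfolding dot_def
    proof (rule sum.cong[OF refl])
      fix m assume m: "m \<in> multi_idx n J"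
      have "f (unit_tup m) = f (unit_tup (restrict m I))"
        by (rule mlform_agree[OF f(2)]) (simp add: agree_def unit_tup_def)
      moreover have "g (unit_tup m) = g (unit_tup (restrict m (J - I)))"
        by (rule mlform_agree[OF g]) (simp add: agree_def unit_tup_def)
      ultimately show "tensor_mult n I (J - I) x y m * \<phi> m =
        (x (restrict m I) * f (unit_tup (restrict m I))) * (y (restrict m (J - I)) * g (unit_tup (restrict m (J - I))))"
        using m by (simp only: tensor_mult_def IJ \<phi>_def) (simp add: mult_ac)
    qed
    also have "\<dots> = (\<Sum>m\<in>multi_idx n I. x m * f (unit_tup m)) *
        (\<Sum>m\<in>multi_idx n (J - I). y m * g (unit_tup m))"
      by (rule sum_multi_idx_split[OF J])
    also have "(\<Sum>m\<in>multi_idx n I. x m * f (unit_tup m)) = 0"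
      using x f(1) by (auto simp: annihilator_def dot_def mult.commute)
    finally show "dot (multi_idx n J) (tensor_mult n I (J - I) x y) \<phi> = 0" by simp
  qed
  then have "t \<in> {x. dot (multi_idx n J) x \<phi> = 0}"
    using t fun_vs.span_minimal[OF _ dot_kernel_subspace] unfolding tensor_subspaces_def by blast
  then show ?thesis by (simp add: dot_def \<phi>_def)
qed

lemma structured_annihilator:
  assumes J: "finite J" and V: "bounded_forms n K V"
    and r: "(\<lambda>u. dot (multi_idx n J) r (pure_tensor n J u)) \<in> structured n J V"
    and t: "\<And>I. I \<subseteq> J \<Longrightarrow> I \<noteq> {} \<Longrightarrow> t \<in> tensor_subspaces n I (J - I) (annihilator n V I) (tensor_space n (J - I))"
  shows "dot (multi_idx n J) t r = 0"
proof -
  obtain g where g: "\<forall>I f. mlform n (J - I) (g I f)"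
    "(\<lambda>u. dot (multi_idx n J) r (pure_tensor n J u)) = (\<lambda>u. \<Sum>I\<in>Pow J - {{}}. \<Sum>f\<in>V I. f u * g I f u)"
    using r unfolding structured_def by blast
  let ?M = "multi_idx n J"
  have rm: "r m = (\<Sum>I\<in>Pow J - {{}}. \<Sum>f\<in>V I. f (unit_tup m) * g I f (unit_tup m))" if m: "m \<in> ?M" for m
    using fun_cong[OF g(2), of "unit_tup m"] m J
    by (simp add: pure_tensor_unit_tup dot_commute[of _ r] dot_unit_vec multi_idx_finite)
  have "dot ?M t r = (\<Sum>m\<in>?M. \<Sum>I\<in>Pow J - {{}}. \<Sum>f\<in>V I. t m * (f (unit_tup m) * g I f (unit_tup m)))"
    unfolding dot_def by (intro sum.cong refl) (simp add: rm sum_distrib_left)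
  also have "\<dots> = (\<Sum>I\<in>Pow J - {{}}. \<Sum>f\<in>V I. \<Sum>m\<in>?M. t m * (f (unit_tup m) * g I f (unit_tup m)))"
    by (subst sum.swap, rule sum.cong[OF refl], rule sum.swap)
  also have "\<dots> = (\<Sum>I\<in>Pow J - {{}}. \<Sum>f\<in>V I. 0)"
  proof (intro sum.cong refl)
    fix I f assume I: "I \<in> Pow J - {{}}" and f: "f \<in> V I"
    have "mlform n I f" using V f by (simp add: bounded_forms_def)
    then show "(\<Sum>m\<in>?M. t m * (f (unit_tup m) * g I f (unit_tup m))) = 0"
      using I by (intro annihilator_tensor[where V = V and I = I] J f t g(1)[rule_format]) auto
  qed
  finally show ?thesis by simp
qed

text \<open>Equal tensors from different tuples count separately, so \<open>B'\<close> has to be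
  lifted to a set of tuples before averages over tuples apply to it.\<close>

lemma sub_image_mset_set:
  assumes "finite S" "M \<subseteq># image_mset f (mset_set S)"
  shows "\<exists>T\<subseteq>S. M = image_mset f (mset_set T)"
proof -
  obtain N where "image_mset f (mset_set S) = M + N" using assms(2) by (auto simp: subset_mset.le_iff_add)
  then obtain M' N' where M': "mset_set S = M' + N'" "M = image_mset f M'"
    by (meson image_mset_eq_plusD)
  have "M' = mset_set (set_mset M')"
  proof (rule multiset_eqI)
    fix x
    have "count M' x \<le> count (mset_set S) x" by (simp add: M'(1))
    also have "\<dots> \<le> 1" by (simp add: count_mset_set')
    finally have le: "count M' x \<le> 1" .
    show "count M' x = count (mset_set (set_mset M')) x"
    proof (cases "x \<in># M'")
      case True
      then have "count M' x = 1" using le by (metis count_greater_eq_one_iff le_antisym)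
      then show ?thesis using True by (simp add: count_mset_set')
    next
      case False
      then show ?thesis by (simp add: count_mset_set' not_in_iff)
    qed
  qed
  moreover have "set_mset M' \<subseteq> S"
    using M'(1) assms(1) by (metis finite_set_mset_mset_set set_mset_union Un_upper1)
  ultimately show ?thesis using M'(2) by metis
qed

section \<open>From almost closure to a dense coset\<close>

lemma fourier_indicator:
  assumes M: "finite M" and A: "A \<subseteq> vecs M" and t: "t \<in> vecs M"
  shows "(\<Sum>y\<in>vecs M. (fourier M (\<lambda>x. of_bool (x \<in> A)) y)\<^sup>2 * of_bool (dot M t y = 1)) =
    real (card (vecs M)) * (real (card A) - real (card {a\<in>A. a + t \<in> A})) / 2"
proof -
  let ?f = "\<lambda>x. of_bool (x \<in> A) :: real"
  have cnt: "(\<Sum>x\<in>vecs M. ?f x * ?f (x + s)) = real (card {a\<in>A. a + s \<in> A})" for s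
  proof -
    have "(\<Sum>x\<in>vecs M. ?f x * ?f (x + s)) = (\<Sum>x\<in>vecs M. of_bool (x \<in> {a\<in>A. a + s \<in> A}))"
      by (rule sum.cong) auto
    also have "\<dots> = real (card (vecs M \<inter> {a\<in>A. a + s \<in> A}))"
      using card_vecs(1)[OF M] by (simp add: of_bool_def sum.If_cases Int_def)
    also have "vecs M \<inter> {a\<in>A. a + s \<in> A} = {a\<in>A. a + s \<in> A}" using A by auto
    finally show ?thesis .
  qed
  \<comment> \<open>This splits the sum into the correlations of \<open>A\<close> with itself at
    shifts 0 and \<open>t\<close>.\<close>
  have e: "of_bool (b = 1) = (1 - sgn_char b) / 2" for b by (cases b) simp_all
  have "(\<Sum>y\<in>vecs M. (fourier M ?f y)\<^sup>2 * of_bool (dot M t y = 1)) =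
    (\<Sum>y\<in>vecs M. fourier M ?f y * fourier M ?f y * sgn_char (dot M 0 y) / 2 - fourier M ?f y * fourier M ?f y * sgn_char (dot M t y) / 2)"
    by (intro sum.cong refl) (simp add: e power2_eq_square field_simps)
  also have "\<dots> = (\<Sum>y\<in>vecs M. fourier M ?f y * fourier M ?f y * sgn_char (dot M 0 y)) / 2
     - (\<Sum>y\<in>vecs M. fourier M ?f y * fourier M ?f y * sgn_char (dot M t y)) / 2"
    by (simp only: sum_subtractf sum_divide_distrib)
  also have "\<dots> = real (card (vecs M)) * (real (card A) - real (card {a\<in>A. a + t \<in> A})) / 2"
    using sum_fourier_mult[OF M vecs_0, of ?f ?f] sum_fourier_mult[OF M t, of ?f ?f] cnt[of 0] cnt[of t]
    by (simp add: field_simps)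
  finally show ?thesis .
qed

text \<open>A frequency that is not forced to be orthogonal to \<open>C\<close> has product 1 with
  more than a proportion \<beta> of \<open>T\<close>. By Markov's inequality such frequencies carry
  at most \<theta> / 2 of the Fourier mass of \<open>A\<close>; the closure deficit is
  \<open>\<beta> * \<theta>\<close> so that \<beta> cancels here.\<close>

lemma closed_imp_dense_coset:
  fixes pt :: "'u \<Rightarrow> 'm \<Rightarrow> bit" and \<beta> \<theta> :: real
  assumes M: "finite M" and A: "A \<subseteq> vecs M" "A \<noteq> {}" and T: "finite T" "T \<noteq> {}" "pt ` T \<subseteq> vecs M"
    and C: "C \<subseteq> vecs M" and \<beta>: "\<beta> > 0"
    and cl: "(1 - \<beta> * \<theta>) * card A * card T \<le> (\<Sum>u\<in>T. card {a\<in>A. a + pt u \<in> A})"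
    and forced: "\<And>r t. r \<in> vecs M \<Longrightarrow> card {u\<in>T. dot M (pt u) r = 1} \<le> \<beta> * card T \<Longrightarrow> t \<in> C \<Longrightarrow> dot M t r = 0"
  shows "\<exists>a\<in>A. (1 - \<theta>) * card C \<le> card {t\<in>C. a + t \<in> A}"
proof -
  let ?G = "vecs M"
  define \<phi> where "\<phi> y = (fourier M (\<lambda>x. of_bool (x \<in> A)) y)\<^sup>2" for y
  define L where "L t = real (card A) - real (card {a\<in>A. a + t \<in> A})" for t
  have G: "finite ?G" "card ?G > 0" using M by (simp_all add: card_vecs(1))
  have fA: "finite A" "card A > 0" using A G finite_subset by (auto simp: card_gt_0_iff)
  have fC: "finite C" using C G finite_subset by blast
  have cT: "card T > 0" using T by (simp add: card_gt_0_iff)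
  have \<phi>0: "0 \<le> \<phi> y" for y by (simp add: \<phi>_def)
  have id: "(\<Sum>y\<in>?G. \<phi> y * of_bool (dot M t y = 1)) = card ?G * L t / 2" if "t \<in> ?G" for t
    unfolding \<phi>_def L_def by (rule fourier_indicator[OF M A(1) that])
  have swap: "(\<Sum>y\<in>?G. \<phi> y * card {u\<in>U. dot M (p u) y = 1}) = card ?G / 2 * (\<Sum>u\<in>U. L (p u))"
    if U: "finite U" "p ` U \<subseteq> ?G" for U :: "'c set" and p
  proof -
    have "(\<Sum>y\<in>?G. \<phi> y * card {u\<in>U. dot M (p u) y = 1}) = (\<Sum>y\<in>?G. \<Sum>u\<in>U. \<phi> y * of_bool (dot M (p u) y = 1))"
      using U(1) by (intro sum.cong refl) (simp add: of_bool_def sum.If_cases Int_def flip: sum_distrib_left)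
    also have "\<dots> = (\<Sum>u\<in>U. \<Sum>y\<in>?G. \<phi> y * of_bool (dot M (p u) y = 1))" by (rule sum.swap)
    also have "\<dots> = (\<Sum>u\<in>U. card ?G / 2 * L (p u))"
      using U(2) by (intro sum.cong refl) (simp add: id image_subset_iff)
    finally show ?thesis by (simp add: sum_distrib_left)
  qed
  define bad where "bad = {r\<in>?G. \<not> card {u\<in>T. dot M (pt u) r = 1} \<le> \<beta> * card T}"
  have "sum \<phi> bad * (\<beta> * card T) = (\<Sum>y\<in>bad. \<phi> y * (\<beta> * card T))" by (rule sum_distrib_right)
  also have "\<dots> \<le> (\<Sum>y\<in>bad. \<phi> y * card {u\<in>T. dot M (pt u) y = 1})"
    by (intro sum_mono mult_left_mono \<phi>0) (auto simp: bad_def)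
  also have "\<dots> \<le> (\<Sum>y\<in>?G. \<phi> y * card {u\<in>T. dot M (pt u) y = 1})"
    using G \<phi>0 by (intro sum_mono2) (auto simp: bad_def)
  also have "\<dots> = card ?G / 2 * (\<Sum>u\<in>T. L (pt u))" by (rule swap[OF T(1,3)])
  also have "\<dots> \<le> card ?G / 2 * (\<beta> * \<theta> * card A * card T)"
    using cl by (intro mult_left_mono) (auto simp: L_def sum_subtractf algebra_simps)
  finally have "sum \<phi> bad * (\<beta> * card T) \<le> (card ?G / 2 * (\<theta> * card A)) * (\<beta> * card T)" by (simp add: mult_ac)
  then have bad: "sum \<phi> bad \<le> card ?G / 2 * (\<theta> * card A)"
    using \<beta> cT by (simp add: mult_le_cancel_right)
  \<comment> \<open>The same identity read for \<open>C\<close>: only bad frequencies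
    contribute.\<close>
  have "card ?G / 2 * (\<Sum>t\<in>C. L t) = (\<Sum>y\<in>?G. \<phi> y * card {t\<in>C. dot M t y = 1})"
    using swap[of C "\<lambda>t. t"] fC C by simp
  also have "\<dots> \<le> (\<Sum>y\<in>?G. if y \<in> bad then \<phi> y * card C else 0)"
  proof (rule sum_mono)
    fix y assume y: "y \<in> ?G"
    show "\<phi> y * card {t\<in>C. dot M t y = 1} \<le> (if y \<in> bad then \<phi> y * card C else 0)"
    proof (cases "y \<in> bad")
      case True
      then show ?thesis using fC \<phi>0 by (auto intro!: mult_left_mono card_mono)
    next
      case False
      then have "dot M t y = 0" if "t \<in> C" for t using forced[OF y _ that] y by (auto simp: bad_def)
      then have e: "{t\<in>C. dot M t y = 1} = {}" by auto
      show ?thesis using False unfolding e by simp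
    qed
  qed
  also have "\<dots> = sum \<phi> bad * card C"
  proof -
    have "?G \<inter> bad = bad" by (auto simp: bad_def)
    then show ?thesis using G by (simp add: sum.If_cases sum_distrib_right)
  qed
  also have "\<dots> \<le> card ?G / 2 * (\<theta> * card A) * card C" using bad by (intro mult_right_mono) auto
  finally have "card ?G / 2 * (\<Sum>t\<in>C. L t) \<le> card ?G / 2 * (\<theta> * card A * card C)" by (simp add: mult_ac)
  then have "(\<Sum>t\<in>C. L t) \<le> \<theta> * card A * card C" using G by (simp add: mult_le_cancel_left)
  then have "(1 - \<theta>) * card A * card C \<le> (\<Sum>t\<in>C. real (card {a\<in>A. a + t \<in> A}))"
    by (simp add: L_def sum_subtractf algebra_simps)
  also have "\<dots> = (\<Sum>a\<in>A. real (card {t\<in>C. a + t \<in> A}))"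
  proof -
    have "(\<Sum>t\<in>C. real (card {a\<in>A. a + t \<in> A})) = (\<Sum>t\<in>C. \<Sum>a\<in>A. of_bool (a + t \<in> A))"
      using fA by (simp add: of_bool_def sum.If_cases Int_def)
    also have "\<dots> = (\<Sum>a\<in>A. \<Sum>t\<in>C. of_bool (a + t \<in> A))" by (rule sum.swap)
    also have "\<dots> = (\<Sum>a\<in>A. real (card {t\<in>C. a + t \<in> A}))"
      using fC by (simp add: of_bool_def sum.If_cases Int_def)
    finally show ?thesis .
  qed
  finally have fin: "(1 - \<theta>) * card A * card C \<le> (\<Sum>a\<in>A. real (card {t\<in>C. a + t \<in> A}))" .
  show ?thesis
  proof (rule ccontr)
    assume "\<not> ?thesis"
    then have "(\<Sum>a\<in>A. real (card {t\<in>C. a + t \<in> A})) < (\<Sum>a\<in>A. (1 - \<theta>) * card C)"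
      using fA A(2) by (intro sum_strict_mono) (auto simp: not_le)
    then show False using fin by (simp add: mult_ac)
  qed
qed

theorem theorem1p10:
  fixes d :: nat
  assumes "d \<ge> 1"
  shows "\<exists>(\<epsilon> :: real \<Rightarrow> real) (k :: real \<Rightarrow> nat).
    (\<forall>\<theta>>0. \<epsilon> \<theta> > 0) \<and> (\<forall>\<delta>>0. k \<delta> > 0) \<and>
    (\<forall>\<theta>>0. \<forall>\<delta>>0. \<forall>n :: nat \<Rightarrow> nat. (\<forall>i\<in>{1..d}. n i > 0) \<longrightarrow>
      (\<forall>B' A. B' \<subseteq># pure_tensors d n \<and>
        real (size B') \<ge> \<delta> * real (size (pure_tensors d n)) \<and>
        A \<subseteq> tensor_space n {1..d} \<and> closed_wrt B' (1 - \<epsilon> \<theta>) A \<longrightarrow>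
        (\<exists>D. simple_set d n (k \<delta>) D \<and>
          real (card (D \<inter> A)) \<ge> (1 - \<theta>) * real (card D))))"
proof -
  obtain \<beta> where \<beta>: "\<beta> > 0" and F: "\<forall>\<delta>>0. \<exists>K. \<forall>n J \<nu>. finite J \<and> card J = d \<and>
    (\<forall>u\<in>tuples n J. 0 \<le> \<nu> u \<and> \<nu> u \<le> 1) \<and> \<delta> \<le> mean n J \<nu> \<longrightarrow> (\<exists>V. confines n J K \<beta> \<nu> V)"
    using dense_confines[of d] by (elim exE conjE) (rule that)
  then have "\<exists>K. \<forall>\<delta>. \<delta> > 0 \<longrightarrow> (\<forall>n J \<nu>. finite J \<and> card J = d \<and>
    (\<forall>u\<in>tuples n J. 0 \<le> \<nu> u \<and> \<nu> u \<le> 1) \<and> \<delta> \<le> mean n J \<nu> \<longrightarrow> (\<exists>V. confines n J (K \<delta>) \<beta> \<nu> V))"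
    by (intro choice) (simp only: ex_simps)
  then obtain K where K: "\<forall>\<delta>. \<delta> > 0 \<longrightarrow> (\<forall>n J \<nu>. finite J \<and> card J = d \<and>
    (\<forall>u\<in>tuples n J. 0 \<le> \<nu> u \<and> \<nu> u \<le> 1) \<and> \<delta> \<le> mean n J \<nu> \<longrightarrow> (\<exists>V. confines n J (K \<delta>) \<beta> \<nu> V))"
    by (elim exE)
  \<comment> \<open>The summand 1 makes the codimension bound positive.\<close>
  have main: "\<exists>D. simple_set d n (K \<delta> + 1) D \<and> real (card (D \<inter> A)) \<ge> (1 - \<theta>) * real (card D)"
    if \<delta>: "\<delta> > 0" and B': "B' \<subseteq># pure_tensors d n"
      "real (size B') \<ge> \<delta> * real (size (pure_tensors d n))"
      and A: "A \<subseteq> tensor_space n {1..d}" and cl: "closed_wrt B' (1 - \<beta> * \<theta>) A"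
    for \<theta> \<delta> :: real and n B' A
  proof -
    define J where "J = {1..d}"
    have J: "finite J" "card J = d" "J \<noteq> {}" using assms by (auto simp: J_def)
    define M where "M = multi_idx n J"
    have M: "finite M" using J by (simp add: M_def multi_idx_finite)
    have XJ: "tuples n J = (\<Pi>\<^sub>E i\<in>{1..d}. coord_space (n i))" by (simp add: tuples_def J_def coord_space_vecs)
    have pts: "pure_tensors d n = image_mset (pure_tensor n J) (mset_set (tuples n J))"
      by (simp only: pure_tensors_def XJ) (simp only: J_def)
    have fX: "finite (tuples n J)" using J by (simp add: tuples_finite)
    obtain T where T: "T \<subseteq> tuples n J" "B' = image_mset (pure_tensor n J) (mset_set T)"
      using sub_image_mset_set[OF fX] B'(1) unfolding pts by blast
    have fT: "finite T" using T(1) fX finite_subset by blast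
    have sB: "size B' = card T" by (simp add: T(2))
    have cA: "finite A" "A \<noteq> {}" "B' \<noteq> {#}" using cl by (auto simp: closed_wrt_def)
    then have T0: "T \<noteq> {}" using T(2) by auto
    have avgT: "mean n J (\<lambda>u. of_bool (u \<in> T) * of_bool (Q u)) = card {u\<in>T. Q u} / card (tuples n J)" for Q
    proof -
      have "(\<Sum>u\<in>tuples n J. of_bool (u \<in> T) * of_bool (Q u) :: real) = (\<Sum>u\<in>tuples n J. of_bool (u \<in> {u\<in>T. Q u}))"
        by (rule sum.cong) auto
      also have "\<dots> = real (card (tuples n J \<inter> {u\<in>T. Q u}))"
        using fX by (simp add: of_bool_def sum.If_cases Int_def)
      also have "tuples n J \<inter> {u\<in>T. Q u} = {u\<in>T. Q u}" using T(1) by auto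
      finally show ?thesis by (simp add: mean_def)
    qed
    have avT: "mean n J (\<lambda>u. of_bool (u \<in> T)) = card T / card (tuples n J)" using avgT[of "\<lambda>_. True"] by simp
    have cX: "card (tuples n J) > 0" using J by (simp add: tuples_card)
    have "\<delta> \<le> mean n J (\<lambda>u. of_bool (u \<in> T))"
      using B'(2) cX unfolding avT by (simp add: pts sB pos_le_divide_eq)
    then have "finite J \<and> card J = d \<and> (\<forall>u\<in>tuples n J. 0 \<le> (of_bool (u \<in> T) :: real) \<and> (of_bool (u \<in> T) :: real) \<le> 1) \<and>
      \<delta> \<le> mean n J (\<lambda>u. of_bool (u \<in> T))" using J by simp
    with K[THEN spec, THEN mp, OF \<delta>, THEN spec, of n, THEN spec, of J, THEN spec, of "\<lambda>u. of_bool (u \<in> T)"]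
    have "\<exists>V. confines n J (K \<delta>) \<beta> (\<lambda>u. of_bool (u \<in> T)) V" by (rule mp)
    then obtain V where V: "bounded_forms n (K \<delta>) V" and VW: "\<And>r. mlform n J r \<Longrightarrow>
      mean n J (\<lambda>u. of_bool (u \<in> T) * of_bool (r u = 1)) \<le> \<beta> * mean n J (\<lambda>u. of_bool (u \<in> T)) \<Longrightarrow> r \<in> structured n J V"
      unfolding confines_def by blast
    define C where "C = (\<Inter>I\<in>{I. I \<subseteq> {1..d} \<and> I \<noteq> {}}.
      tensor_subspaces n I ({1..d} - I) (annihilator n V I) (tensor_space n ({1..d} - I)))"
    have CM: "C \<subseteq> vecs M"
    proof -
      \<comment> \<open>The index set \<open>J\<close> itself takes part in the intersection because
        \<open>d \<ge> 1\<close>.\<close>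
      have "C \<subseteq> tensor_subspaces n J (J - J) (annihilator n V J) (tensor_space n (J - J))"
        unfolding C_def J_def by (rule INT_lower) (use J(3) in \<open>simp add: J_def\<close>)
      also have "\<dots> \<subseteq> vecs M"
        unfolding tensor_subspaces_def
        by (intro fun_vs.span_minimal vecs_subspace) (auto simp: tensor_mult_def vecs_def M_def)
      finally show ?thesis .
    qed
    have "\<exists>a\<in>A. (1 - \<theta>) * card C \<le> card {t\<in>C. a + t \<in> A}"
    proof (rule closed_imp_dense_coset[OF M _ cA(2) fT T0 _ CM \<beta>])
      show "A \<subseteq> vecs M" using A by (simp add: M_def J_def tensor_space_vecs)
      show "pure_tensor n J ` T \<subseteq> vecs M" by (auto simp: pure_tensor_def vecs_def M_def)
      have "(\<Sum>b\<in>#B'. card {a\<in>A. a + b \<in> A}) = (\<Sum>u\<in>T. card {a\<in>A. a + pure_tensor n J u \<in> A})"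
        by (simp add: T(2) sum_unfold_sum_mset image_mset.compositionality comp_def)
      then show "(1 - \<beta> * \<theta>) * card A * card T \<le> (\<Sum>u\<in>T. card {a\<in>A. a + pure_tensor n J u \<in> A})"
        using cl by (simp add: closed_wrt_def sB)
      fix r t
      assume r: "r \<in> vecs M" and few: "card {u\<in>T. dot M (pure_tensor n J u) r = 1} \<le> \<beta> * card T" and t: "t \<in> C"
      have "(\<lambda>u. dot M r (pure_tensor n J u)) \<in> structured n J V"
      proof (rule VW)
        show "mlform n J (\<lambda>u. dot M r (pure_tensor n J u))" unfolding M_def by (rule mlform_pure_tensor[OF J(1)])
        have "real (card {u\<in>T. dot M r (pure_tensor n J u) = 1}) / card (tuples n J) \<le> \<beta> * card T / card (tuples n J)"
          using few by (intro divide_right_mono) (simp_all add: dot_commute)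
        then show "mean n J (\<lambda>u. of_bool (u \<in> T) * of_bool (dot M r (pure_tensor n J u) = 1))
          \<le> \<beta> * mean n J (\<lambda>u. of_bool (u \<in> T))"
          unfolding avgT avT by simp
      qed
      then show "dot M t r = 0"
        unfolding M_def
      proof (rule structured_annihilator[OF J(1) V])
        fix I assume "I \<subseteq> J" "I \<noteq> {}"
        then show "t \<in> tensor_subspaces n I (J - I) (annihilator n V I) (tensor_space n (J - I))"
          using t unfolding C_def J_def by blast
      qed
    qed
    then obtain a where a: "a \<in> A" "(1 - \<theta>) * card C \<le> card {t\<in>C. a + t \<in> A}" by blast
    define D where "D = (\<lambda>x. a + x) ` C"
    have inj: "inj_on (\<lambda>x. a + x) S" for S by (simp add: inj_on_def)
    have "D \<inter> A = (\<lambda>x. a + x) ` {t\<in>C. a + t \<in> A}" by (auto simp: D_def)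
    then have "card (D \<inter> A) = card {t\<in>C. a + t \<in> A}" using card_image[OF inj] by simp
    moreover have "card D = card C" unfolding D_def by (rule card_image[OF inj])
    moreover have "simple_set d n (K \<delta> + 1) D"
      unfolding simple_set_def
    proof (intro exI[of _ "annihilator n V"] exI[of _ a] conjI allI impI)
      show "a \<in> tensor_space n {1..d}" using a(1) A by blast
      show "D = (\<lambda>x. a + x) ` (\<Inter>I\<in>{I. I \<subseteq> {1..d} \<and> I \<noteq> {}}.
        tensor_subspaces n I ({1..d} - I) (annihilator n V I) (tensor_space n ({1..d} - I)))"
        by (simp only: D_def C_def)
      fix I assume I: "I \<subseteq> {1..d} \<and> I \<noteq> {}"
      then have fI: "finite I" using finite_subset by blast
      show "annihilator n V I \<subseteq> tensor_space n I" by (auto simp: annihilator_def tensor_space_vecs)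
      show "fun_vs.subspace (annihilator n V I)" by (rule annihilator_subspace)
      have fV: "finite (V I)" "card (V I) \<le> K \<delta>" using V by (auto simp: bounded_forms_def)
      have "fun_vs.dim (vecs (multi_idx n I)) \<le> fun_vs.dim (annihilator n V I) + card ((\<lambda>f m. f (unit_tup m)) ` V I)"
        unfolding annihilator_def using fV by (intro codim_kernel multi_idx_finite fI) auto
      also have "card ((\<lambda>f m. f (unit_tup m)) ` V I) \<le> K \<delta>"
        using card_image_le[OF fV(1)] fV(2) order_trans by blast
      finally show "int (fun_vs.dim (tensor_space n I)) - int (fun_vs.dim (annihilator n V I)) \<le> int (K \<delta> + 1)"
        by (simp add: tensor_space_vecs)
    qed
    ultimately show ?thesis using a(2) by (intro exI[of _ D]) simp
  qed
  show ?thesis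
  proof (intro exI[of _ "\<lambda>\<theta>. \<beta> * \<theta>"] exI[of _ "\<lambda>\<delta>. K \<delta> + 1"] conjI allI impI)
    fix \<theta> \<delta> :: real and n B' A
    assume "\<delta> > 0" and "B' \<subseteq># pure_tensors d n \<and> \<delta> * real (size (pure_tensors d n)) \<le> real (size B') \<and>
      A \<subseteq> tensor_space n {1..d} \<and> closed_wrt B' (1 - \<beta> * \<theta>) A"
    then show "\<exists>D. simple_set d n (K \<delta> + 1) D \<and> (1 - \<theta>) * real (card D) \<le> real (card (D \<inter> A))"
      using main[of \<delta> B' n A \<theta>] by blast
  qed (use \<beta> in auto)
qed

end
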